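(* Let $k\ge1$ be an integer, let $E\subset\mathbb{R}^2$ be a polygon, let $S$ be an integer with $\frac{(k+1)(k+2)}{2}\le S\le N_E$, and suppose the degrees of freedom of $V_{k,k}(E)$ are ordered as $\delta_1,\dots,\delta_{N_E}$ in such a way that $\delta_1,\dots,\delta_S$ contain all the boundary degrees of freedom and satisfy property $\mathscr{S}$: every $p\in\mathbb{P}_k(E)$ with $\delta_1(p)=\dots=\delta_S(p)=0$ is identically zero. Let $\Pi^{\mathcal S}_k:V_{k,k}(E)\to\mathbb{P}_k(E)$ be the associated operator, and let $$V^S_k(E)=\{\varphi\in V_{k,k}(E):\ \delta_r(\varphi)=\delta_r(\Pi^{\mathcal S}_k\varphi)\ \ \forall\, r=S+1,\dots,N_E\}$$ be the Serendipity virtual element space. Then: (i) the dimension of $V^S_k(E)$ is $S$; (ii) $\delta_1,\dots,\delta_S$ is a unisolvent set of degrees of freedom for $V^S_k(E)$; (iii) $\mathbb{P}_k(E)\subseteq V^S_k(E)$; (iv) the $L^2(E)$-orthogonal projection $\Pi^0_k$ onto $\mathbb{P}_k(E)$ is computable on $V^S_k(E)$ from the degrees of freedom $\delta_1,\dots,\delta_S$.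
   Context: $\mathbb{P}_k(\mathcal{O})$ denotes the polynomials of degree $\le k$ restricted to $\mathcal{O}$ (in two variables on $E$, in one variable on an edge $e$), with $\mathbb{P}_{-1}=\{0\}$. $E$ is a polygon with diameter $h_E$ satisfying the standing assumption that, for some $\rho_0>0$, $E$ is star-shaped with respect to all the points of a ball of radius $\rho_0 h_E$ and every edge $e$ of $E$ has length $|e|\ge\rho_0 h_E$. The space is $V_{k,k}(E)=\{\varphi\in C^0(\overline{E}):\ \varphi_{|e}\in\mathbb{P}_k(e)\ \text{for every edge } e,\ \Delta\varphi\in\mathbb{P}_k(E)\}$. Its degrees of freedom are: (1) the values of $\varphi$ at the vertices; (2) the edge moments $\int_e\varphi\,q\,ds$ for $q$ in a basis of $\mathbb{P}_{k-2}(e)$, for every edge $e$; (3) the internal moments $\int_E\varphi\,q\,dE$ for $q$ in a basis of $\mathbb{P}_k(E)$. Those in (1) and (2) are called the boundary degrees of freedom. If $E$ has $N_e$ edges, the total number of degrees of freedom is $N_E=kN_e+\frac{(k+1)(k+2)}{2}=\dim V_{k,k}(E)$, and they are unisolvent for $V_{k,k}(E)$. The operator $\Pi^{\mathcal S}_k$: put $\mathcal{D}\varphi=(\delta_1(\varphi),\dots,\delta_S(\varphi))\in\mathbb{R}^S$ and let $(\cdot,\cdot)_{\mathbb{R}^S}$ be the Euclidean scalar product (or any symmetric positive definite bilinear form) on $\mathbb{R}^S$; then $\Pi^{\mathcal S}_k\varphi$ is the unique element of $\mathbb{P}_k(E)$ with $(\mathcal{D}(\Pi^{\mathcal S}_k\varphi-\varphi),\mathcal{D}q)_{\mathbb{R}^S}=0$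 for all $q\in\mathbb{P}_k(E)$. It is linear, depends on $\varphi$ only through $\delta_1(\varphi),\dots,\delta_S(\varphi)$, and is the identity on $\mathbb{P}_k(E)$. A set of $S$ linear functionals is unisolvent for a space $V$ if $v\mapsto(\delta_1(v),\dots,\delta_S(v))$ is a bijection $V\to\mathbb{R}^S$. In (iv), "computable" means that for each $\varphi\in V^S_k(E)$ all the moments $\int_E\varphi\,q\,dE$, $q\in\mathbb{P}_k(E)$, hence $\Pi^0_k\varphi$, are obtained linearly from $\delta_1(\varphi),\dots,\delta_S(\varphi)$, each moment in (3) being either one of $\delta_1(\varphi),\dots,\delta_S(\varphi)$ or equal to the corresponding moment of the polynomial $\Pi^{\mathcal S}_k\varphi$. *)

theory Defs
  imports "HOL-Analysis.Analysis" "HOL-Library.Function_Algebras"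
    "HOL-Computational_Algebra.Polynomial"
begin

type_synonym plane = "real \<times> real"

section \<open>Spaces of functions\<close>

text \<open>With pointwise scaling, spaces of real functions can use the library's
  \<open>span\<close>, \<open>independent\<close>, \<open>subspace\<close> and \<open>dim\<close>.\<close>

instantiation "fun" :: (type, real_vector) real_vector
begin

definition scaleR_fun_def: "c *\<^sub>R f = (\<lambda>x. c *\<^sub>R f x)"

instance
  by standard (auto simp: scaleR_fun_def fun_eq_iff algebra_simps)

end

text \<open>A function on \<open>D\<close> is represented by its extension by zero outside \<open>D\<close>,
  so that equality of representatives is equality on \<open>D\<close>.\<close>

definition restr :: "'a set \<Rightarrow> ('a \<Rightarrow> real) \<Rightarrow> 'a \<Rightarrow> real" where
  "restr D f = (\<lambda>x. if x \<in> D then f x else 0)"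

definition is_basis :: "'a::real_vector set \<Rightarrow> 'a set \<Rightarrow> bool" where
  "is_basis B V \<longleftrightarrow> independent B \<and> span B = V"

definition linear_functional_on :: "'a::real_vector set \<Rightarrow> ('a \<Rightarrow> real) \<Rightarrow> bool" where
  "linear_functional_on V f \<longleftrightarrow>
     (\<forall>u\<in>V. \<forall>v\<in>V. f (u + v) = f u + f v) \<and> (\<forall>c. \<forall>u\<in>V. f (c *\<^sub>R u) = c * f u)"

section \<open>Polynomials\<close>

definition poly_fun2 :: "nat \<Rightarrow> (plane \<Rightarrow> real) set" where
  "poly_fun2 k =
     {f. \<exists>c :: nat \<Rightarrow> nat \<Rightarrow> real. \<forall>x y. f (x, y) = (\<Sum>(i, j) | i + j \<le> k. c i j * x ^ i * y ^ j)}"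

definition Pk :: "nat \<Rightarrow> plane set \<Rightarrow> (plane \<Rightarrow> real) set" where
  "Pk k D = restr D ` poly_fun2 k"

text \<open>The degree bound is an integer because the moments on an edge use degree \<open>k - 2\<close>,
  which is \<open>-1\<close> (zero space) for \<open>k = 1\<close>. The variable is the affine parameter on
  \<open>[0,1]\<close>, a fixed nonzero multiple of arc length.\<close>

definition Pk_edge :: "int \<Rightarrow> plane \<Rightarrow> plane \<Rightarrow> (plane \<Rightarrow> real) set" where
  "Pk_edge m a b =
     {f. (\<forall>x. x \<notin> closed_segment a b \<longrightarrow> f x = 0) \<and>
         (\<exists>p :: real poly. (p = 0 \<or> int (degree p) \<le> m) \<and>
            (\<forall>t\<in>{0..1}. f (linepath a b t) = poly p t))}"

section \<open>Polygons\<close>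

definition edge_end :: "plane list \<Rightarrow> nat \<Rightarrow> plane" where
  "edge_end vs i = vs ! (Suc i mod length vs)"

definition edge :: "plane list \<Rightarrow> nat \<Rightarrow> plane set" where
  "edge vs i = closed_segment (vs ! i) (edge_end vs i)"

text \<open>Two edges may meet only in vertices they share as end points; consecutive edges may
  be aligned. \<open>E\<close> is the open region enclosed by the edges.\<close>

definition polygon :: "plane set \<Rightarrow> plane list \<Rightarrow> bool" where
  "polygon E vs \<longleftrightarrow>
     3 \<le> length vs \<and> distinct vs \<and>
     (\<forall>i<length vs. \<forall>j<length vs. i \<noteq> j \<longrightarrow>
        edge vs i \<inter> edge vs j = {vs ! i, edge_end vs i} \<inter> {vs ! j, edge_end vs j}) \<and>
     E = inside (\<Union>i<length vs. edge vs i)"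

definition shape_regular :: "real \<Rightarrow> plane set \<Rightarrow> plane list \<Rightarrow> bool" where
  "shape_regular \<rho>\<^sub>0 E vs \<longleftrightarrow>
     0 < \<rho>\<^sub>0 \<and>
     (\<exists>c. \<forall>x\<in>ball c (\<rho>\<^sub>0 * diameter E). x \<in> E \<and> (\<forall>y\<in>E. closed_segment x y \<subseteq> E)) \<and>
     (\<forall>i<length vs. \<rho>\<^sub>0 * diameter E \<le> dist (vs ! i) (edge_end vs i))"

section \<open>The Laplacian in the sense of distributions\<close>

definition partial_deriv :: "plane \<Rightarrow> (plane \<Rightarrow> real) \<Rightarrow> plane \<Rightarrow> real" where
  "partial_deriv v f = (\<lambda>x. frechet_derivative f (at x) v)"

primrec C_diff :: "nat \<Rightarrow> (plane \<Rightarrow> real) \<Rightarrow> bool" where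
  "C_diff 0 f \<longleftrightarrow> continuous_on UNIV f"
| "C_diff (Suc m) f \<longleftrightarrow>
     (\<forall>x. f differentiable (at x)) \<and>
     C_diff m (partial_deriv (1, 0) f) \<and> C_diff m (partial_deriv (0, 1) f)"

definition test_functions :: "plane set \<Rightarrow> (plane \<Rightarrow> real) set" where
  "test_functions E =
     {\<psi>. (\<forall>m. C_diff m \<psi>) \<and> (\<exists>K. compact K \<and> K \<subseteq> E \<and> (\<forall>x. x \<notin> K \<longrightarrow> \<psi> x = 0))}"

definition laplacian :: "(plane \<Rightarrow> real) \<Rightarrow> plane \<Rightarrow> real" where
  "laplacian f = (\<lambda>x. partial_deriv (1, 0) (partial_deriv (1, 0) f) x +
                      partial_deriv (0, 1) (partial_deriv (0, 1) f) x)"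

definition has_weak_laplacian ::
    "plane set \<Rightarrow> (plane \<Rightarrow> real) \<Rightarrow> (plane \<Rightarrow> real) \<Rightarrow> bool" where
  "has_weak_laplacian E \<phi> g \<longleftrightarrow>
     (\<forall>\<psi>\<in>test_functions E.
        (LINT x:E|lborel. \<phi> x * laplacian \<psi> x) = (LINT x:E|lborel. g x * \<psi> x))"

section \<open>The space and its degrees of freedom\<close>

definition Vkk :: "nat \<Rightarrow> plane set \<Rightarrow> plane list \<Rightarrow> (plane \<Rightarrow> real) set" where
  "Vkk k E vs =
     {\<phi>. (\<forall>x. x \<notin> closure E \<longrightarrow> \<phi> x = 0) \<and> continuous_on (closure E) \<phi> \<and>
         (\<forall>i<length vs. restr (edge vs i) \<phi> \<in> Pk_edge (int k) (vs ! i) (edge_end vs i)) \<and>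
         (\<exists>g\<in>Pk k E. has_weak_laplacian E \<phi> g)}"

datatype dof =
    Vertex nat
  | EdgeMoment nat "plane \<Rightarrow> real"
  | InternalMoment "plane \<Rightarrow> real"

definition moment :: "plane set \<Rightarrow> (plane \<Rightarrow> real) \<Rightarrow> (plane \<Rightarrow> real) \<Rightarrow> real" where
  "moment E \<phi> q = (LINT x:E|lborel. \<phi> x * q x)"

text \<open>The factor \<open>dist a b\<close> turns the integral over the affine parameter into the
  arc length integral.\<close>

definition edge_moment ::
    "plane \<Rightarrow> plane \<Rightarrow> (plane \<Rightarrow> real) \<Rightarrow> (plane \<Rightarrow> real) \<Rightarrow> real" where
  "edge_moment a b \<phi> q =
     dist a b * (LINT t:{0..1}|lborel. \<phi> (linepath a b t) * q (linepath a b t))"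

fun dof_value :: "plane set \<Rightarrow> plane list \<Rightarrow> dof \<Rightarrow> (plane \<Rightarrow> real) \<Rightarrow> real" where
  "dof_value E vs (Vertex i) \<phi> = \<phi> (vs ! i)"
| "dof_value E vs (EdgeMoment i q) \<phi> = edge_moment (vs ! i) (edge_end vs i) \<phi> q"
| "dof_value E vs (InternalMoment q) \<phi> = moment E \<phi> q"

definition boundary_dofs :: "plane list \<Rightarrow> (nat \<Rightarrow> (plane \<Rightarrow> real) set) \<Rightarrow> dof set" where
  "boundary_dofs vs Be =
     Vertex ` {..<length vs} \<union> (\<Union>i<length vs. EdgeMoment i ` Be i)"

definition all_dofs ::
    "plane list \<Rightarrow> (nat \<Rightarrow> (plane \<Rightarrow> real) set) \<Rightarrow> (plane \<Rightarrow> real) set \<Rightarrow> dof set" where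
  "all_dofs vs Be Bi = boundary_dofs vs Be \<union> InternalMoment ` Bi"

definition num_dofs :: "nat \<Rightarrow> plane list \<Rightarrow> nat" where
  "num_dofs k vs = k * length vs + (k + 1) * (k + 2) div 2"

text \<open>\<open>\<delta> 1, \<dots>, \<delta> N\<close> are the degrees of freedom, enumerated by \<open>\<sigma>\<close>, for the bases \<open>Be i\<close> of
  the moment spaces on the edges and \<open>Bi\<close> of the internal moment space.\<close>

definition dof_ordering ::
    "nat \<Rightarrow> plane set \<Rightarrow> plane list \<Rightarrow> (nat \<Rightarrow> (plane \<Rightarrow> real) set) \<Rightarrow> (plane \<Rightarrow> real) set \<Rightarrow>
     (nat \<Rightarrow> dof) \<Rightarrow> (nat \<Rightarrow> (plane \<Rightarrow> real) \<Rightarrow> real) \<Rightarrow> bool" where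
  "dof_ordering k E vs Be Bi \<sigma> \<delta> \<longleftrightarrow>
     (\<forall>i<length vs. is_basis (Be i) (Pk_edge (int k - 2) (vs ! i) (edge_end vs i))) \<and>
     is_basis Bi (Pk k (closure E)) \<and>
     bij_betw \<sigma> {1..num_dofs k vs} (all_dofs vs Be Bi) \<and>
     (\<forall>r\<in>{1..num_dofs k vs}. \<delta> r = dof_value E vs (\<sigma> r))"

section \<open>Serendipity\<close>

definition property_S ::
    "nat \<Rightarrow> plane set \<Rightarrow> nat \<Rightarrow> (nat \<Rightarrow> (plane \<Rightarrow> real) \<Rightarrow> real) \<Rightarrow> bool" where
  "property_S k E S \<delta> \<longleftrightarrow>
     (\<forall>p\<in>Pk k (closure E). (\<forall>r\<in>{1..S}. \<delta> r p = 0) \<longrightarrow> p = 0)"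

definition RS :: "nat \<Rightarrow> (nat \<Rightarrow> real) set" where
  "RS S = {u. \<forall>r. r \<notin> {1..S} \<longrightarrow> u r = 0}"

definition dof_vector ::
    "nat \<Rightarrow> (nat \<Rightarrow> (plane \<Rightarrow> real) \<Rightarrow> real) \<Rightarrow> (plane \<Rightarrow> real) \<Rightarrow> nat \<Rightarrow> real" where
  "dof_vector S \<delta> \<phi> = (\<lambda>r. if r \<in> {1..S} then \<delta> r \<phi> else 0)"

definition spd_form :: "nat \<Rightarrow> ((nat \<Rightarrow> real) \<Rightarrow> (nat \<Rightarrow> real) \<Rightarrow> real) \<Rightarrow> bool" where
  "spd_form S b \<longleftrightarrow>
     (\<forall>w\<in>RS S. linear_functional_on (RS S) (\<lambda>u. b u w)) \<and>
     (\<forall>u\<in>RS S. \<forall>w\<in>RS S. b u w = b w u) \<and>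
     (\<forall>u\<in>RS S. u \<noteq> 0 \<longrightarrow> 0 < b u u)"

definition PiS ::
    "nat \<Rightarrow> plane set \<Rightarrow> nat \<Rightarrow> (nat \<Rightarrow> (plane \<Rightarrow> real) \<Rightarrow> real) \<Rightarrow>
     ((nat \<Rightarrow> real) \<Rightarrow> (nat \<Rightarrow> real) \<Rightarrow> real) \<Rightarrow> (plane \<Rightarrow> real) \<Rightarrow> plane \<Rightarrow> real" where
  "PiS k E S \<delta> b \<phi> =
     (THE p. p \<in> Pk k (closure E) \<and>
        (\<forall>q\<in>Pk k (closure E). b (dof_vector S \<delta> (p - \<phi>)) (dof_vector S \<delta> q) = 0))"

definition VS ::
    "nat \<Rightarrow> plane set \<Rightarrow> plane list \<Rightarrow> nat \<Rightarrow> (nat \<Rightarrow> (plane \<Rightarrow> real) \<Rightarrow> real) \<Rightarrow>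
     ((nat \<Rightarrow> real) \<Rightarrow> (nat \<Rightarrow> real) \<Rightarrow> real) \<Rightarrow> (plane \<Rightarrow> real) set" where
  "VS k E vs S \<delta> b =
     {\<phi>\<in>Vkk k E vs. \<forall>r\<in>{S + 1..num_dofs k vs}. \<delta> r \<phi> = \<delta> r (PiS k E S \<delta> b \<phi>)}"

definition unisolvent ::
    "nat \<Rightarrow> (nat \<Rightarrow> (plane \<Rightarrow> real) \<Rightarrow> real) \<Rightarrow> (plane \<Rightarrow> real) set \<Rightarrow> bool" where
  "unisolvent S \<delta> V \<longleftrightarrow>
     (\<forall>r\<in>{1..S}. linear_functional_on V (\<delta> r)) \<and> bij_betw (dof_vector S \<delta>) V (RS S)"

definition Pi0 :: "nat \<Rightarrow> plane set \<Rightarrow> (plane \<Rightarrow> real) \<Rightarrow> plane \<Rightarrow> real" where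
  "Pi0 k E \<phi> =
     (THE p. p \<in> Pk k (closure E) \<and> (\<forall>q\<in>Pk k (closure E). moment E (p - \<phi>) q = 0))"

text \<open>All moments and the projection are given by fixed linear formulas in
  \<open>\<delta> 1, \<dots>, \<delta> S\<close>, and each internal degree of freedom is one of these or the corresponding
  moment of the polynomial \<open>PiS\<close>, itself given by such a formula.\<close>

definition Pi0_computable ::
    "nat \<Rightarrow> plane set \<Rightarrow> plane list \<Rightarrow> (plane \<Rightarrow> real) set \<Rightarrow> (nat \<Rightarrow> dof) \<Rightarrow> nat \<Rightarrow>
     (nat \<Rightarrow> (plane \<Rightarrow> real) \<Rightarrow> real) \<Rightarrow> ((nat \<Rightarrow> real) \<Rightarrow> (nat \<Rightarrow> real) \<Rightarrow> real) \<Rightarrow> bool" where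
  "Pi0_computable k E vs Bi \<sigma> S \<delta> b \<longleftrightarrow>
     (\<forall>q\<in>Pk k (closure E). \<exists>c :: nat \<Rightarrow> real. \<forall>\<phi>\<in>VS k E vs S \<delta> b.
        moment E \<phi> q = (\<Sum>r = 1..S. c r * \<delta> r \<phi>)) \<and>
     (\<exists>l. (\<forall>r\<in>{1..S}. l r \<in> Pk k (closure E)) \<and>
        (\<forall>\<phi>\<in>VS k E vs S \<delta> b. Pi0 k E \<phi> = (\<Sum>r = 1..S. \<delta> r \<phi> *\<^sub>R l r))) \<and>
     (\<exists>l. (\<forall>r\<in>{1..S}. l r \<in> Pk k (closure E)) \<and>
        (\<forall>\<phi>\<in>VS k E vs S \<delta> b. PiS k E S \<delta> b \<phi> = (\<Sum>r = 1..S. \<delta> r \<phi> *\<^sub>R l r))) \<and>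
     (\<forall>q\<in>Bi. InternalMoment q \<in> \<sigma> ` {1..S} \<or>
        (\<forall>\<phi>\<in>VS k E vs S \<delta> b. moment E \<phi> q = moment E (PiS k E S \<delta> b \<phi>) q))"

end

theory Submission
  imports Defs "HOL-Complex_Analysis.Great_Picard"
begin

text \<open>The theorem rests on one analytic fact: a function of \<open>Vkk\<close> is determined by its
\<open>num_dofs\<close> degrees of freedom, and these can be prescribed arbitrarily
(\<open>dofs_injective\<close>, \<open>dofs_surjective\<close>).

Granted this fact, the rest is linear algebra. \<open>property_S\<close> makes the bilinear form definite
on polynomials, so \<open>PiS \<phi>\<close> is given by a fixed linear formula in the first \<open>S\<close> degrees of
freedom of \<open>\<phi>\<close> (\<open>PiS_formula\<close>). In the serendipity space the remaining degrees of freedom are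
those of this polynomial; hence the first \<open>S\<close> values determine the function and can be
prescribed. Polynomials belong to the space because \<open>PiS\<close> fixes them, and every internal
moment is either one of the first \<open>S\<close> values or a moment of the computed polynomial.

The analytic fact is a statement about the Poisson equation on the polygon, with a
distributional Laplacian and continuous boundary values. It is reached through the five-point
difference operator \<open>dlap\<close>, acting on functions on the whole plane. By translation
invariance of Lebesgue measure this operator can be moved to the test function, so weak
Laplacians are limits of difference quotients (\<open>weak_laplacian_of_dlap\<close>).

Uniqueness. If all degrees of freedom of \<open>\<phi>\<close> vanish, then \<open>\<phi>\<close> vanishes on the boundary, its
Laplacian is a polynomial \<open>g\<close>, and the integral of \<open>\<phi> g\<close> is zero. Formally, minus that
integral is the Dirichlet energy of \<open>\<phi>\<close>. As \<open>\<phi>\<close> is only continuous, the energy is taken for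
difference quotients of a mollified and truncated function, with a Poincare inequality for
differences (\<open>energy_uniqueness\<close>).

Existence. Subtracting a polynomial reduces the Poisson equation to the Laplace equation.
Discretely harmonic functions with given boundary values are limits of a monotone iteration.
They are asymptotically equicontinuous: translates of such a function are discretely harmonic
too, so the maximum principle reduces the modulus of continuity to the boundary, where the real
part of a complex square root is a barrier; its branch cut lies in an exterior cone, which exists
because \<open>E\<close> is star-shaped with respect to a disc. A convergent subsequence then gives a weakly
harmonic function (\<open>weak_dirichlet\<close>). Together with one-dimensional interpolation on the
edges this realizes all boundary degrees of freedom. For the internal moments, the linear map
from a polynomial \<open>g\<close> to the moments of the solution with Laplacian \<open>g\<close> and zero boundary values
is injective by the uniqueness argument, hence surjective for reasons of dimension
(\<open>interior_moments_realized\<close>).\<close>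

(* Points of the plane stay single variables in quantified statements. *)
declare split_paired_All [simp del] split_paired_Ex [simp del]

section \<open>Square linear systems\<close>

lemma sum_fun_apply: "(\<Sum>x\<in>X. g x) q = (\<Sum>x\<in>X. g x q :: real)"
  by (induction X rule: infinite_finite_induct) (auto simp: zero_fun_def)

text \<open>An injective map sends the basis to as many independent vectors as the target has coordinates;
  a vector outside their span would give one independent vector too many.\<close>

lemma square_system:
  fixes A :: "'b \<Rightarrow> 'c \<Rightarrow> real"
  assumes fB: "finite B" and fC: "finite C" and card: "card B = card C"
    and inj: "\<And>a. (\<forall>q\<in>C. (\<Sum>b\<in>B. a b * A b q) = 0) \<Longrightarrow> (\<forall>b\<in>B. a b = 0)"
  shows "\<exists>a. \<forall>q\<in>C. (\<Sum>b\<in>B. a b * A b q) = c q"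
proof -
  define f where "f b = (\<lambda>q. if q \<in> C then A b q else 0)" for b
  define e where "e q = (\<lambda>x. if x = q then 1 else (0::real))" for q :: 'c
  have zero: "\<forall>b\<in>B. a b = 0" if "(\<Sum>b\<in>B. a b *\<^sub>R f b) = 0" for a
  proof (rule inj, rule ballI)
    fix q assume q: "q \<in> C"
    have "(\<Sum>b\<in>B. a b *\<^sub>R f b) q = 0" using that by (simp add: zero_fun_def)
    then show "(\<Sum>b\<in>B. a b * A b q) = 0" using q by (simp add: sum_fun_apply scaleR_fun_def f_def)
  qed
  have injf: "inj_on f B"
  proof (rule inj_onI, rule ccontr)
    fix x y assume xy: "x \<in> B" "y \<in> B" "f x = f y" "x \<noteq> y"
    define a where "a b = (if b = x then 1 else if b = y then -1 else (0::real))" for b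
    have "(\<Sum>b\<in>B. a b *\<^sub>R f b) = (\<Sum>b\<in>{x,y}. a b *\<^sub>R f b)"
      by (rule sum.mono_neutral_right) (use xy fB in \<open>auto simp: a_def\<close>)
    also have "\<dots> = 0" using xy by (simp add: a_def)
    finally have "a x = 0" using zero xy by blast
    then show False by (simp add: a_def)
  qed
  have "independent (f ` B)"
    unfolding dependent_finite[OF finite_imageI[OF fB]]
  proof
    assume "\<exists>u. (\<exists>v\<in>f ` B. u v \<noteq> 0) \<and> (\<Sum>v\<in>f ` B. u v *\<^sub>R v) = 0"
    then obtain u where u: "\<exists>v\<in>f ` B. u v \<noteq> 0" "(\<Sum>v\<in>f ` B. u v *\<^sub>R v) = 0" by blast
    have "(\<Sum>b\<in>B. u (f b) *\<^sub>R f b) = 0" using u(2) by (simp add: sum.reindex[OF injf])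
    from zero[OF this] u(1) show False by auto
  qed
  have inC: "g \<in> span (e ` C)" if "\<And>x. x \<notin> C \<Longrightarrow> g x = 0" for g
  proof -
    have "g = (\<Sum>q\<in>C. g q *\<^sub>R e q)"
    proof
      fix x
      have "(\<Sum>q\<in>C. g q *\<^sub>R e q) x = (\<Sum>q\<in>C. if q = x then g q else 0)"
        by (auto simp: sum_fun_apply scaleR_fun_def e_def intro!: sum.cong)
      then show "g x = (\<Sum>q\<in>C. g q *\<^sub>R e q) x" using that[of x] fC by (auto simp: sum.delta)
    qed
    also have "\<dots> \<in> span (e ` C)" by (intro span_sum span_scale span_base) auto
    finally show ?thesis .
  qed
  have injB: "card (f ` B) = card B" by (rule card_image[OF injf])
  define c' where "c' = (\<lambda>q. if q \<in> C then c q else 0)"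
  have "c' \<in> span (f ` B)"
  proof (rule ccontr)
    assume n: "c' \<notin> span (f ` B)"
    have "independent (insert c' (f ` B))" using n \<open>independent (f ` B)\<close> by (simp add: independent_insert span_superset)
    moreover have "insert c' (f ` B) \<subseteq> span (e ` C)" using inC by (auto simp: c'_def f_def)
    ultimately have "card (insert c' (f ` B)) \<le> card (e ` C)"
      using independent_span_bound[OF finite_imageI[OF fC]] by blast
    moreover have "c' \<notin> f ` B" using n span_base[of c' "f ` B"] by auto
    ultimately have "card B + 1 \<le> card (e ` C)" using fB injB by simp
    also have "\<dots> \<le> card C" by (rule card_image_le[OF fC])
    finally show False using card by simp
  qed
  then obtain u where "c' = (\<Sum>v\<in>f ` B. u v *\<^sub>R v)"
    unfolding span_finite[OF finite_imageI[OF fB]] by blast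
  then have eq: "c' = (\<Sum>b\<in>B. u (f b) *\<^sub>R f b)" by (simp add: sum.reindex[OF injf])
  have "(\<Sum>b\<in>B. u (f b) * A b q) = c q" if "q \<in> C" for q
  proof -
    have "c' q = (\<Sum>b\<in>B. u (f b) *\<^sub>R f b) q" using eq by simp
    then show ?thesis using that by (simp add: sum_fun_apply scaleR_fun_def f_def c'_def)
  qed
  then show ?thesis by (intro exI[of _ "\<lambda>b. u (f b)"]) simp
qed

lemma linear_functional_on_sum:
  assumes "linear_functional_on V f" "subspace V" "\<And>b. b \<in> B \<Longrightarrow> g b \<in> V"
  shows "f (\<Sum>b\<in>B. a b *\<^sub>R g b) = (\<Sum>b\<in>B. a b * f (g b))"
  using assms(3)
proof (induction B rule: infinite_finite_induct)
  case (insert x F)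
  have "(\<Sum>b\<in>F. a b *\<^sub>R g b) \<in> V" "a x *\<^sub>R g x \<in> V"
    using insert assms(2) by (auto intro!: subspace_sum subspace_scale)
  then show ?case using insert assms(1) by (auto simp: linear_functional_on_def)
next
  case empty
  have "f (0 *\<^sub>R 0) = 0 * f 0" using assms unfolding linear_functional_on_def by (blast intro: subspace_0)
  then show ?case by simp
next
  case (infinite A)
  have "f (0 *\<^sub>R 0) = 0 * f 0" using assms unfolding linear_functional_on_def by (blast intro: subspace_0)
  with infinite show ?case by simp
qed

text \<open>This is how solvability is deduced from uniqueness below: for the moments on an edge, for the
  internal moments, and for both projections.\<close>

lemma span_system:
  fixes B :: "'a::real_vector set" and T :: "'a \<Rightarrow> 'c \<Rightarrow> real"
  assumes fB: "finite B" and ind: "independent B" and fC: "finite C" and card: "card B = card C"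
    and lin: "\<And>q. q \<in> C \<Longrightarrow> linear_functional_on (span B) (\<lambda>r. T r q)"
    and inj: "\<And>r. r \<in> span B \<Longrightarrow> (\<forall>q\<in>C. T r q = 0) \<Longrightarrow> r = 0"
  shows "\<exists>r\<in>span B. \<forall>q\<in>C. T r q = c q"
proof -
  have T: "T (\<Sum>b\<in>B. a b *\<^sub>R b) q = (\<Sum>b\<in>B. a b * T b q)" if "q \<in> C" for a q
    by (rule linear_functional_on_sum[OF lin[OF that]]) (auto simp: span_base)
  have mem: "(\<Sum>b\<in>B. a b *\<^sub>R b) \<in> span B" for a
    by (intro span_sum span_scale span_base)
  have "\<exists>a. \<forall>q\<in>C. (\<Sum>b\<in>B. a b * T b q) = c q"
  proof (rule square_system[OF fB fC card])
    fix a assume a: "\<forall>q\<in>C. (\<Sum>b\<in>B. a b * T b q) = 0"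
    have "(\<Sum>b\<in>B. a b *\<^sub>R b) = 0" by (rule inj[OF mem]) (simp add: T a)
    then show "\<forall>b\<in>B. a b = 0" using ind fB by (auto simp: dependent_finite)
  qed
  then obtain a where a: "\<forall>q\<in>C. (\<Sum>b\<in>B. a b * T b q) = c q" by blast
  show ?thesis
    by (rule bexI[of _ "\<Sum>b\<in>B. a b *\<^sub>R b"]) (simp_all add: T a mem)
qed

section \<open>The five-point difference operator\<close>

text \<open>The factor \<open>1 / h\<^sup>2\<close> is left out because the maximum principle only uses the sign. The
  argument ranges over the whole plane instead of a lattice, so that a discretely harmonic
  function can be translated by an arbitrary vector.\<close>

definition dlap :: "real \<Rightarrow> (plane \<Rightarrow> real) \<Rightarrow> plane \<Rightarrow> real" where
  "dlap h f x = f (x + (h, 0)) + f (x - (h, 0)) + f (x + (0, h)) + f (x - (0, h)) - 4 * f x"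

text \<open>The difference operator only sees derivatives along coordinate lines, and these are easily
  available for test functions as well as for polynomials.\<close>

definition has_second_derivs ::
    "(plane \<Rightarrow> real) \<Rightarrow> (plane \<Rightarrow> real) \<Rightarrow> (plane \<Rightarrow> real) \<Rightarrow> bool" where
  "has_second_derivs f f11 f22 \<longleftrightarrow>
     (\<exists>f1 f2. \<forall>x y.
        ((\<lambda>t. f (t, y)) has_real_derivative f1 (x, y)) (at x) \<and>
        ((\<lambda>t. f1 (t, y)) has_real_derivative f11 (x, y)) (at x) \<and>
        ((\<lambda>t. f (x, t)) has_real_derivative f2 (x, y)) (at y) \<and>
        ((\<lambda>t. f2 (x, t)) has_real_derivative f22 (x, y)) (at y)) \<and>
     continuous_on UNIV f11 \<and> continuous_on UNIV f22"

lemma second_difference: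
  fixes f f' f'' :: "real \<Rightarrow> real"
  assumes d: "\<And>t. (f has_real_derivative f' t) (at t)" "\<And>t. (f' has_real_derivative f'' t) (at t)"
    and h: "0 < h"
  shows "\<exists>s1 s2. \<bar>s1 - x\<bar> \<le> h \<and> \<bar>s2 - x\<bar> \<le> h \<and> f (x + h) + f (x - h) - 2 * f x = h\<^sup>2 / 2 * (f'' s1 + f'' s2)"
proof -
  define D where "D m = (if m = 0 then f else if m = 1 then f' else f'')" for m :: nat
  have D: "\<forall>m t. m < 2 \<and> x - h \<le> t \<and> t \<le> x + h \<longrightarrow> (D m has_real_derivative D (Suc m) t) (at t)"
    using d by (auto simp: D_def less_2_cases_iff)
  obtain s1 where s1: "x < s1" "s1 < x + h" "f (x + h) = (\<Sum>m<2. (D m x / fact m) * (x + h - x)^m) + (D 2 s1 / fact 2) * (x + h - x)^2"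
    using Taylor[of 2 D f "x - h" "x + h" x "x + h"] D h by (auto simp: D_def)
  obtain s2 where s2: "x - h < s2" "s2 < x" "f (x - h) = (\<Sum>m<2. (D m x / fact m) * (x - h - x)^m) + (D 2 s2 / fact 2) * (x - h - x)^2"
    using Taylor[of 2 D f "x - h" "x + h" x "x - h"] D h by (auto simp: D_def)
  have "f (x + h) + f (x - h) - 2 * f x = h\<^sup>2 / 2 * (f'' s1 + f'' s2)"
    using s1(3) s2(3) by (simp add: D_def numeral_2_eq_2 algebra_simps)
  then show ?thesis using s1 s2 by (intro exI[of _ s1] exI[of _ s2]) auto
qed

lemma two_averages:
  fixes a b c d u v e :: real
  assumes "\<bar>a - u\<bar> < e / 2" "\<bar>b - u\<bar> < e / 2" "\<bar>c - v\<bar> < e / 2" "\<bar>d - v\<bar> < e / 2"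
  shows "\<bar>(a + b) / 2 + (c + d) / 2 - (u + v)\<bar> \<le> e"
  using assms by argo

text \<open>By Taylor's formula on each axis a second difference is the mean of two values of the second
  derivative at distance at most \<open>h\<close>, so uniform continuity near \<open>K\<close> gives the uniform bound.\<close>

lemma dlap_consistency:
  assumes f: "has_second_derivs f f11 f22" and K: "compact K" and e: "0 < e"
  shows "\<exists>h0>0. \<forall>h. 0 < h \<and> h < h0 \<longrightarrow> (\<forall>x\<in>K. \<bar>dlap h f x / h\<^sup>2 - (f11 x + f22 x)\<bar> \<le> e)"
proof -
  obtain f1 f2 where
    d1: "\<And>x y. ((\<lambda>t. f (t, y)) has_real_derivative f1 (x, y)) (at x)"
        "\<And>x y. ((\<lambda>t. f1 (t, y)) has_real_derivative f11 (x, y)) (at x)" and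
    d2: "\<And>x y. ((\<lambda>t. f (x, t)) has_real_derivative f2 (x, y)) (at y)"
        "\<And>x y. ((\<lambda>t. f2 (x, t)) has_real_derivative f22 (x, y)) (at y)" and
    c: "continuous_on UNIV f11" "continuous_on UNIV f22"
    using f unfolding has_second_derivs_def by blast
  define K' where "K' = {x + y | x y. x \<in> K \<and> y \<in> cball 0 (1::real)}"
  have "compact K'" unfolding K'_def by (intro compact_sums K compact_cball)
  then have u: "uniformly_continuous_on K' f11" "uniformly_continuous_on K' f22"
    using c by (auto intro!: compact_uniformly_continuous intro: continuous_on_subset)
  obtain a where a: "a > 0" "\<And>x y. x \<in> K' \<Longrightarrow> y \<in> K' \<Longrightarrow> dist x y < a \<Longrightarrow> dist (f11 x) (f11 y) < e / 2"
    using u(1) e unfolding uniformly_continuous_on_def by (metis dist_commute half_gt_zero)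
  obtain b where b: "b > 0" "\<And>x y. x \<in> K' \<Longrightarrow> y \<in> K' \<Longrightarrow> dist x y < b \<Longrightarrow> dist (f22 x) (f22 y) < e / 2"
    using u(2) e unfolding uniformly_continuous_on_def by (metis dist_commute half_gt_zero)
  have near: "z \<in> K'" if "x \<in> K" "dist x z \<le> 1" for x z
    unfolding K'_def mem_Collect_eq
    by (rule exI[of _ x], rule exI[of _ "z - x"]) (use that in \<open>simp add: dist_norm norm_minus_commute\<close>)
  show ?thesis
  proof (intro exI[of _ "min 1 (min a b)"] conjI allI impI ballI)
    show "0 < min 1 (min a b)" using a b by simp
    fix h x assume h: "0 < h \<and> h < min 1 (min a b)" and x: "x \<in> K"
    obtain p q where pq: "x = (p, q)" by (cases x)
    obtain s1 s2 where s: "\<bar>s1 - p\<bar> \<le> h" "\<bar>s2 - p\<bar> \<le> h"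
       "f (p + h, q) + f (p - h, q) - 2 * f (p, q) = h\<^sup>2 / 2 * (f11 (s1, q) + f11 (s2, q))"
      using second_difference[OF d1(1)[of q] d1(2)[of q], of h p] h by blast
    obtain r1 r2 where r: "\<bar>r1 - q\<bar> \<le> h" "\<bar>r2 - q\<bar> \<le> h"
       "f (p, q + h) + f (p, q - h) - 2 * f (p, q) = h\<^sup>2 / 2 * (f22 (p, r1) + f22 (p, r2))"
      using second_difference[OF d2(1)[of p] d2(2)[of p], of h q] h by blast
    have D1: "dist x (s, q) = \<bar>s - p\<bar>" for s by (simp add: pq dist_prod_def dist_real_def abs_minus_commute)
    have D2: "dist x (p, s) = \<bar>s - q\<bar>" for s by (simp add: pq dist_prod_def dist_real_def abs_minus_commute)
    have xK: "x \<in> K'" using near[OF x, of x] by simp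
    have "\<bar>f11 (s1, q) - f11 x\<bar> < e / 2" "\<bar>f11 (s2, q) - f11 x\<bar> < e / 2"
      using a(2)[of x "(s1, q)"] a(2)[of x "(s2, q)"] near[OF x] xK D1 s h
      by (auto simp: dist_real_def abs_minus_commute)
    moreover have "\<bar>f22 (p, r1) - f22 x\<bar> < e / 2" "\<bar>f22 (p, r2) - f22 x\<bar> < e / 2"
      using b(2)[of x "(p, r1)"] b(2)[of x "(p, r2)"] near[OF x] xK D2 r h
      by (auto simp: dist_real_def abs_minus_commute)
    moreover have "dlap h f x / h\<^sup>2 = (f11 (s1, q) + f11 (s2, q)) / 2 + (f22 (p, r1) + f22 (p, r2)) / 2"
    proof -
      have "dlap h f x = h\<^sup>2 / 2 * (f11 (s1, q) + f11 (s2, q)) + h\<^sup>2 / 2 * (f22 (p, r1) + f22 (p, r2))"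
        using s(3) r(3) by (simp add: dlap_def pq)
      then show ?thesis using h by (simp add: field_simps)
    qed
    ultimately show "\<bar>dlap h f x / h\<^sup>2 - (f11 x + f22 x)\<bar> \<le> e"
      using two_averages by simp
  qed
qed

section \<open>Test functions\<close>

lemma partial_deriv_zero_on_open:
  assumes "open U" "\<And>x. x \<in> U \<Longrightarrow> f x = 0" "x \<in> U"
  shows "partial_deriv v f x = 0"
proof -
  have "(f has_derivative (\<lambda>_. 0)) (at x)"
    by (rule has_derivative_transform_within_open[of "\<lambda>_. 0" _ _ _ U]) (use assms in auto)
  then have "frechet_derivative f (at x) = (\<lambda>_. 0)" by (rule frechet_derivative_at[symmetric])
  then show ?thesis by (simp add: partial_deriv_def)
qed

lemma laplacian_zero_on_open:
  assumes "open U" "\<And>x. x \<in> U \<Longrightarrow> f x = 0" "x \<in> U"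
  shows "laplacian f x = 0"
  using assms unfolding laplacian_def
  by (simp add: partial_deriv_zero_on_open[of U])

lemma partial_deriv_line:
  assumes "f differentiable (at (x, y))"
  shows "((\<lambda>t. f (t, y)) has_real_derivative partial_deriv (1, 0) f (x, y)) (at x)"
    and "((\<lambda>t. f (x, t)) has_real_derivative partial_deriv (0, 1) f (x, y)) (at y)"
proof -
  let ?D = "frechet_derivative f (at (x, y))"
  have D: "(f has_derivative ?D) (at (x, y))" using assms by (simp add: frechet_derivative_works)
  then interpret bounded_linear ?D by (rule has_derivative_bounded_linear)
  have "((\<lambda>t. f (t, y)) has_derivative (\<lambda>t. ?D (t, 0))) (at x)"
    by (rule has_derivative_compose[of "\<lambda>t. (t, y)" "\<lambda>t. (t, 0)"]) (auto intro!: derivative_eq_intros D)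
  moreover have "?D (t, 0) = partial_deriv (1, 0) f (x, y) * t" for t
    using scaleR[of t "(1, 0)"] by (simp add: partial_deriv_def)
  ultimately show "((\<lambda>t. f (t, y)) has_real_derivative partial_deriv (1, 0) f (x, y)) (at x)"
    by (simp add: has_field_derivative_def)
  have "((\<lambda>t. f (x, t)) has_derivative (\<lambda>t. ?D (0, t))) (at y)"
    by (rule has_derivative_compose[of "\<lambda>t. (x, t)" "\<lambda>t. (0, t)"]) (auto intro!: derivative_eq_intros D)
  moreover have "?D (0, t) = partial_deriv (0, 1) f (x, y) * t" for t
    using scaleR[of t "(0, 1)"] by (simp add: partial_deriv_def)
  ultimately show "((\<lambda>t. f (x, t)) has_real_derivative partial_deriv (0, 1) f (x, y)) (at y)"
    by (simp add: has_field_derivative_def)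
qed

lemma C_diff_second_derivs:
  assumes "\<forall>m. C_diff m f"
  shows "has_second_derivs f (partial_deriv (1,0) (partial_deriv (1,0) f))
                             (partial_deriv (0,1) (partial_deriv (0,1) f))"
proof -
  have c: "C_diff (Suc (Suc 0)) f" using assms by blast
  show ?thesis unfolding has_second_derivs_def
    apply (intro conjI)
      apply (rule exI[of _ "partial_deriv (1,0) f"], rule exI[of _ "partial_deriv (0,1) f"])
    using c by (auto intro!: partial_deriv_line)
qed

lemma C_diff_continuous: "C_diff m f \<Longrightarrow> continuous_on UNIV f"
  by (cases m) (auto simp: continuous_at_imp_continuous_on differentiable_imp_continuous_within)

lemma C_diff_laplacian_continuous:
  assumes "\<forall>m. C_diff m f" shows "continuous_on UNIV (laplacian f)"
proof -
  have c: "C_diff (Suc (Suc 0)) f" using assms by blast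
  then have "continuous_on UNIV (partial_deriv (1,0) (partial_deriv (1,0) f))"
    "continuous_on UNIV (partial_deriv (0,1) (partial_deriv (0,1) f))" by simp_all
  then show ?thesis unfolding laplacian_def by (rule continuous_on_add)
qed

section \<open>Integrals over the plane\<close>

lemma integral_shift:
  fixes f :: "plane \<Rightarrow> real"
  assumes "f \<in> borel_measurable borel"
  shows "(LINT x|lborel. f (x + a)) = (LINT x|lborel. f x)"
proof -
  have "(LINT x|lborel. f x) = (LINT x|distr lborel borel ((+) a). f x)" by (simp add: lborel_distr_plus)
  also have "\<dots> = (LINT x|lborel. f (a + x))" by (rule integral_distr) (use assms in auto)
  finally show ?thesis by (simp add: add.commute)
qed

lemma integrable_shift:
  fixes f :: "plane \<Rightarrow> real"
  assumes "integrable lborel f"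
  shows "integrable lborel (\<lambda>x. f (x + a))"
proof -
  have "integrable (distr lborel borel ((+) a)) f" using assms by (simp add: lborel_distr_plus)
  then have "integrable lborel (\<lambda>x. f (a + x))" by (subst (asm) integrable_distr_eq) (use assms in auto)
  then show ?thesis by (simp add: add.commute)
qed

lemma integrable_bounded_support:
  fixes f :: "plane \<Rightarrow> real"
  assumes "f \<in> borel_measurable borel" "\<And>x. \<bar>f x\<bar> \<le> B" "bounded S" "\<And>x. x \<notin> S \<Longrightarrow> f x = 0"
  shows "integrable lborel f"
proof -
  obtain R where R: "S \<subseteq> cball 0 R" using assms(3) by (auto simp: bounded_iff subset_iff)
  show ?thesis
  proof (rule Bochner_Integration.integrable_bound[of _ "\<lambda>x. B * indicator (cball 0 R) x"])
    show "integrable lborel (\<lambda>x::plane. B * indicator (cball 0 R) x)"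
      using emeasure_lborel_cball_finite[of "0::plane" R] by (auto intro!: integrable_mult_right integrable_real_indicator simp: top.not_eq_extremum)
    have B: "B \<ge> 0" using assms(2)[of 0] by linarith
    show "AE x in lborel. norm (f x) \<le> norm (B * indicator (cball 0 R) x)"
    proof (rule AE_I2)
      fix x show "norm (f x) \<le> norm (B * indicator (cball 0 R) x)"
      proof (cases "x \<in> cball 0 R")
        case False then have "f x = 0" using R assms(4) by blast
        then show ?thesis by simp
      qed (use assms(2)[of x] B in simp)
    qed
  qed (use assms in auto)
qed

lemma integral_five_points:
  fixes g1 g2 g3 g4 g5 :: "'a \<Rightarrow> real"
  assumes "integrable M g1" "integrable M g2" "integrable M g3" "integrable M g4" "integrable M g5"
  shows "(LINT x|M. g1 x + g2 x + g3 x + g4 x - 4 * g5 x) =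
    (LINT x|M. g1 x) + (LINT x|M. g2 x) + (LINT x|M. g3 x) + (LINT x|M. g4 x) - 4 * (LINT x|M. g5 x)"
  using assms by simp

text \<open>Each of the five terms is moved from one factor to the other by a translation of the plane.\<close>

lemma dlap_by_parts:
  fixes u f :: "plane \<Rightarrow> real"
  assumes m: "u \<in> borel_measurable borel" "f \<in> borel_measurable borel"
    and i: "\<And>a. integrable lborel (\<lambda>x. u (x + a) * f x)"
  shows "(LINT x|lborel. u x * dlap h f x) = (LINT x|lborel. dlap h u x * f x)"
proof -
  have i': "integrable lborel (\<lambda>x. u x * f (x + a))" for a
    using integrable_shift[OF i[of "-a"], of a] by simp
  have s: "(LINT x|lborel. u x * f (x + a)) = (LINT x|lborel. u (x + (-a)) * f x)" for a
    using integral_shift[of "\<lambda>x. u (x + (-a)) * f x" a] m by simp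
  have "(LINT x|lborel. u x * dlap h f x) =
     (LINT x|lborel. u x * f (x + (h,0))) + (LINT x|lborel. u x * f (x + - (h,0)))
     + (LINT x|lborel. u x * f (x + (0,h))) + (LINT x|lborel. u x * f (x + - (0,h))) - 4 * (LINT x|lborel. u x * f (x + 0))"
    (is "_ = ?r")
  proof -
    have "(LINT x|lborel. u x * dlap h f x) = (LINT x|lborel. u x * f (x + (h,0)) + u x * f (x + - (h,0)) + u x * f (x + (0,h)) + u x * f (x + -(0,h))
       - 4 * (u x * f (x + 0)))"
      by (intro Bochner_Integration.integral_cong) (simp_all add: dlap_def algebra_simps del: uminus_Pair)
    also have "\<dots> = ?r" by (rule integral_five_points) (rule i')+
    finally show ?thesis .
  qed
  also have "\<dots> = (LINT x|lborel. u (x + - (h,0)) * f x) + (LINT x|lborel. u (x + (h,0)) * f x)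
     + (LINT x|lborel. u (x + - (0,h)) * f x) + (LINT x|lborel. u (x + (0,h)) * f x) - 4 * (LINT x|lborel. u (x + 0) * f x)"
    unfolding s by simp
  also have "\<dots> = (LINT x|lborel. u (x + - (h,0)) * f x + u (x + (h,0)) * f x
     + u (x + - (0,h)) * f x + u (x + (0,h)) * f x - 4 * (u (x + 0) * f x))"
    by (rule integral_five_points[symmetric]) (rule i)+
  also have "\<dots> = (LINT x|lborel. dlap h u x * f x)"
    by (intro Bochner_Integration.integral_cong) (simp_all add: dlap_def algebra_simps del: uminus_Pair)
  finally show ?thesis .
qed

section \<open>Weak Laplacians as limits of differences\<close>

lemma compact_support_bounded:
  assumes "continuous_on UNIV (f :: plane \<Rightarrow> real)" "compact K" "\<And>x. x \<notin> K \<Longrightarrow> f x = 0"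
  shows "\<exists>B>0. \<forall>x. \<bar>f x\<bar> \<le> B"
proof -
  have "bounded (f ` K)" using assms by (intro compact_imp_bounded compact_continuous_image) (auto intro: continuous_on_subset)
  then obtain B where B: "B > 0" "\<forall>x\<in>K. \<bar>f x\<bar> \<le> B" by (auto simp: bounded_pos)
  have "\<bar>f x\<bar> \<le> B" for x using B assms(3)[of x] by (cases "x \<in> K") auto
  with B show ?thesis by blast
qed

lemma set_integral_support:
  fixes f :: "plane \<Rightarrow> real"
  assumes "\<And>x. x \<notin> E \<Longrightarrow> f x = 0"
  shows "(LINT x:E|lborel. f x) = (LINT x|lborel. f x)"
  unfolding set_lebesgue_integral_def
  by (intro Bochner_Integration.integral_cong) (use assms in \<open>auto simp: indicator_def\<close>)

text \<open>Summation by parts moves the difference to the test function, where it converges uniformly; both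
  sides then converge by dominated convergence. Only pointwise convergence of \<open>u n\<close> is needed, so
  the approximations may be discontinuous, as discretely harmonic functions are.\<close>

lemma weak_laplacian_of_dlap:
  fixes u :: "nat \<Rightarrow> plane \<Rightarrow> real"
  assumes E: "open E" "bounded E"
    and h: "\<And>n. 0 < h n" "h \<longlonglongrightarrow> 0"
    and meas: "\<And>n. u n \<in> borel_measurable borel"
    and bd: "\<And>n x. \<bar>u n x\<bar> \<le> M"
    and lim: "\<And>x. x \<in> E \<Longrightarrow> (\<lambda>n. u n x) \<longlonglongrightarrow> v x"
    and glim: "\<And>x. x \<in> E \<Longrightarrow> (\<lambda>n. dlap (h n) (u n) x / (h n)\<^sup>2) \<longlonglongrightarrow> g x"
    and gbd: "\<And>n x. x \<in> E \<Longrightarrow> \<bar>dlap (h n) (u n) x / (h n)\<^sup>2\<bar> \<le> G"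
  shows "has_weak_laplacian E v g"
  unfolding has_weak_laplacian_def
proof
  fix f assume "f \<in> test_functions E"
  then obtain K where smooth: "\<forall>m. C_diff m f" and K: "compact K" "K \<subseteq> E" "\<And>x. x \<notin> K \<Longrightarrow> f x = 0"
    unfolding test_functions_def by blast
  have cf: "continuous_on UNIV f" using smooth C_diff_continuous by blast
  have mf [measurable]: "f \<in> borel_measurable borel" using cf by (rule borel_measurable_continuous_onI)
  have mu [measurable]: "u n \<in> borel_measurable borel" for n by (rule meas)
  have bK: "bounded K" using K(1) by (rule compact_imp_bounded)
  have lap0: "laplacian f x = 0" if "x \<notin> K" for x
    by (rule laplacian_zero_on_open[of "-K"]) (use K that in \<open>auto simp: compact_imp_closed\<close>)
  have cl: "continuous_on UNIV (laplacian f)" using smooth by (rule C_diff_laplacian_continuous)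
  obtain B where B: "B > 0" "\<And>x. \<bar>f x\<bar> \<le> B" using compact_support_bounded[OF cf K(1) K(3)] by metis
  obtain L where L: "L > 0" "\<And>x. \<bar>laplacian f x\<bar> \<le> L" using compact_support_bounded[OF cl K(1) lap0] by metis
  have M: "M \<ge> 0" using bd[of 0 0] by linarith
  define K1 where "K1 = {x + y | x y. x \<in> K \<and> y \<in> cball 0 (1::real)}"
  have cK1: "compact K1" unfolding K1_def by (intro compact_sums K compact_cball)
  have KK1: "K \<subseteq> K1"
  proof
    fix x assume "x \<in> K" then show "x \<in> K1" unfolding K1_def mem_Collect_eq by (intro exI[of _ x] exI[of _ 0]) auto
  qed
  define F where "F n x = dlap (h n) f x / (h n)\<^sup>2" for n x
  have F0: "F n x = 0" if "x \<notin> K1" "h n \<le> 1" for n x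
  proof -
    have nk: "x + a \<notin> K" if a: "norm a \<le> 1" for a
    proof
      assume "x + a \<in> K"
      then have "x \<in> K1" unfolding K1_def mem_Collect_eq using a by (intro exI[of _ "x + a"] exI[of _ "-a"]) auto
      then show False using \<open>x \<notin> K1\<close> by simp
    qed
    have hh: "\<bar>h n\<bar> \<le> 1" using that h(1)[of n] by simp
    show ?thesis
      using K(3)[OF nk[of "(h n, 0)"]] K(3)[OF nk[of "(- h n, 0)"]] K(3)[OF nk[of "(0, h n)"]] K(3)[OF nk[of "(0, - h n)"]]
         K(3)[OF nk[of 0]] hh
      by (simp add: F_def dlap_def norm_Pair diff_conv_add_uminus del: add_uminus_conv_diff)
  qed
  have Flim: "\<exists>N. \<forall>n\<ge>N. \<forall>x. \<bar>F n x - laplacian f x\<bar> \<le> e" if e: "e > 0" for e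
  proof -
    obtain h0 where h0: "h0 > 0" "\<And>k x. 0 < k \<Longrightarrow> k < h0 \<Longrightarrow> x \<in> K1 \<Longrightarrow> \<bar>dlap k f x / k\<^sup>2 - laplacian f x\<bar> \<le> e"
      using dlap_consistency[OF C_diff_second_derivs[OF smooth] cK1 e] unfolding laplacian_def by metis
    have "\<forall>\<^sub>F n in sequentially. h n < min h0 1" using h(2) h0(1) by (intro order_tendstoD) auto
    then obtain N where N: "\<And>n. n \<ge> N \<Longrightarrow> h n < min h0 1" by (auto simp: eventually_sequentially)
    have "\<bar>F n x - laplacian f x\<bar> \<le> e" if n: "n \<ge> N" for n x
    proof (cases "x \<in> K1")
      case True then show ?thesis using h0(2)[OF h(1)[of n]] N[OF n] by (simp add: F_def)
    next
      case False
      then have "x \<notin> K" using KK1 by blast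
      then show ?thesis using F0[OF False, of n] N[OF n] lap0[of x] e by auto
    qed
    then show ?thesis by blast
  qed
  obtain N where N: "\<And>n x. n \<ge> N \<Longrightarrow> \<bar>F n x - laplacian f x\<bar> \<le> 1" using Flim[of 1] by auto
  obtain N' where N': "\<And>n. n \<ge> N' \<Longrightarrow> h n < 1"
    using order_tendstoD(2)[OF h(2), of 1] by (auto simp: eventually_sequentially)
  (* Dropping finitely many terms makes F uniformly bounded and supported in K1. *)
  define m where "m n = n + (N + N')" for n :: nat
  have mF [measurable]: "F n \<in> borel_measurable borel" for n
    unfolding F_def dlap_def by measurable
  have mm: "filterlim m at_top sequentially" unfolding m_def by (rule filterlim_add_const_nat_at_top)
  have parts: "(LINT x|lborel. u n x * F n x) = (LINT x|lborel. dlap (h n) (u n) x / (h n)\<^sup>2 * f x)" for n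
  proof -
    have "(LINT x|lborel. u n x * dlap (h n) f x) = (LINT x|lborel. dlap (h n) (u n) x * f x)"
    proof (rule dlap_by_parts[OF meas mf])
      fix a show "integrable lborel (\<lambda>x. u n (x + a) * f x)"
      proof (rule integrable_bounded_support[where B="M * B" and S=K])
        fix x show "\<bar>u n (x + a) * f x\<bar> \<le> M * B" using bd[of n "x+a"] B(2)[of x] M by (auto simp: abs_mult intro: mult_mono)
      qed (use K bK in auto)
    qed
    then have "(LINT x|lborel. u n x * dlap (h n) f x) / (h n)\<^sup>2 = (LINT x|lborel. dlap (h n) (u n) x * f x) / (h n)\<^sup>2" by simp
    then show ?thesis by (simp add: F_def)
  qed
  have cl': "laplacian f \<in> borel_measurable borel" using cl by (rule borel_measurable_continuous_onI)
  have mE [measurable]: "E \<in> sets borel" using E(1) by simp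
  have "(\<lambda>n. LINT x|lborel. u (m n) x * F (m n) x) \<longlonglongrightarrow> (LINT x|lborel. (if x \<in> E then v x else 0) * laplacian f x)"
  proof (rule integral_dominated_convergence[where w="\<lambda>x. indicator K1 x * (M * (L + 1))"])
    have vE: "(\<lambda>n. if x \<in> E then u n x else 0) \<longlonglongrightarrow> (if x \<in> E then v x else 0)" for x using lim[of x] by simp
    have "(\<lambda>x. if x \<in> E then v x else 0) \<in> borel_measurable borel"
      by (rule borel_measurable_LIMSEQ_real[OF vE]) measurable
    then show "(\<lambda>x. (if x \<in> E then v x else 0) * laplacian f x) \<in> borel_measurable lborel" using cl' by simp
    show "(\<lambda>x. u (m n) x * F (m n) x) \<in> borel_measurable lborel" for n by simp
    show "integrable lborel (\<lambda>x. indicator K1 x * (M * (L + 1)))"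
      using emeasure_compact_finite[OF cK1] cK1 by (intro integrable_mult_left integrable_real_indicator) (auto simp: compact_imp_closed)
    show "AE x in lborel. (\<lambda>n. u (m n) x * F (m n) x) \<longlonglongrightarrow> (if x \<in> E then v x else 0) * laplacian f x"
    proof (rule AE_I2)
      fix x
      have Fx: "(\<lambda>n. F n x) \<longlonglongrightarrow> laplacian f x"
      proof (rule LIMSEQ_I)
        fix r :: real assume "0 < r"
        then obtain N where "\<forall>n\<ge>N. \<forall>x. \<bar>F n x - laplacian f x\<bar> \<le> r/2" using Flim[of "r/2"] \<open>0 < r\<close> by auto
        then have "norm (F n x - laplacian f x) \<le> r/2" if "n \<ge> N" for n using that unfolding real_norm_def by blast
        then have "norm (F n x - laplacian f x) < r" if "n \<ge> N" for n using that \<open>0 < r\<close> by fastforce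
        then show "\<exists>no. \<forall>n\<ge>no. norm (F n x - laplacian f x) < r" by blast
      qed
      have "(\<lambda>n. u n x * F n x) \<longlonglongrightarrow> (if x \<in> E then v x else 0) * laplacian f x"
      proof (cases "x \<in> E")
        case True then show ?thesis using tendsto_mult[OF lim[OF True] Fx] by simp
      next
        case False
        have "(\<lambda>n. F n x * u n x) \<longlonglongrightarrow> 0"
        proof (rule Lim_null_comparison)
          show "\<forall>\<^sub>F n in sequentially. norm (F n x * u n x) \<le> \<bar>F n x\<bar> * M"
            using bd[of _ x] by (auto simp: abs_mult intro!: always_eventually mult_left_mono)
          have "laplacian f x = 0" using lap0 False K(2) by blast
          then show "(\<lambda>n. \<bar>F n x\<bar> * M) \<longlonglongrightarrow> 0" using tendsto_mult_left_zero[OF tendsto_rabs_zero] Fx by auto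
        qed
        then show ?thesis using False by (simp add: mult.commute)
      qed
      then show "(\<lambda>n. u (m n) x * F (m n) x) \<longlonglongrightarrow> (if x \<in> E then v x else 0) * laplacian f x"
        using mm by (rule filterlim_compose)
    qed
    show "AE x in lborel. norm (u (m n) x * F (m n) x) \<le> indicator K1 x * (M * (L + 1))" for n
    proof (rule AE_I2)
      fix x
      have "\<bar>F (m n) x\<bar> \<le> L + 1" using N[of "m n" x] L(2)[of x] by (simp add: m_def)
      moreover have "x \<notin> K1 \<Longrightarrow> F (m n) x = 0" using F0[of x "m n"] N'[of "m n"] by (simp add: m_def)
      ultimately show "norm (u (m n) x * F (m n) x) \<le> indicator K1 x * (M * (L + 1))"
        using bd[of "m n" x] M by (auto simp: indicator_def abs_mult intro!: mult_mono)
    qed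
  qed
  moreover have "(\<lambda>n. LINT x|lborel. dlap (h n) (u n) x / (h n)\<^sup>2 * f x) \<longlonglongrightarrow> (LINT x|lborel. (if x \<in> E then g x else 0) * f x)"
  proof (rule integral_dominated_convergence[where w="\<lambda>x. indicator K x * (G * B)"])
    have gE: "(\<lambda>n. if x \<in> E then dlap (h n) (u n) x / (h n)\<^sup>2 else 0) \<longlonglongrightarrow> (if x \<in> E then g x else 0)" for x using glim[of x] by simp
    have md [measurable]: "dlap (h n) (u n) \<in> borel_measurable borel" for n unfolding dlap_def by measurable
    have "(\<lambda>x. if x \<in> E then g x else 0) \<in> borel_measurable borel"
      by (rule borel_measurable_LIMSEQ_real[OF gE]) measurable
    then show "(\<lambda>x. (if x \<in> E then g x else 0) * f x) \<in> borel_measurable lborel" by simp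
    show "(\<lambda>x. dlap (h n) (u n) x / (h n)\<^sup>2 * f x) \<in> borel_measurable lborel" for n by simp
    show "integrable lborel (\<lambda>x. indicator K x * (G * B))"
      using emeasure_compact_finite[OF K(1)] K(1) by (intro integrable_mult_left integrable_real_indicator) (auto simp: compact_imp_closed)
    show "AE x in lborel. (\<lambda>n. dlap (h n) (u n) x / (h n)\<^sup>2 * f x) \<longlonglongrightarrow> (if x \<in> E then g x else 0) * f x"
    proof (rule AE_I2)
      fix x show "(\<lambda>n. dlap (h n) (u n) x / (h n)\<^sup>2 * f x) \<longlonglongrightarrow> (if x \<in> E then g x else 0) * f x"
      proof (cases "x \<in> E")
        case True then show ?thesis using tendsto_mult[OF glim[OF True] tendsto_const[of "f x"]] by simp
      next
        case False then have "f x = 0" using K(2) K(3) by blast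
        then show ?thesis by simp
      qed
    qed
    show "AE x in lborel. norm (dlap (h n) (u n) x / (h n)\<^sup>2 * f x) \<le> indicator K x * (G * B)" for n
    proof (rule AE_I2)
      fix x
      show "norm (dlap (h n) (u n) x / (h n)\<^sup>2 * f x) \<le> indicator K x * (G * B)"
      proof (cases "x \<in> K")
        case True
        then have "\<bar>dlap (h n) (u n) x / (h n)\<^sup>2\<bar> * \<bar>f x\<bar> \<le> G * B"
          using gbd[of x n] K(2) B(2)[of x] order_trans[OF abs_ge_zero gbd[of x n]] by (intro mult_mono) auto
        then show ?thesis using True by (simp add: abs_mult)
      qed (use K(3) in auto)
    qed
  qed
  then have "(\<lambda>n. LINT x|lborel. dlap (h (m n)) (u (m n)) x / (h (m n))\<^sup>2 * f x) \<longlonglongrightarrow> (LINT x|lborel. (if x \<in> E then g x else 0) * f x)"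
    using mm by (rule filterlim_compose)
  ultimately have "(LINT x|lborel. (if x \<in> E then v x else 0) * laplacian f x) = (LINT x|lborel. (if x \<in> E then g x else 0) * f x)"
    unfolding parts by (rule LIMSEQ_unique)
  moreover have "(LINT x|lborel. (if x \<in> E then v x else 0) * laplacian f x) = (LINT x:E|lborel. v x * laplacian f x)"
    unfolding set_lebesgue_integral_def by (intro Bochner_Integration.integral_cong) (auto simp: indicator_def)
  moreover have "(LINT x|lborel. (if x \<in> E then g x else 0) * f x) = (LINT x:E|lborel. g x * f x)"
    unfolding set_lebesgue_integral_def by (intro Bochner_Integration.integral_cong) (auto simp: indicator_def)
  ultimately show "(LINT x:E|lborel. v x * laplacian f x) = (LINT x:E|lborel. g x * f x)" by simp
qed

text \<open>The function itself is the approximating sequence, cut off outside a large disc to make it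
  bounded; for \<open>h \<le> 1\<close> the differences at points of \<open>E\<close> do not see the cut.\<close>

lemma weak_laplacian_classical:
  assumes E: "open E" "bounded E" and f: "has_second_derivs f f11 f22" and cf: "continuous_on UNIV f"
  shows "has_weak_laplacian E f (\<lambda>x. f11 x + f22 x)"
proof -
  obtain R where R: "E \<subseteq> cball 0 R" using E(2) by (auto simp: bounded_iff subset_iff)
  have c: "continuous_on UNIV f11" "continuous_on UNIV f22" using f by (auto simp: has_second_derivs_def)
  define u where "u x = (if x \<in> cball 0 (R + 1) then f x else 0)" for x
  have "bounded (f ` cball 0 (R + 1))" "bounded ((\<lambda>x. f11 x + f22 x) ` cball 0 R)"
    using cf c by (auto intro!: compact_imp_bounded compact_continuous_image continuous_intros intro: continuous_on_subset)
  then obtain M G where "\<forall>x\<in>f ` cball 0 (R + 1). norm x \<le> M" "M > 0"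
    "\<forall>x\<in>(\<lambda>x. f11 x + f22 x) ` cball 0 R. norm x \<le> G" unfolding bounded_pos by metis
  then have M: "\<And>x. x \<in> cball 0 (R+1) \<Longrightarrow> \<bar>f x\<bar> \<le> M" and "M > 0"
    and G: "\<And>x. x \<in> cball 0 R \<Longrightarrow> \<bar>f11 x + f22 x\<bar> \<le> G"
    unfolding ball_simps by (metis real_norm_def)+
  have cons: "\<exists>h0>0. \<forall>h. 0 < h \<and> h < h0 \<longrightarrow> (\<forall>x\<in>E. \<bar>dlap h u x / h\<^sup>2 - (f11 x + f22 x)\<bar> \<le> e)" if e: "e > 0" for e
  proof -
    obtain h0 where h0: "h0 > 0" "\<And>h x. 0 < h \<Longrightarrow> h < h0 \<Longrightarrow> x \<in> cball 0 R \<Longrightarrow> \<bar>dlap h f x / h\<^sup>2 - (f11 x + f22 x)\<bar> \<le> e"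
      using dlap_consistency[OF f compact_cball e, of 0 R] by metis
    have "dlap h u x = dlap h f x" if "x \<in> E" "0 < h" "h < 1" for h x
    proof -
      have nx: "norm x \<le> R" using R that by auto
      have a: "norm (x + a) \<le> R + 1" if "norm a \<le> 1" for a using norm_triangle_ineq[of x a] nx that by linarith
      have e: "x - (h,0) = x + (-h,0)" "x - (0,h) = x + (0,-h)" by (simp_all add: prod_eq_iff)
      show ?thesis unfolding dlap_def u_def e using a[of "(h,0)"] a[of "(-h,0)"] a[of "(0,h)"] a[of "(0,-h)"] nx that
        by (simp add: norm_Pair)
    qed
    then show ?thesis using h0 R by (intro exI[of _ "min h0 1"]) (auto simp: subset_iff)
  qed
  obtain h1 where h1: "h1 > 0" "\<And>h x. 0 < h \<Longrightarrow> h < h1 \<Longrightarrow> x \<in> E \<Longrightarrow> \<bar>dlap h u x / h\<^sup>2 - (f11 x + f22 x)\<bar> \<le> 1"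
    using cons[of 1] by auto
  define h where "h n = h1 * inverse (real (Suc (Suc n)))" for n
  have hpos: "0 < h n" "h n < h1" for n
    using h1(1) by (simp_all add: h_def inverse_eq_divide divide_less_eq)
  have hlim: "h \<longlonglongrightarrow> 0" unfolding h_def
    using tendsto_mult_right_zero[OF LIMSEQ_Suc[OF LIMSEQ_inverse_real_of_nat]] by blast
  show ?thesis
  proof (rule weak_laplacian_of_dlap[OF E hpos(1) hlim, of "\<lambda>_. u" M])
    show "u \<in> borel_measurable borel" for n :: nat
    proof -
      have "u = (\<lambda>x. indicator (cball 0 (R + 1)) x * f x)" by (auto simp: u_def fun_eq_iff indicator_def)
      then show ?thesis
        using borel_measurable_times[OF borel_measurable_indicator[OF borel_closed[OF closed_cball]] borel_measurable_continuous_onI[OF cf]]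
        by simp
    qed
    show "\<bar>u x\<bar> \<le> M" for n :: nat and x using M[of x] \<open>M > 0\<close> by (simp add: u_def)
    show "(\<lambda>n::nat. u x) \<longlonglongrightarrow> f x" if "x \<in> E" for x
    proof -
      have "u x = f x" using R that by (auto simp: u_def)
      then show ?thesis by simp
    qed
    show "(\<lambda>n. dlap (h n) u x / (h n)\<^sup>2) \<longlonglongrightarrow> f11 x + f22 x" if x: "x \<in> E" for x
    proof (rule LIMSEQ_I)
      fix r :: real assume r: "0 < r"
      obtain h0 where h0: "h0 > 0" "\<And>h x. 0 < h \<Longrightarrow> h < h0 \<Longrightarrow> x \<in> E \<Longrightarrow> \<bar>dlap h u x / h\<^sup>2 - (f11 x + f22 x)\<bar> \<le> r/2"
        using cons[of "r/2"] r by auto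
      obtain N where "\<And>n. n \<ge> N \<Longrightarrow> h n < h0" using order_tendstoD(2)[OF hlim h0(1)] by (auto simp: eventually_sequentially)
      then have "\<bar>dlap (h n) u x / (h n)\<^sup>2 - (f11 x + f22 x)\<bar> < r" if "n \<ge> N" for n
        using h0(2)[OF hpos(1) _ x, of n] r that by fastforce
      then show "\<exists>no. \<forall>n\<ge>no. norm (dlap (h n) u x / (h n)\<^sup>2 - (f11 x + f22 x)) < r"
        unfolding real_norm_def by blast
    qed
    show "\<bar>dlap (h n) u x / (h n)\<^sup>2\<bar> \<le> G + 1" if "x \<in> E" for n x
      using h1(2)[OF hpos[of n] that] G[of x] R that by (auto simp: subset_iff)
  qed
qed

section \<open>Smooth bump functions\<close>

text \<open>The derivatives of \<open>exp (- 1 / s)\<close> for \<open>s > 0\<close> are combinations of these functions, and all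
  of them continue smoothly by zero.\<close>

definition flat :: "nat \<Rightarrow> real \<Rightarrow> real" where
  "flat n s = (if s > 0 then exp (- inverse s) * inverse s ^ n else 0)"

lemma exp_inverse_power_tendsto_0: "((\<lambda>s. exp (- inverse s) * inverse s ^ n) \<longlongrightarrow> 0) (at_right (0::real))"
proof -
  have "((\<lambda>x::real. x ^ n / exp x) \<longlongrightarrow> 0) at_top" by (rule tendsto_power_div_exp_0)
  then have "((\<lambda>s::real. inverse s ^ n / exp (inverse s)) \<longlongrightarrow> 0) (at_right 0)"
    by (rule filterlim_compose) (rule filterlim_inverse_at_top_right)
  then show ?thesis by (simp add: exp_minus field_simps)
qed

lemma flat_deriv:
  "(flat n has_real_derivative flat (n + 2) s - real n * flat (n + 1) s) (at s)"
proof -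
  consider "s > 0" | "s < 0" | "s = 0" by linarith
  then show ?thesis
  proof cases
    case 1
    have "((\<lambda>s. exp (- inverse s)) has_real_derivative exp (- inverse s) * (inverse s)\<^sup>2) (at s)"
      using 1 by (auto intro!: derivative_eq_intros simp: power2_eq_square)
    moreover have "((\<lambda>s. inverse s ^ n) has_real_derivative - (real n * inverse s ^ (n + 1))) (at s)"
    proof (cases n)
      case (Suc m)
      have "s \<noteq> 0" using 1 by simp
      show ?thesis
        by (rule DERIV_cong[OF DERIV_power[OF DERIV_inverse[OF \<open>s \<noteq> 0\<close>], where n=n]])
           (simp add: Suc power2_eq_square algebra_simps)
    qed simp
    ultimately have "((\<lambda>s. exp (- inverse s) * inverse s ^ n) has_real_derivative
        exp (- inverse s) * (inverse s)\<^sup>2 * inverse s ^ n + - (real n * inverse s ^ (n + 1)) * exp (- inverse s)) (at s)"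
      by (rule DERIV_mult)
    then have "((\<lambda>s. exp (- inverse s) * inverse s ^ n) has_real_derivative flat (n + 2) s - real n * flat (n + 1) s) (at s)"
      by (rule DERIV_cong) (use 1 in \<open>simp add: flat_def power2_eq_square algebra_simps\<close>)
    then show ?thesis
      by (rule has_field_derivative_transform_within_open[of _ _ _ "{0<..}"]) (use 1 in \<open>auto simp: flat_def\<close>)
  next
    case 2
    have "((\<lambda>_. 0) has_real_derivative flat (n + 2) s - real n * flat (n + 1) s) (at s)"
      using 2 by (simp add: flat_def)
    then show ?thesis
      by (rule has_field_derivative_transform_within_open[of _ _ _ "{..<0}"]) (use 2 in \<open>auto simp: flat_def\<close>)
  next
    case 3
    have "((\<lambda>h. (flat n (0 + h) - flat n 0) / h) \<longlongrightarrow> 0) (at 0)"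
    proof (rule filterlim_split_at)
      show "((\<lambda>h. (flat n (0 + h) - flat n 0) / h) \<longlongrightarrow> 0) (at_left 0)"
        by (rule Lim_transform_eventually[OF tendsto_const]) (auto simp: eventually_at_filter flat_def)
      show "((\<lambda>h. (flat n (0 + h) - flat n 0) / h) \<longlongrightarrow> 0) (at_right 0)"
         by (rule Lim_transform_eventually[OF exp_inverse_power_tendsto_0[of "Suc n"]])
           (auto simp: eventually_at_filter flat_def field_simps)
    qed
    then show ?thesis using 3 by (simp add: DERIV_def flat_def)
  qed
qed

definition gap :: "real \<Rightarrow> plane \<Rightarrow> real" where
  "gap \<rho> x = \<rho>\<^sup>2 - (fst x)\<^sup>2 - (snd x)\<^sup>2"

text \<open>A class of functions that contains a bump on the disc of radius \<open>\<rho>\<close> and is closed under partial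
  differentiation, so that its members are differentiable to every order.\<close>

inductive_set flat_family :: "real \<Rightarrow> (plane \<Rightarrow> real) set" for \<rho> where
  atom: "(\<lambda>x. c * fst x ^ i * snd x ^ j * flat n (gap \<rho> x)) \<in> flat_family \<rho>"
| add: "f \<in> flat_family \<rho> \<Longrightarrow> g \<in> flat_family \<rho> \<Longrightarrow> (\<lambda>x. f x + g x) \<in> flat_family \<rho>"

lemma flat_gap_derivative:
  "((\<lambda>x. flat n (gap \<rho> x)) has_derivative
     (\<lambda>v. (flat (n + 2) (gap \<rho> x) - real n * flat (n + 1) (gap \<rho> x)) * (- 2 * fst x * fst v - 2 * snd x * snd v))) (at x)"
proof -
  have "(gap \<rho> has_derivative (\<lambda>v. - 2 * fst x * fst v - 2 * snd x * snd v)) (at x)"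
    unfolding gap_def by (auto intro!: derivative_eq_intros simp: fun_eq_iff)
  from DERIV_compose_FDERIV[OF flat_deriv this] show ?thesis by (simp add: mult.commute)
qed

lemma flat_family_partial:
  assumes "f \<in> flat_family \<rho>"
  shows "\<exists>f1 f2. f1 \<in> flat_family \<rho> \<and> f2 \<in> flat_family \<rho> \<and>
    (\<forall>x. (f has_derivative (\<lambda>v. f1 x * fst v + f2 x * snd v)) (at x))"
  using assms
proof induction
  case (atom c i j n)
  let ?m = "\<lambda>c i j n x. c * fst x ^ i * snd x ^ j * flat n (gap \<rho> x)"
  let ?f1 = "\<lambda>x. (?m (c * real i) (i - 1) j n x + ?m (- 2 * c) (i + 1) j (n + 2) x) + ?m (2 * c * real n) (i + 1) j (n + 1) x"
  let ?f2 = "\<lambda>x. (?m (c * real j) i (j - 1) n x + ?m (- 2 * c) i (j + 1) (n + 2) x) + ?m (2 * c * real n) i (j + 1) (n + 1) x"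
  show ?case
  proof (rule exI[of _ ?f1], rule exI[of _ ?f2], intro conjI allI)
    show "?f1 \<in> flat_family \<rho>" by (intro flat_family.intros)
    show "?f2 \<in> flat_family \<rho>" by (intro flat_family.intros)
    fix x
    show "(?m c i j n has_derivative (\<lambda>v. ?f1 x * fst v + ?f2 x * snd v)) (at x)"
      by (rule derivative_eq_intros flat_gap_derivative refl)+ (simp add: fun_eq_iff algebra_simps)
  qed
next
  case (add f g)
  from add.IH(1) obtain f1 f2 where f: "f1 \<in> flat_family \<rho>" "f2 \<in> flat_family \<rho>"
    "\<forall>x. (f has_derivative (\<lambda>v. f1 x * fst v + f2 x * snd v)) (at x)"
    by (elim exE conjE) (rule that; assumption)
  from add.IH(2) obtain g1 g2 where g: "g1 \<in> flat_family \<rho>" "g2 \<in> flat_family \<rho>"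
    "\<forall>x. (g has_derivative (\<lambda>v. g1 x * fst v + g2 x * snd v)) (at x)"
    by (elim exE conjE) (rule that; assumption)
  show ?case
  proof (rule exI[of _ "\<lambda>x. f1 x + g1 x"], rule exI[of _ "\<lambda>x. f2 x + g2 x"], intro conjI allI)
    fix x show "((\<lambda>x. f x + g x) has_derivative (\<lambda>v. (f1 x + g1 x) * fst v + (f2 x + g2 x) * snd v)) (at x)"
      by (rule has_derivative_eq_rhs[OF has_derivative_add[OF f(3)[rule_format] g(3)[rule_format]]]) (simp add: fun_eq_iff algebra_simps)
  qed (intro flat_family.add f g)+
qed

lemma flat_family_C_diff: "f \<in> flat_family \<rho> \<Longrightarrow> C_diff m f"
proof (induction m arbitrary: f)
  case 0
  from flat_family_partial[OF this] obtain f1 f2 where "\<forall>x. (f has_derivative (\<lambda>v. f1 x * fst v + f2 x * snd v)) (at x)"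
    by (elim exE conjE) (rule that; assumption)
  then have "isCont f x" for x by (metis has_derivative_continuous)
  then show ?case by (simp add: continuous_at_imp_continuous_on)
next
  case (Suc m)
  from flat_family_partial[OF Suc.prems] obtain f1 f2 where f: "f1 \<in> flat_family \<rho>" "f2 \<in> flat_family \<rho>"
    and D: "\<forall>x. (f has_derivative (\<lambda>v. f1 x * fst v + f2 x * snd v)) (at x)"
    by (elim exE conjE) (rule that; assumption)
  have "frechet_derivative f (at x) = (\<lambda>v. f1 x * fst v + f2 x * snd v)" for x
    using frechet_derivative_at[OF D[rule_format, of x]] by simp
  then have "partial_deriv (1,0) f = f1" "partial_deriv (0,1) f = f2"
    by (auto simp: partial_deriv_def fun_eq_iff)
  moreover have "f differentiable (at x)" for x unfolding differentiable_def by (rule exI, rule D[rule_format])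
  ultimately show ?case using Suc.IH f by simp
qed

lemma partial_deriv_shift:
  assumes "\<And>x. f differentiable (at x)"
  shows "partial_deriv v (\<lambda>y. f (y - a)) x = partial_deriv v f (x - a)" "(\<lambda>y. f (y - a)) differentiable (at x)"
proof -
  have D: "(f has_derivative frechet_derivative f (at (x - a))) (at (x - a))" using assms by (simp add: frechet_derivative_works)
  have "((\<lambda>y. f (y - a)) has_derivative (\<lambda>h. frechet_derivative f (at (x - a)) h)) (at x)"
    by (rule has_derivative_compose[of "\<lambda>y. y - a" "\<lambda>h. h"]) (auto intro!: derivative_eq_intros D)
  then show "partial_deriv v (\<lambda>y. f (y - a)) x = partial_deriv v f (x - a)" "(\<lambda>y. f (y - a)) differentiable (at x)"
    using frechet_derivative_at[of "\<lambda>y. f (y - a)" _ x] by (auto simp: partial_deriv_def differentiable_def)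
qed

lemma C_diff_shift: "C_diff m f \<Longrightarrow> C_diff m (\<lambda>y. f (y - a))"
proof (induction m arbitrary: f)
  case 0 then show ?case by (auto intro!: continuous_on_compose2[of UNIV f] continuous_intros)
next
  case (Suc m)
  then have d: "\<And>x. f differentiable (at x)" by simp
  have "partial_deriv v (\<lambda>y. f (y - a)) = (\<lambda>x. partial_deriv v f (x - a))" for v
    using partial_deriv_shift(1)[OF d] by (simp add: fun_eq_iff)
  then show ?case using Suc partial_deriv_shift(2)[OF d] by simp
qed

lemma laplacian_shift:
  assumes "\<forall>m. C_diff m f"
  shows "laplacian (\<lambda>y. f (y - a)) x = laplacian f (x - a)"
proof -
  have "C_diff (Suc (Suc 0)) f" using assms by blast
  then have d: "\<And>x. f differentiable (at x)" "\<And>x. partial_deriv (1,0) f differentiable (at x)"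
    "\<And>x. partial_deriv (0,1) f differentiable (at x)" by simp_all
  have "partial_deriv v (\<lambda>y. f (y - a)) = (\<lambda>x. partial_deriv v f (x - a))" for v
    using partial_deriv_shift(1)[OF d(1)] by (simp add: fun_eq_iff)
  then show ?thesis by (simp add: laplacian_def partial_deriv_shift(1)[OF d(2)] partial_deriv_shift(1)[OF d(3)])
qed

section \<open>The energy inequality\<close>

lemma integrable_compact_support:
  fixes f :: "plane \<Rightarrow> real"
  assumes "continuous_on UNIV f" "bounded S" "\<And>x. x \<notin> S \<Longrightarrow> f x = 0"
  shows "integrable lborel f"
proof -
  have "compact (closure S)" using assms(2) by (simp add: compact_closure)
  moreover have "f x = 0" if "x \<notin> closure S" for x using assms(3) that closure_subset by blast
  ultimately obtain B where B: "\<And>x. \<bar>f x\<bar> \<le> B" using compact_support_bounded[OF assms(1)] by metis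
  show ?thesis
    by (rule integrable_bounded_support[OF borel_measurable_continuous_onI[OF assms(1)] B assms(2,3)])
qed

text \<open>The set where \<open>f\<close> is nonzero is open and null, hence empty.\<close>

lemma integral_zero_imp_zero:
  fixes f :: "plane \<Rightarrow> real"
  assumes c: "continuous_on U f" and U: "open U" and i: "integrable lborel (\<lambda>x. indicator U x * f x)"
    and nn: "\<And>x. x \<in> U \<Longrightarrow> 0 \<le> f x" and z: "(LINT x|lborel. indicator U x * f x) = 0" and x: "x \<in> U"
  shows "f x = 0"
proof (rule ccontr)
  assume nz: "f x \<noteq> 0"
  let ?S = "{y \<in> U. f y \<in> - {0}}"
  have oS: "open ?S"
    using continuous_open_preimage[OF c U, of "- {0}"] open_Compl[OF closed_singleton, of "0::real"] by (simp add: vimage_def Int_def)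
  have nn': "0 \<le> indicator U y * f y" for y using nn[of y] by (simp add: indicator_def)
  have "AE y in lborel. indicator U y * f y = 0"
    using integral_nonneg_eq_0_iff_AE[OF i] nn' z by simp
  then have "AE y in lborel. y \<notin> ?S" by eventually_elim (auto simp: indicator_def)
  moreover have "?S \<in> sets lborel" using oS by simp
  ultimately have "?S \<in> null_sets lborel" by (subst AE_iff_null_sets) auto
  then have "negligible ?S" by (simp add: negligible_iff_null_sets null_sets_completionI)
  moreover have "?S \<noteq> {}" using nz x by auto
  ultimately show False using open_not_negligible[OF oS] by simp
qed

lemma uniformly_continuous_compact_support:
  fixes f :: "plane \<Rightarrow> real"
  assumes c: "continuous_on UNIV f" and z: "\<And>x. x \<notin> cball 0 R \<Longrightarrow> f x = 0" and e: "e > 0"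
  shows "\<exists>d>0. \<forall>x y. dist x y < d \<longrightarrow> \<bar>f x - f y\<bar> < e"
proof -
  have "uniformly_continuous_on (cball 0 (R + 1)) f"
    by (intro compact_uniformly_continuous continuous_on_subset[OF c]) auto
  then obtain d where d: "d > 0" "\<And>x y. x \<in> cball 0 (R+1) \<Longrightarrow> y \<in> cball 0 (R+1) \<Longrightarrow> dist y x < d \<Longrightarrow> dist (f y) (f x) < e"
    unfolding uniformly_continuous_on_def using e by metis
  show ?thesis
  proof (intro exI[of _ "min d 1"] conjI allI impI)
    show "0 < min d 1" using d by simp
    fix x y :: plane assume xy: "dist x y < min d 1"
    show "\<bar>f x - f y\<bar> < e"
    proof (cases "x \<in> cball 0 (R+1) \<and> y \<in> cball 0 (R+1)")
      case True then show ?thesis using d(2)[of y x] xy by (simp add: dist_real_def)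
    next
      case False
      have "norm x \<le> norm y + dist x y" "norm y \<le> norm x + dist x y"
        by (metis dist_norm norm_triangle_sub add.commute dist_commute)+
      then have "x \<notin> cball 0 R" "y \<notin> cball 0 R" using False xy by auto
      then show ?thesis using z e by simp
    qed
  qed
qed

text \<open>The discrete form of integrating \<open>v \<Delta>f\<close> by parts. Truncation is monotone and does not increase
  distances, so \<open>(v y - v x)\<^sup>2 \<le> (v y - v x) * (f y - f x)\<close>.\<close>

lemma direction_energy:
  fixes f :: "plane \<Rightarrow> real"
  assumes c: "continuous_on UNIV f" and z: "\<And>x. x \<notin> cball 0 R \<Longrightarrow> f x = 0" and d: "d > 0"
  defines "v \<equiv> \<lambda>x. max (f x - d) 0"
  shows "(LINT x|lborel. v x * (f (x + a) + f (x - a) - 2 * f x)) \<le> - (LINT x|lborel. (v (x + a) - v x)\<^sup>2)"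
proof -
  have cv: "continuous_on UNIV v" unfolding v_def by (intro continuous_intros c)
  have zv: "v x = 0" if "x \<notin> cball 0 R" for x using z[OF that] d by (simp add: v_def)
  have cs: "continuous_on UNIV (\<lambda>x. g (x + b))" if "continuous_on UNIV g" for g :: "plane \<Rightarrow> real" and b
    by (rule continuous_on_compose2[OF that]) (auto intro!: continuous_intros)
  have ca: "continuous_on UNIV (\<lambda>x. f (x - a))" using cs[OF c, of "-a"] by simp
  have bS: "bounded (cball (0::plane) (R + norm a))" by simp
  have out: "x \<notin> cball 0 R \<and> x + a \<notin> cball 0 R" if "x \<notin> cball 0 (R + norm a)" for x
  proof -
    have "norm x \<le> norm (x + a) + norm a" by (metis add_diff_cancel norm_triangle_sub norm_minus_commute norm_triangle_ineq4)
    then show ?thesis using that by (auto intro: order_trans)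
  qed
  have i1: "integrable lborel (\<lambda>x. v x * (f (x + a) - f x))"
    by (rule integrable_compact_support[of _ "cball 0 R"]) (auto intro!: continuous_intros cv c cs zv)
  have i2: "integrable lborel (\<lambda>x. v x * (f (x - a) - f x))"
    by (rule integrable_compact_support[of _ "cball 0 R"]) (auto intro!: continuous_intros cv c ca zv)
  have i2': "integrable lborel (\<lambda>x. v (x + a) * (f x - f (x + a)))"
    using integrable_shift[OF i2, of a] by simp
  have e2: "(LINT x|lborel. v x * (f (x - a) - f x)) = (LINT x|lborel. v (x + a) * (f x - f (x + a)))"
    using integral_shift[of "\<lambda>x. v x * (f (x - a) - f x)" a] i2 by simp
  have i3: "integrable lborel (\<lambda>x. (v (x + a) - v x)\<^sup>2)"
  proof (rule integrable_compact_support[OF _ bS])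
    fix x :: plane assume "x \<notin> cball 0 (R + norm a)"
    from out[OF this] show "(v (x + a) - v x)\<^sup>2 = 0" using zv by simp
  qed (intro continuous_intros cv cs)
  have "(LINT x|lborel. v x * (f (x + a) + f (x - a) - 2 * f x)) = (LINT x|lborel. v x * (f (x + a) - f x) + v x * (f (x - a) - f x))"
    by (intro Bochner_Integration.integral_cong) (simp_all add: algebra_simps)
  also have "\<dots> = (LINT x|lborel. v x * (f (x + a) - f x)) + (LINT x|lborel. v (x + a) * (f x - f (x + a)))"
    by (simp add: Bochner_Integration.integral_add[OF i1 i2] e2)
  also have "\<dots> = (LINT x|lborel. v x * (f (x + a) - f x) + v (x + a) * (f x - f (x + a)))"
    by (rule Bochner_Integration.integral_add[OF i1 i2', symmetric])
  also have "\<dots> \<le> (LINT x|lborel. - (v (x + a) - v x)\<^sup>2)"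
  proof (rule integral_mono[OF Bochner_Integration.integrable_add[OF i1 i2'] Bochner_Integration.integrable_minus[OF i3]])
    fix x
    have "(v (x + a) - v x) * (v (x + a) - v x) \<le> (v (x + a) - v x) * (f (x + a) - f x)"
      unfolding v_def by (cases "f (x + a) \<le> f x") (auto intro!: mult_left_mono_neg mult_left_mono simp: max_def)
    then show "v x * (f (x + a) - f x) + v (x + a) * (f x - f (x + a)) \<le> - (v (x + a) - v x)\<^sup>2"
      by (simp add: power2_eq_square algebra_simps)
  qed
  finally show ?thesis by simp
qed

text \<open>The length \<open>L\<close> exceeds the diameter of the support, so \<open>v\<close> and its translate by \<open>L\<close> have disjoint
  supports and the squared norm of their difference is twice that of \<open>v\<close>. The difference
  telescopes into \<open>n\<close> steps of length \<open>h\<close>, and the Cauchy-Schwarz inequality costs a factor \<open>n\<close>.\<close>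

lemma poincare_differences:
  fixes v :: "plane \<Rightarrow> real"
  assumes c: "continuous_on UNIV v" and z: "\<And>x. x \<notin> cball 0 R \<Longrightarrow> v x = 0" and R: "R \<ge> 0" and n: "n > 0"
  defines "L \<equiv> 2 * R + 1" and "h \<equiv> (2 * R + 1) / real n"
  shows "(LINT x|lborel. (v x)\<^sup>2) \<le> L\<^sup>2 / 2 * ((LINT x|lborel. (v (x + (h, 0)) - v x)\<^sup>2) / h\<^sup>2)"
proof -
  have L: "L > 0" using R by (simp add: L_def)
  have h: "h > 0" "real n * h = L" using n L by (simp_all add: h_def L_def)
  have cs: "continuous_on UNIV (\<lambda>x. v (x + b))" for b
    by (rule continuous_on_compose2[OF c]) (auto intro!: continuous_intros)
  define D where "D x = (v (x + (h, 0)) - v x)\<^sup>2" for x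
  have out: "x + a \<notin> cball 0 R" if "x \<notin> cball 0 (R + norm a)" for x a :: plane
  proof -
    have "norm x \<le> norm (x + a) + norm a" by (metis add_diff_cancel norm_triangle_ineq4)
    then show ?thesis using that by auto
  qed
  have iv2: "integrable lborel (\<lambda>x. (v x)\<^sup>2)"
    by (rule integrable_compact_support[of _ "cball 0 R"]) (auto intro!: continuous_intros c simp: z)
  have iv2': "integrable lborel (\<lambda>x. (v (x + (L, 0)))\<^sup>2)" using integrable_shift[OF iv2] by simp
  have iD: "integrable lborel D" unfolding D_def
  proof (rule integrable_compact_support[of _ "cball 0 (R + \<bar>h\<bar>)"])
    fix x :: plane assume x: "x \<notin> cball 0 (R + \<bar>h\<bar>)"
    have "x + (h,0) \<notin> cball 0 R" using out[of x "(h,0)"] x by (simp add: norm_Pair)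
    moreover have "x \<notin> cball 0 R" using x by auto
    ultimately show "(v (x + (h, 0)) - v x)\<^sup>2 = 0" using z by simp
  qed (auto intro!: continuous_intros c cs)
  have iDs: "integrable lborel (\<lambda>x. D (x + a))" for a by (rule integrable_shift[OF iD])
  have sep: "(v (x + (L, 0)) - v x)\<^sup>2 = (v (x + (L, 0)))\<^sup>2 + (v x)\<^sup>2" for x
  proof -
    have "L \<le> norm (x + (L,0)) + norm x" using norm_triangle_ineq4[of "x + (L,0)" x] L by (simp add: norm_Pair)
    then have "x + (L,0) \<notin> cball 0 R \<or> x \<notin> cball 0 R" by (auto simp: L_def)
    then have "v (x + (L,0)) = 0 \<or> v x = 0" using z by blast
    then have "v (x + (L,0)) * v x = 0" by simp
    then show ?thesis by (simp add: power2_diff)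
  qed
  have tel: "(v (x + (L, 0)) - v x)\<^sup>2 \<le> (\<Sum>j<n. real n * D (x + (real j * h, 0)))" for x
  proof -
    have "v (x + (L, 0)) - v x = (\<Sum>j<n. v (x + (real (Suc j) * h, 0)) - v (x + (real j * h, 0)))"
      by (subst sum_lessThan_telescope) (simp add: h(2) flip: zero_prod_def)
    then have "(v (x + (L, 0)) - v x)\<^sup>2 \<le> real (card {..<n}) * (\<Sum>j<n. (v (x + (real (Suc j) * h, 0)) - v (x + (real j * h, 0)))\<^sup>2)"
      using sum_squared_le_sum_of_squares[of "\<lambda>j. v (x + (real (Suc j) * h, 0)) - v (x + (real j * h, 0))" "{..<n}"] by (simp add: mult.commute)
    also have "\<dots> = (\<Sum>j<n. real n * D (x + (real j * h, 0)))"
    proof -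
      have e: "x + (real j * h, 0) + (h, 0) = x + (real (Suc j) * h, 0)" for j
        by (simp add: prod_eq_iff algebra_simps)
      show ?thesis by (simp only: D_def sum_distrib_left e card_lessThan)
    qed
    finally show ?thesis .
  qed
  have "2 * (LINT x|lborel. (v x)\<^sup>2) = (LINT x|lborel. (v (x + (L, 0)))\<^sup>2 + (v x)\<^sup>2)"
    using integral_shift[of "\<lambda>x. (v x)\<^sup>2" "(L,0)"] iv2 by (simp add: Bochner_Integration.integral_add[OF iv2' iv2])
  also have "\<dots> \<le> (LINT x|lborel. (\<Sum>j<n. real n * D (x + (real j * h, 0))))"
    by (rule integral_mono[OF Bochner_Integration.integrable_add[OF iv2' iv2]])
       (use tel sep iDs in \<open>auto intro!: Bochner_Integration.integrable_sum\<close>)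
  also have "\<dots> = (\<Sum>j<n. real n * (LINT x|lborel. D (x + (real j * h, 0))))"
    using iDs by (subst Bochner_Integration.integral_sum) auto
  also have "\<dots> = real n * (real n * (LINT x|lborel. D x))"
    using integral_shift[of D] iD by simp
  finally have "2 * (LINT x|lborel. (v x)\<^sup>2) \<le> (real n)\<^sup>2 * (LINT x|lborel. D x)" by (simp add: power2_eq_square)
  moreover have "real n = L / h" using h by (simp add: field_simps)
  ultimately show ?thesis by (simp add: D_def power_divide)
qed

lemma mollifier_exists:
  assumes "\<rho> > 0"
  shows "\<exists>\<eta> :: plane \<Rightarrow> real. (\<forall>m. C_diff m \<eta>) \<and> (\<forall>x. 0 \<le> \<eta> x) \<and> (\<forall>x. x \<notin> cball 0 \<rho> \<longrightarrow> \<eta> x = 0) \<and>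
     integrable lborel \<eta> \<and> (LINT x|lborel. \<eta> x) = 1"
proof -
  define b where "b c x = c * fst x ^ 0 * snd x ^ 0 * flat 0 (gap \<rho> x)" for c x
  have sm: "C_diff m (b c)" for m c unfolding b_def by (rule flat_family_C_diff[OF flat_family.atom])
  have g: "gap \<rho> x = \<rho>\<^sup>2 - (norm x)\<^sup>2" for x by (simp add: gap_def norm_prod_def)
  have z: "b c x = 0" if "x \<notin> cball 0 \<rho>" for c x
  proof -
    have "\<rho>\<^sup>2 \<le> (norm x)\<^sup>2" by (rule power_mono) (use that assms in auto)
    then show ?thesis by (simp add: b_def flat_def g)
  qed
  have i: "integrable lborel (b c)" for c
    by (rule integrable_compact_support[OF C_diff_continuous[OF sm[of 0]], of "cball 0 \<rho>"]) (auto simp: z)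
  have nn: "0 \<le> b 1 x" for x by (simp add: b_def flat_def)
  define m where "m = (LINT x|lborel. b 1 x)"
  have "m \<noteq> 0"
  proof
    assume "m = 0"
    then have "b 1 0 = 0"
      using integral_zero_imp_zero[of UNIV "b 1" 0] C_diff_continuous[OF sm[of 0 1]] i[of 1] nn by (simp add: m_def)
    then show False using assms by (simp add: b_def flat_def g)
  qed
  moreover have "m \<ge> 0" unfolding m_def by (rule integral_nonneg_AE) (simp add: nn)
  ultimately have m: "m > 0" by simp
  have sc: "b (1 / m) = (\<lambda>x. b 1 x / m)" by (simp add: b_def fun_eq_iff)
  show ?thesis
  proof (intro exI[of _ "b (1 / m)"] conjI allI impI sm i z)
    show "0 \<le> b (1 / m) x" for x using nn[of x] m by (simp add: sc)
    show "(LINT x|lborel. b (1 / m) x) = 1" unfolding sc using m by (simp add: m_def)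
  qed
qed

text \<open>The mollified function is a weighted mean of \<open>\<phi>\<close> over discs of radius \<open>\<rho>\<close>, so it inherits bounds
  for \<open>\<phi>\<close> and its modulus of continuity.\<close>

lemma continuous_mollified:
  fixes \<phi> \<eta> :: "plane \<Rightarrow> real"
  assumes c: "continuous_on UNIV \<phi>" and z: "\<And>x. x \<notin> cball 0 R \<Longrightarrow> \<phi> x = 0"
    and \<eta>: "continuous_on UNIV \<eta>" "\<And>x. 0 \<le> \<eta> x" "\<And>x. x \<notin> cball 0 \<rho> \<Longrightarrow> \<eta> x = 0"
       "(LINT x|lborel. \<eta> x) = 1"
  defines "f \<equiv> \<lambda>x. LINT y|lborel. \<phi> y * \<eta> (y - x)"
  shows "\<And>x t. (\<And>y. norm y \<le> \<rho> \<Longrightarrow> \<bar>\<phi> (x + y) - t\<bar> \<le> e) \<Longrightarrow> \<bar>f x - t\<bar> \<le> e"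
    and "continuous_on UNIV f"
proof -
  have cs: "continuous_on UNIV (\<lambda>x. g (x + b))" if "continuous_on UNIV g" for g :: "plane \<Rightarrow> real" and b
    by (rule continuous_on_compose2[OF that]) (auto intro!: continuous_intros)
  have i\<eta>: "integrable lborel \<eta>" by (rule integrable_compact_support[OF \<eta>(1), of "cball 0 \<rho>"]) (auto simp: \<eta>(3))
  have i: "integrable lborel (\<lambda>y. \<phi> (y + x) * \<eta> y)" for x
    by (rule integrable_compact_support[of _ "cball 0 \<rho>"]) (auto intro!: continuous_intros cs c \<eta>(1) simp: \<eta>(3))
  have f: "f x = (LINT y|lborel. \<phi> (y + x) * \<eta> y)" for x
  proof -
    have "(\<lambda>y. \<phi> y * \<eta> (y - x)) \<in> borel_measurable borel"
      using cs[OF \<eta>(1), of "-x"] by (intro borel_measurable_continuous_onI continuous_intros c) simp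
    from integral_shift[OF this, of x] show ?thesis by (simp add: f_def)
  qed
  have avg: "\<bar>(LINT y|lborel. g y * \<eta> y)\<bar> \<le> e"
    if g: "integrable lborel (\<lambda>y. g y * \<eta> y)" "\<And>y. norm y \<le> \<rho> \<Longrightarrow> \<bar>g y\<bar> \<le> e" for g e
  proof -
    have "\<bar>(LINT y|lborel. g y * \<eta> y)\<bar> \<le> (LINT y|lborel. \<bar>g y * \<eta> y\<bar>)" by (rule integral_abs_bound)
    also have "\<dots> \<le> (LINT y|lborel. e * \<eta> y)"
    proof (rule integral_mono)
      fix y show "\<bar>g y * \<eta> y\<bar> \<le> e * \<eta> y"
        using g(2)[of y] \<eta>(2)[of y] \<eta>(3)[of y] by (cases "norm y \<le> \<rho>") (auto simp: abs_mult intro: mult_right_mono)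
    qed (use g i\<eta> in auto)
    also have "\<dots> = e" using \<eta>(4) by simp
    finally show ?thesis .
  qed
  show close: "\<bar>f x - t\<bar> \<le> e" if "\<And>y. norm y \<le> \<rho> \<Longrightarrow> \<bar>\<phi> (x + y) - t\<bar> \<le> e" for x t e
  proof -
    have "f x - t = (LINT y|lborel. \<phi> (y + x) * \<eta> y) - (LINT y|lborel. t * \<eta> y)" using \<eta>(4) by (simp add: f)
    also have "\<dots> = (LINT y|lborel. \<phi> (y + x) * \<eta> y - t * \<eta> y)"
      by (rule Bochner_Integration.integral_diff[symmetric]) (use i i\<eta> in auto)
    also have "\<dots> = (LINT y|lborel. (\<phi> (y + x) - t) * \<eta> y)" by (simp add: left_diff_distrib)
    finally have "f x - t = (LINT y|lborel. (\<phi> (y + x) - t) * \<eta> y)" .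
    moreover have "integrable lborel (\<lambda>y. (\<phi> (y + x) - t) * \<eta> y)"
      unfolding left_diff_distrib using i i\<eta> by auto
    ultimately show ?thesis using avg[of "\<lambda>y. \<phi> (y + x) - t" e] that by (simp add: add.commute)
  qed
  show "continuous_on UNIV f"
    unfolding continuous_on_iff
  proof (intro ballI allI impI)
    fix x :: plane and e :: real assume e: "e > 0"
    obtain d where d: "d > 0" "\<And>x y. dist x y < d \<Longrightarrow> \<bar>\<phi> x - \<phi> y\<bar> < e / 2"
      using uniformly_continuous_compact_support[OF c z, of R "e / 2"] e by auto
    show "\<exists>d>0. \<forall>x'\<in>UNIV. dist x' x < d \<longrightarrow> dist (f x') (f x) < e"
    proof (intro exI[of _ d] conjI ballI impI d(1))
      fix x' assume x': "dist x' x < d"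
      have "f x' - f x = (LINT y|lborel. \<phi> (y + x') * \<eta> y - \<phi> (y + x) * \<eta> y)"
        unfolding f by (rule Bochner_Integration.integral_diff[symmetric]) (rule i)+
      also have "\<dots> = (LINT y|lborel. (\<phi> (y + x') - \<phi> (y + x)) * \<eta> y)" by (simp add: left_diff_distrib)
      finally have "f x' - f x = (LINT y|lborel. (\<phi> (y + x') - \<phi> (y + x)) * \<eta> y)" .
      moreover have "\<bar>\<dots>\<bar> \<le> e / 2"
      proof (rule avg)
        show "integrable lborel (\<lambda>y. (\<phi> (y + x') - \<phi> (y + x)) * \<eta> y)"
          unfolding left_diff_distrib using i by auto
        fix y show "\<bar>\<phi> (y + x') - \<phi> (y + x)\<bar> \<le> e / 2"
          using d(2)[of "y + x'" "y + x"] x' by (simp add: dist_norm)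
      qed
      ultimately show "dist (f x') (f x) < e" using e by (simp add: dist_real_def)
    qed
  qed
qed

text \<open>A continuous \<open>\<phi>\<close> has no gradient whose square could be integrated, so the energy inequality is
  proved for a mollified and truncated positive part \<open>v\<close>. After mollification the equation holds at
  every point whose \<open>\<rho>\<close>-disc lies in \<open>E\<close>, because the mollifier centred there is a test
  function. Truncation at height \<open>t / 2\<close> removes the other points, since \<open>\<phi>\<close> is small near the
  boundary. The right-hand side \<open>t\<close> absorbs the errors of both steps and of the differences.\<close>

lemma truncated_mollification:
  fixes \<phi> p g :: "plane \<Rightarrow> real"
  assumes E: "open E" "E \<subseteq> cball 0 R" and R: "R \<ge> 0" and c: "continuous_on UNIV \<phi>"
    and z: "\<And>x. x \<notin> E \<Longrightarrow> \<phi> x = 0"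
    and w: "has_weak_laplacian E \<phi> g" and p: "continuous_on UNIV p" "\<And>x. x \<in> E \<Longrightarrow> g x = p x"
    and t: "t > 0"
  shows "\<exists>v. continuous_on UNIV v \<and> (\<forall>x. x \<notin> E \<longrightarrow> v x = 0) \<and> (\<forall>x. \<bar>v x - max (\<phi> x) 0\<bar> \<le> t) \<and>
     (LINT x|lborel. (v x)\<^sup>2) \<le> (2 * R + 1)\<^sup>2 / 2 * (LINT x|lborel. v x * (t - p x))"
proof -
  have zR: "\<phi> x = 0" if "x \<notin> cball 0 R" for x using z E(2) that by blast
  obtain d1 where d1: "d1 > 0" "\<And>x y. dist x y < d1 \<Longrightarrow> \<bar>\<phi> x - \<phi> y\<bar> < t / 4"
    using uniformly_continuous_compact_support[OF c zR, of R "t / 4"] t by auto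
  have "uniformly_continuous_on (cball 0 (R + 1)) p"
    by (intro compact_uniformly_continuous continuous_on_subset[OF p(1)]) auto
  then obtain d2 where d2: "d2 > 0" "\<And>x y. x \<in> cball 0 (R+1) \<Longrightarrow> y \<in> cball 0 (R+1) \<Longrightarrow> dist y x < d2 \<Longrightarrow> dist (p y) (p x) < t / 2"
    unfolding uniformly_continuous_on_def using t by (metis half_gt_zero)
  define \<rho> where "\<rho> = min (min d1 d2) 1 / 2"
  have \<rho>: "\<rho> > 0" "\<rho> < d1" "\<rho> < d2" "\<rho> < 1" using d1 d2 by (auto simp: \<rho>_def min_def)
  obtain \<eta> :: "plane \<Rightarrow> real" where sm: "\<forall>m. C_diff m \<eta>" and nn: "\<And>x. 0 \<le> \<eta> x" and z\<eta>: "\<And>x. x \<notin> cball 0 \<rho> \<Longrightarrow> \<eta> x = 0"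
    and i\<eta>: "integrable lborel \<eta>" and one: "(LINT x|lborel. \<eta> x) = 1"
    using mollifier_exists[OF \<rho>(1)] by metis
  have c\<eta>: "continuous_on UNIV \<eta>" using sm C_diff_continuous by blast
  have cL: "continuous_on UNIV (laplacian \<eta>)" by (rule C_diff_laplacian_continuous[OF sm])
  have cs: "continuous_on UNIV (\<lambda>x. q (x - b))" if "continuous_on UNIV q" for q :: "plane \<Rightarrow> real" and b
    by (rule continuous_on_compose2[OF that]) (auto intro!: continuous_intros)
  define f where "f x = (LINT y|lborel. \<phi> y * \<eta> (y - x))" for x
  note moll = continuous_mollified[OF c zR c\<eta> nn z\<eta> one, folded f_def]
  have cf: "continuous_on UNIV f" by (rule moll(2))
  have close: "\<bar>f x - \<phi> x\<bar> \<le> t / 4" for x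
  proof (rule moll(1))
    fix y :: plane assume "norm y \<le> \<rho>"
    then show "\<bar>\<phi> (x + y) - \<phi> x\<bar> \<le> t / 4" using d1(2)[of "x + y" x] \<rho>(2) by (simp add: dist_norm)
  qed
  have zf: "f x = 0" if "x \<notin> cball 0 (R + 1)" for x
  proof -
    have "\<bar>f x - 0\<bar> \<le> 0"
    proof (rule moll(1))
      fix y :: plane assume "norm y \<le> \<rho>"
      moreover have "norm x \<le> norm (x + y) + norm y" by (metis add_diff_cancel norm_triangle_ineq4)
      ultimately have "x + y \<notin> cball 0 R" using \<rho>(4) that by auto
      then show "\<bar>\<phi> (x + y) - 0\<bar> \<le> 0" using zR by simp
    qed
    then show ?thesis by simp
  qed
  define v where "v x = max (f x - t / 2) 0" for x
  have cv: "continuous_on UNIV v" unfolding v_def by (intro continuous_intros cf)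
  have deep: "cball x \<rho> \<subseteq> E" if "v x \<noteq> 0" for x
  proof (rule subsetI, rule ccontr)
    fix y assume y: "y \<in> cball x \<rho>" "y \<notin> E"
    have "f x > t / 2" using that by (simp add: v_def max_def split: if_splits)
    then have "\<phi> x > t / 4" using close[of x] by linarith
    moreover have "\<bar>\<phi> x - \<phi> y\<bar> < t / 4" using d1(2)[of x y] y \<rho>(2) by simp
    ultimately show False using z[OF y(2)] by simp
  qed
  have zv: "v x = 0" if "x \<notin> E" for x using deep[of x] that \<rho>(1) by force
  have zvR: "v x = 0" if "x \<notin> cball 0 (R+1)" for x using zf[OF that] t by (simp add: v_def)
  have zvR': "v x = 0" if "x \<notin> cball 0 R" for x using zv E(2) that by blast
  have vnn: "v x \<ge> 0" for x by (simp add: v_def)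
  have vclose: "\<bar>v x - max (\<phi> x) 0\<bar> \<le> t" for x
  proof -
    have "\<bar>max a 0 - max b 0\<bar> \<le> \<bar>a - b\<bar>" for a b :: real by (auto simp: max_def)
    from this[of "f x - t / 2" "\<phi> x"] show ?thesis using close[of x] t unfolding v_def by linarith
  qed
  define M where "M = (LINT y|lborel. \<bar>\<phi> y\<bar>)"
  have i\<phi>: "integrable lborel (\<lambda>y. \<bar>\<phi> y\<bar>)"
    by (rule integrable_compact_support[of _ "cball 0 R"]) (auto intro!: continuous_intros c simp: zR)
  have M: "M \<ge> 0" unfolding M_def by (rule integral_nonneg_AE) simp
  define \<kappa> where "\<kappa> = t / 2 / (M + 1)"
  have \<kappa>: "\<kappa> > 0" using t M by (simp add: \<kappa>_def)
  obtain h0 where h0: "h0 > 0" "\<And>h x. 0 < h \<Longrightarrow> h < h0 \<Longrightarrow> x \<in> cball 0 (2 * R + 1) \<Longrightarrow> \<bar>dlap h \<eta> x / h\<^sup>2 - laplacian \<eta> x\<bar> \<le> \<kappa>"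
    using dlap_consistency[OF C_diff_second_derivs[OF sm] compact_cball \<kappa>] unfolding laplacian_def by metis
  (* The mollified equation: A compares differences with the Laplacian of the mollifier,
     B is the weak equation, and C uses the continuity of p. *)
  have Lf: "p x - t \<le> dlap h f x / h\<^sup>2" if x: "v x \<noteq> 0" and h: "0 < h" "h < h0" for x h
  proof -
    note dx = deep[OF x]
    have xE: "x \<in> E" using dx \<rho>(1) by force
    have xR: "norm x \<le> R" using xE E(2) by auto
    have i1: "integrable lborel (\<lambda>y. \<phi> y * \<eta> (y - b))" for b
      by (rule integrable_compact_support[of _ "cball 0 R"]) (auto intro!: continuous_intros c cs c\<eta> simp: zR)
    have i2: "integrable lborel (\<lambda>y. \<phi> y * laplacian \<eta> (y - x))"
      by (rule integrable_compact_support[of _ "cball 0 R"]) (auto intro!: continuous_intros c cs cL simp: zR)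
    have "dlap h f x = (LINT y|lborel. \<phi> y * \<eta> (y - (x + (h,0))) + \<phi> y * \<eta> (y - (x - (h,0)))
        + \<phi> y * \<eta> (y - (x + (0,h))) + \<phi> y * \<eta> (y - (x - (0,h))) - 4 * (\<phi> y * \<eta> (y - x)))"
      unfolding dlap_def f_def by (rule integral_five_points[symmetric]) (rule i1)+
    also have "\<dots> = (LINT y|lborel. \<phi> y * dlap h \<eta> (y - x))"
      by (intro Bochner_Integration.integral_cong) (simp_all add: dlap_def algebra_simps del: uminus_Pair)
    finally have df: "dlap h f x / h\<^sup>2 = (LINT y|lborel. \<phi> y * (dlap h \<eta> (y - x) / h\<^sup>2))" by simp
    have i3: "integrable lborel (\<lambda>y. \<phi> y * (dlap h \<eta> (y - x) / h\<^sup>2))"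
    proof (rule integrable_compact_support[of _ "cball 0 R"])
      have "continuous_on UNIV (dlap h \<eta>)" unfolding dlap_def
        by (intro continuous_intros continuous_on_compose2[OF c\<eta>]) auto
      then show "continuous_on UNIV (\<lambda>y. \<phi> y * (dlap h \<eta> (y - x) / h\<^sup>2))"
        using h by (intro continuous_intros c cs) auto
    qed (auto simp: zR)
    have A: "\<bar>dlap h f x / h\<^sup>2 - (LINT y|lborel. \<phi> y * laplacian \<eta> (y - x))\<bar> \<le> t / 2"
    proof -
      have "\<bar>dlap h f x / h\<^sup>2 - (LINT y|lborel. \<phi> y * laplacian \<eta> (y - x))\<bar>
         = \<bar>(LINT y|lborel. \<phi> y * (dlap h \<eta> (y - x) / h\<^sup>2) - \<phi> y * laplacian \<eta> (y - x))\<bar>"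
        unfolding df by (subst Bochner_Integration.integral_diff[OF i3 i2]) simp
      also have "\<dots> \<le> (LINT y|lborel. \<bar>\<phi> y * (dlap h \<eta> (y - x) / h\<^sup>2) - \<phi> y * laplacian \<eta> (y - x)\<bar>)"
        by (rule integral_abs_bound)
      also have "\<dots> \<le> (LINT y|lborel. \<kappa> * \<bar>\<phi> y\<bar>)"
      proof (rule integral_mono)
        fix y
        show "\<bar>\<phi> y * (dlap h \<eta> (y - x) / h\<^sup>2) - \<phi> y * laplacian \<eta> (y - x)\<bar> \<le> \<kappa> * \<bar>\<phi> y\<bar>"
        proof (cases "y \<in> cball 0 R")
          case True
          have "norm (y - x) \<le> norm y + norm x" by (rule norm_triangle_ineq4)
          then have "y - x \<in> cball 0 (2 * R + 1)" using True xR by simp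
          then have "\<bar>dlap h \<eta> (y - x) / h\<^sup>2 - laplacian \<eta> (y - x)\<bar> \<le> \<kappa>" using h0(2) h by blast
          then have "\<bar>\<phi> y\<bar> * \<bar>dlap h \<eta> (y - x) / h\<^sup>2 - laplacian \<eta> (y - x)\<bar> \<le> \<bar>\<phi> y\<bar> * \<kappa>" by (rule mult_left_mono) simp
          then show ?thesis by (simp only: abs_mult[symmetric] right_diff_distrib mult.commute)
        next
          case False then show ?thesis using zR \<kappa> by simp
        qed
      qed (use i2 i3 i\<phi> in auto)
      also have "\<dots> = \<kappa> * M" by (simp add: M_def)
      also have "\<dots> \<le> t / 2"
      proof -
        have "M / (M + 1) \<le> 1" using M by simp
        then have "t / 2 * (M / (M + 1)) \<le> t / 2 * 1" by (rule mult_left_mono) (use t in simp)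
        then show ?thesis by (simp add: \<kappa>_def)
      qed
      finally show ?thesis .
    qed
    have test: "(\<lambda>y. \<eta> (y - x)) \<in> test_functions E"
      unfolding test_functions_def mem_Collect_eq
    proof (intro conjI allI)
      show "C_diff m (\<lambda>y. \<eta> (y - x))" for m using sm by (intro C_diff_shift) blast
      show "\<exists>K. compact K \<and> K \<subseteq> E \<and> (\<forall>y. y \<notin> K \<longrightarrow> \<eta> (y - x) = 0)"
        by (rule exI[of _ "cball x \<rho>"]) (use dx z\<eta> in \<open>auto simp: dist_norm norm_minus_commute\<close>)
    qed
    have "(LINT y|lborel. \<phi> y * laplacian \<eta> (y - x)) = (LINT y:E|lborel. \<phi> y * laplacian (\<lambda>y. \<eta> (y - x)) y)"
      unfolding laplacian_shift[OF sm] by (rule set_integral_support[symmetric]) (simp add: z)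
    also have "\<dots> = (LINT y:E|lborel. g y * \<eta> (y - x))" using w test unfolding has_weak_laplacian_def by blast
    also have "\<dots> = (LINT y|lborel. p y * \<eta> (y - x))"
    proof -
      have "indicator E y *\<^sub>R (g y * \<eta> (y - x)) = p y * \<eta> (y - x)" for y
      proof (cases "y \<in> E")
        case False
        then have "y \<notin> cball x \<rho>" using dx by blast
        then have "\<eta> (y - x) = 0" using z\<eta>[of "y - x"] by (simp add: dist_norm norm_minus_commute)
        then show ?thesis by simp
      qed (simp add: p(2))
      then show ?thesis unfolding set_lebesgue_integral_def by (simp only:)
    qed
    finally have B: "(LINT y|lborel. \<phi> y * laplacian \<eta> (y - x)) = (LINT y|lborel. p y * \<eta> (y - x))" .
    have i\<eta>x: "integrable lborel (\<lambda>y. \<eta> (y - x))" using integrable_shift[OF i\<eta>, of "-x"] by simp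
    have one': "(LINT y|lborel. \<eta> (y - x)) = 1" using integral_shift[of \<eta> "-x"] i\<eta> one by simp
    have ip: "integrable lborel (\<lambda>y. p y * \<eta> (y - x))"
      by (rule integrable_compact_support[of _ "cball x \<rho>"]) (auto intro!: continuous_intros p cs c\<eta> z\<eta> simp: dist_norm norm_minus_commute)
    have C: "p x - t / 2 \<le> (LINT y|lborel. p y * \<eta> (y - x))"
    proof -
      have "p x - t / 2 = (LINT y|lborel. (p x - t / 2) * \<eta> (y - x))" using one' by simp
      also have "\<dots> \<le> (LINT y|lborel. p y * \<eta> (y - x))"
      proof (rule integral_mono)
        fix y
        show "(p x - t / 2) * \<eta> (y - x) \<le> p y * \<eta> (y - x)"
        proof (cases "y \<in> cball x \<rho>")
          case True
          have "y \<in> cball 0 R" using True dx E(2) by blast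
          then have "x \<in> cball 0 (R+1)" "y \<in> cball 0 (R+1)" using xR by auto
          then have "dist (p y) (p x) < t / 2" using d2(2)[of x y] True \<rho>(3) by (simp add: dist_commute)
          then have "p x - t / 2 \<le> p y" unfolding dist_real_def by linarith
          then show ?thesis using nn by (rule mult_right_mono)
        next
          case False then have "\<eta> (y - x) = 0" using z\<eta>[of "y - x"] by (simp add: dist_norm norm_minus_commute)
          then show ?thesis by simp
        qed
      qed (use ip i\<eta>x in auto)
      finally show ?thesis .
    qed
    show ?thesis using A[unfolded B] C by linarith
  qed
  obtain n :: nat where n: "real n > (2 * R + 3) / h0" using reals_Archimedean2 by blast
  have "n > 0" using n h0(1) R by (cases n) (auto simp: field_simps)
  define h where "h = (2 * R + 1) / real n"
  have h: "0 < h" "h < h0"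
  proof -
    show "0 < h" using R \<open>n > 0\<close> by (simp add: h_def)
    have "2 * R + 3 < real n * h0" using n h0(1) by (simp add: field_simps)
    then show "h < h0" using \<open>n > 0\<close> by (simp add: h_def field_simps)
  qed
  have cs': "continuous_on UNIV (\<lambda>x. q (x + b))" if "continuous_on UNIV q" for q :: "plane \<Rightarrow> real" and b
    using cs[OF that, of "-b"] by simp
  have cdf: "continuous_on UNIV (\<lambda>x. f (x + a) + f (x - a) - 2 * f x)" for a by (intro continuous_intros cs cs' cf)
  have iv: "integrable lborel (\<lambda>x. v x * q x)" if "continuous_on UNIV q" for q
    by (rule integrable_compact_support[of _ "cball 0 (R+1)"]) (auto intro!: continuous_intros cv that simp: zvR)
  have dir: "(LINT x|lborel. v x * (f (x + a) + f (x - a) - 2 * f x)) \<le> - (LINT x|lborel. (v (x + a) - v x)\<^sup>2)" for a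
    using direction_energy[OF cf zf, of "R + 1" "t / 2" a] t by (simp add: v_def)
  have "(LINT x|lborel. v x * dlap h f x) =
      (LINT x|lborel. v x * (f (x + (h,0)) + f (x - (h,0)) - 2 * f x) + v x * (f (x + (0,h)) + f (x - (0,h)) - 2 * f x))"
    by (intro Bochner_Integration.integral_cong) (simp_all add: dlap_def algebra_simps)
  also have "\<dots> = (LINT x|lborel. v x * (f (x + (h,0)) + f (x - (h,0)) - 2 * f x)) + (LINT x|lborel. v x * (f (x + (0,h)) + f (x - (0,h)) - 2 * f x))"
    by (rule Bochner_Integration.integral_add) (intro iv cdf)+
  also have "\<dots> \<le> - (LINT x|lborel. (v (x + (h,0)) - v x)\<^sup>2) + 0"
  proof (rule add_mono[OF dir])
    have "(LINT x|lborel. (v (x + (0,h)) - v x)\<^sup>2) \<ge> 0" by (rule integral_nonneg_AE) simp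
    then show "(LINT x|lborel. v x * (f (x + (0,h)) + f (x - (0,h)) - 2 * f x)) \<le> 0" using dir[of "(0,h)"] by linarith
  qed
  finally have en: "(LINT x|lborel. (v (x + (h,0)) - v x)\<^sup>2) \<le> - (LINT x|lborel. v x * dlap h f x)" by simp
  have cd: "continuous_on UNIV (dlap h f)"
    unfolding dlap_def by (intro continuous_intros cs cs' cf)
  have "(LINT x|lborel. (v (x + (h,0)) - v x)\<^sup>2) / h\<^sup>2 \<le> - (LINT x|lborel. v x * dlap h f x) / h\<^sup>2"
    using en by (rule divide_right_mono) simp
  also have "\<dots> = (LINT x|lborel. v x * (- (dlap h f x / h\<^sup>2)))" by simp
  also have "\<dots> \<le> (LINT x|lborel. v x * (t - p x))"
  proof (rule integral_mono)
    show "integrable lborel (\<lambda>x. v x * - (dlap h f x / h\<^sup>2))"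
      using h by (intro iv continuous_intros cd) auto
    show "integrable lborel (\<lambda>x. v x * (t - p x))" by (intro iv continuous_intros p)
    fix x show "v x * - (dlap h f x / h\<^sup>2) \<le> v x * (t - p x)"
    proof (cases "v x = 0")
      case False
      then have "- (dlap h f x / h\<^sup>2) \<le> t - p x" using Lf[of x h] h by simp
      then show ?thesis by (rule mult_left_mono[OF _ vnn])
    qed simp
  qed
  finally have fin: "(LINT x|lborel. (v (x + (h,0)) - v x)\<^sup>2) / h\<^sup>2 \<le> (LINT x|lborel. v x * (t - p x))" .
  have "(LINT x|lborel. (v x)\<^sup>2) \<le> (2 * R + 1)\<^sup>2 / 2 * ((LINT x|lborel. (v (x + (h, 0)) - v x)\<^sup>2) / h\<^sup>2)"
    using poincare_differences[OF cv zvR' R \<open>n > 0\<close>] by (simp add: h_def)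
  also have "\<dots> \<le> (2 * R + 1)\<^sup>2 / 2 * (LINT x|lborel. v x * (t - p x))"
    by (rule mult_left_mono[OF fin]) simp
  finally show ?thesis using cv zv vclose by blast
qed

text \<open>The limit \<open>t \<rightarrow> 0\<close> of \<open>truncated_mollification\<close>.\<close>

lemma positive_part_energy:
  fixes \<phi> p g :: "plane \<Rightarrow> real"
  assumes E: "open E" "E \<subseteq> cball 0 R" and R: "R \<ge> 0" and c: "continuous_on UNIV \<phi>"
    and z: "\<And>x. x \<notin> E \<Longrightarrow> \<phi> x = 0"
    and w: "has_weak_laplacian E \<phi> g" and p: "continuous_on UNIV p" "\<And>x. x \<in> E \<Longrightarrow> g x = p x"
  shows "(LINT x|lborel. (max (\<phi> x) 0)\<^sup>2) \<le> (2 * R + 1)\<^sup>2 / 2 * (LINT x|lborel. max (\<phi> x) 0 * (- p x))"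
proof -
  have bE: "bounded E" using E(2) bounded_cball bounded_subset by blast
  have zR: "\<phi> x = 0" if "x \<notin> cball 0 R" for x using z E(2) that by blast
  define t where "t n = inverse (real (Suc n))" for n
  have t: "t n > 0" "t n \<le> 1" for n by (simp_all add: t_def inverse_le_1_iff)
  have t0: "t \<longlonglongrightarrow> 0" unfolding t_def by (rule LIMSEQ_inverse_real_of_nat)
  have "\<forall>n. \<exists>v. continuous_on UNIV v \<and> (\<forall>x. x \<notin> E \<longrightarrow> v x = 0) \<and> (\<forall>x. \<bar>v x - max (\<phi> x) 0\<bar> \<le> t n) \<and>
     (LINT x|lborel. (v x)\<^sup>2) \<le> (2 * R + 1)\<^sup>2 / 2 * (LINT x|lborel. v x * (t n - p x))"
    by (rule allI, rule truncated_mollification[OF E R c z w p t(1)])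
  from choice[OF this] obtain v where V: "\<forall>n. continuous_on UNIV (v n) \<and> (\<forall>x. x \<notin> E \<longrightarrow> v n x = 0) \<and>
     (\<forall>x. \<bar>v n x - max (\<phi> x) 0\<bar> \<le> t n) \<and>
     (LINT x|lborel. (v n x)\<^sup>2) \<le> (2 * R + 1)\<^sup>2 / 2 * (LINT x|lborel. v n x * (t n - p x))"
    by (elim exE) (rule that)
  have v: "\<And>n. continuous_on UNIV (v n)" "\<And>n x. x \<notin> E \<Longrightarrow> v n x = 0" "\<And>n x. \<bar>v n x - max (\<phi> x) 0\<bar> \<le> t n"
     "\<And>n. (LINT x|lborel. (v n x)\<^sup>2) \<le> (2 * R + 1)\<^sup>2 / 2 * (LINT x|lborel. v n x * (t n - p x))"
    using V by simp_all
  obtain M where M: "M > 0" "\<And>x. \<bar>\<phi> x\<bar> \<le> M" using compact_support_bounded[OF c compact_cball zR] by metis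
  have "bounded (p ` cball 0 R)" by (intro compact_imp_bounded compact_continuous_image continuous_on_subset[OF p(1)]) auto
  then obtain P where P0: "P > 0" "\<forall>y\<in>p ` cball 0 R. norm y \<le> P" unfolding bounded_pos by (elim exE conjE) (rule that)
  have P: "P > 0" "\<And>x. x \<in> E \<Longrightarrow> \<bar>p x\<bar> \<le> P" using P0 E(2) by auto
  have vb: "\<bar>v n x\<bar> \<le> M + 1" for n x using v(3)[of n x] t(2)[of n] M(2)[of x] by linarith
  have vlim: "(\<lambda>n. v n x) \<longlonglongrightarrow> max (\<phi> x) 0" for x
  proof (rule LIM_zero_cancel, rule Lim_null_comparison[OF _ t0])
    show "\<forall>\<^sub>F n in sequentially. norm (v n x - max (\<phi> x) 0) \<le> t n" using v(3) by (intro always_eventually) simp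
  qed
  have mc: "q \<in> borel_measurable lborel" if "continuous_on UNIV q" for q :: "plane \<Rightarrow> real"
    using borel_measurable_continuous_onI[OF that] by simp
  have iE: "integrable lborel (\<lambda>x. indicator E x * K)" for K :: real
    using E(1) emeasure_bounded_finite[OF bE] by (intro integrable_mult_left integrable_real_indicator) auto
  have cm: "continuous_on UNIV (\<lambda>x. max (\<phi> x) 0)" by (intro continuous_intros c)
  have A: "(\<lambda>n. LINT x|lborel. (v n x)\<^sup>2) \<longlonglongrightarrow> (LINT x|lborel. (max (\<phi> x) 0)\<^sup>2)"
  proof (rule integral_dominated_convergence[OF _ _ iE[of "(M + 1)\<^sup>2"]])
    show "(\<lambda>x. (max (\<phi> x) 0)\<^sup>2) \<in> borel_measurable lborel" by (intro mc continuous_intros cm)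
    show "(\<lambda>x. (v n x)\<^sup>2) \<in> borel_measurable lborel" for n by (intro mc continuous_intros v)
    show "AE x in lborel. (\<lambda>n. (v n x)\<^sup>2) \<longlonglongrightarrow> (max (\<phi> x) 0)\<^sup>2" by (intro AE_I2 tendsto_intros vlim)
    show "AE x in lborel. norm ((v n x)\<^sup>2) \<le> indicator E x * (M + 1)\<^sup>2" for n
    proof (rule AE_I2)
      fix x show "norm ((v n x)\<^sup>2) \<le> indicator E x * (M + 1)\<^sup>2"
        using power_mono[OF vb[of n x] abs_ge_zero, of 2] v(2)[of x n] by (cases "x \<in> E") auto
    qed
  qed
  have B: "(\<lambda>n. LINT x|lborel. v n x * (t n - p x)) \<longlonglongrightarrow> (LINT x|lborel. max (\<phi> x) 0 * (0 - p x))"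
  proof (rule integral_dominated_convergence[OF _ _ iE[of "(M + 1) * (1 + P)"]])
    show "(\<lambda>x. max (\<phi> x) 0 * (0 - p x)) \<in> borel_measurable lborel" by (intro mc continuous_intros cm p)
    show "(\<lambda>x. v n x * (t n - p x)) \<in> borel_measurable lborel" for n by (intro mc continuous_intros v p)
    show "AE x in lborel. (\<lambda>n. v n x * (t n - p x)) \<longlonglongrightarrow> max (\<phi> x) 0 * (0 - p x)" by (intro AE_I2 tendsto_intros vlim t0)
    show "AE x in lborel. norm (v n x * (t n - p x)) \<le> indicator E x * ((M + 1) * (1 + P))" for n
    proof (rule AE_I2)
      fix x show "norm (v n x * (t n - p x)) \<le> indicator E x * ((M + 1) * (1 + P))"
      proof (cases "x \<in> E")
        case True
        have "\<bar>t n - p x\<bar> \<le> 1 + P" using P(2)[OF True] t[of n] by linarith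
        then have "\<bar>v n x\<bar> * \<bar>t n - p x\<bar> \<le> (M + 1) * (1 + P)" using vb[of n x] M(1) by (intro mult_mono) auto
        then show ?thesis using True by (simp add: abs_mult)
      qed (use v(2) in simp)
    qed
  qed
  have "(LINT x|lborel. (max (\<phi> x) 0)\<^sup>2) \<le> (2 * R + 1)\<^sup>2 / 2 * (LINT x|lborel. max (\<phi> x) 0 * (0 - p x))"
    by (rule LIMSEQ_le[OF A tendsto_mult_left[OF B]]) (use v(4) in blast)
  then show ?thesis by simp
qed

lemma weak_laplacian_uminus:
  assumes "has_weak_laplacian E \<phi> g"
  shows "has_weak_laplacian E (\<lambda>x. - \<phi> x) (\<lambda>x. - g x)"
  using assms unfolding has_weak_laplacian_def set_lebesgue_integral_def by simp

text \<open>The inequalities for the positive part of \<open>\<phi>\<close> and of \<open>- \<phi>\<close> add up to a bound for the integral of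
  \<open>\<phi>\<^sup>2\<close> by a multiple of \<open>- moment E \<phi> g\<close>.\<close>

theorem energy_uniqueness:
  fixes \<phi> p g :: "plane \<Rightarrow> real"
  assumes E: "open E" "bounded E" and c: "continuous_on UNIV \<phi>"
    and z: "\<And>x. x \<notin> E \<Longrightarrow> \<phi> x = 0"
    and w: "has_weak_laplacian E \<phi> g" and p: "continuous_on UNIV p" "\<And>x. x \<in> E \<Longrightarrow> g x = p x"
    and m: "moment E \<phi> g = 0"
  shows "\<phi> x = 0"
proof -
  obtain R where R0: "R > 0" "\<forall>x\<in>E. norm x \<le> R"
    using E(2) unfolding bounded_pos by (elim exE conjE) (rule that)
  then have R: "R > 0" "E \<subseteq> cball 0 R" by (simp_all add: subset_iff)
  have zR: "\<phi> x = 0" if "x \<notin> cball 0 R" for x using z R(2) that by blast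
  let ?C = "(2 * R + 1)\<^sup>2 / 2"
  have ic: "integrable lborel (\<lambda>x. q x)" if "continuous_on UNIV q" "\<And>x. \<phi> x = 0 \<Longrightarrow> q x = 0" for q :: "plane \<Rightarrow> real"
    by (rule integrable_compact_support[OF that(1), of "cball 0 R"]) (use that(2) zR in auto)
  have a: "(LINT x|lborel. (max (\<phi> x) 0)\<^sup>2) \<le> ?C * (LINT x|lborel. max (\<phi> x) 0 * (- p x))"
    by (rule positive_part_energy[OF E(1) R(2) _ c z w p]) (use R in auto)
  have b: "(LINT x|lborel. (max (- \<phi> x) 0)\<^sup>2) \<le> ?C * (LINT x|lborel. max (- \<phi> x) 0 * (- (- p x)))"
    by (rule positive_part_energy[OF E(1) R(2) _ _ _ weak_laplacian_uminus[OF w]])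
       (use R in \<open>auto intro!: continuous_intros c p simp: z p(2)\<close>)
  have "(LINT x|lborel. (\<phi> x)\<^sup>2) = (LINT x|lborel. (max (\<phi> x) 0)\<^sup>2 + (max (- \<phi> x) 0)\<^sup>2)"
    by (intro Bochner_Integration.integral_cong) (auto simp: max_def)
  also have "\<dots> = (LINT x|lborel. (max (\<phi> x) 0)\<^sup>2) + (LINT x|lborel. (max (- \<phi> x) 0)\<^sup>2)"
    by (rule Bochner_Integration.integral_add; rule ic) (auto intro!: continuous_intros c)
  also have "\<dots> \<le> ?C * ((LINT x|lborel. max (\<phi> x) 0 * (- p x)) + (LINT x|lborel. max (- \<phi> x) 0 * (- (- p x))))"
    using a b by (simp only: distrib_left add_mono)
  also have "(LINT x|lborel. max (\<phi> x) 0 * (- p x)) + (LINT x|lborel. max (- \<phi> x) 0 * (- (- p x)))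
      = (LINT x|lborel. max (\<phi> x) 0 * (- p x) + max (- \<phi> x) 0 * (- (- p x)))"
    by (rule Bochner_Integration.integral_add[symmetric]; rule ic) (auto intro!: continuous_intros c p)
  also have "\<dots> = (LINT x|lborel. - (\<phi> x * p x))"
    by (intro Bochner_Integration.integral_cong) (auto simp: max_def)
  also have "\<dots> = - moment E \<phi> g"
  proof -
    have "(LINT x|lborel. \<phi> x * p x) = moment E \<phi> g"
      unfolding moment_def set_lebesgue_integral_def
      by (intro Bochner_Integration.integral_cong) (auto simp: indicator_def z p(2))
    then show ?thesis by simp
  qed
  finally have "(LINT x|lborel. (\<phi> x)\<^sup>2) \<le> 0" using m by simp
  moreover have "(LINT x|lborel. (\<phi> x)\<^sup>2) \<ge> 0" by (rule integral_nonneg_AE) simp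
  moreover have "continuous_on UNIV (\<lambda>x. (\<phi> x)\<^sup>2)" by (intro continuous_intros c)
  moreover from this have "integrable lborel (\<lambda>x. (\<phi> x)\<^sup>2)" by (rule ic) simp
  ultimately have "(\<phi> x)\<^sup>2 = 0" using integral_zero_imp_zero[of UNIV "\<lambda>x. (\<phi> x)\<^sup>2" x] by simp
  then show ?thesis by simp
qed

section \<open>Discrete harmonic functions\<close>

lemma norm_plane_sq: "(norm (x :: plane))\<^sup>2 = (fst x)\<^sup>2 + (snd x)\<^sup>2"
  by (simp add: norm_prod_def)

lemma dlap_norm_sq: "dlap h (\<lambda>x. (norm x)\<^sup>2) x = 4 * h\<^sup>2"
  unfolding dlap_def norm_plane_sq by (simp add: power2_eq_square algebra_simps)

text \<open>A small multiple of \<open>|x|\<^sup>2\<close> makes the difference strictly positive. The supremum need not be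
  attained, as \<open>v\<close> may be discontinuous, but at a point where it is almost attained the mean over
  the neighbours would exceed it.\<close>

lemma discrete_maximum_principle:
  fixes v :: "plane \<Rightarrow> real"
  assumes A: "bounded A" and h: "h > 0"
    and sub: "\<And>x. x \<in> A \<Longrightarrow> 0 \<le> dlap h v x"
    and bd: "\<And>x. x \<in> A \<Longrightarrow> v x \<le> B"
    and bdry: "\<And>x y. x \<in> A \<Longrightarrow> y \<notin> A \<Longrightarrow> dist x y = h \<Longrightarrow> v y \<le> m"
    and x: "x \<in> A"
  shows "v x \<le> m"
proof (rule ccontr)
  assume "\<not> v x \<le> m"
  then have gap: "v x - m > 0" by simp
  obtain R where R: "R > 0" "\<forall>x\<in>A. norm x \<le> R"
    using A unfolding bounded_pos by (elim exE conjE) (rule that)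
  define k where "k = (v x - m) / (2 * (R + h)\<^sup>2)"
  have Rh: "(R + h)\<^sup>2 > 0" using R h by simp
  have k: "k > 0" using gap Rh by (simp add: k_def)
  have kR: "k * (R + h)\<^sup>2 = (v x - m) / 2" using Rh by (simp add: k_def)
  define w where "w y = v y + k * (norm y)\<^sup>2" for y
  have wb: "w y \<le> B + k * R\<^sup>2" if "y \<in> A" for y
  proof -
    have "(norm y)\<^sup>2 \<le> R\<^sup>2" using R that by (intro power_mono) auto
    then have "k * (norm y)\<^sup>2 \<le> k * R\<^sup>2" using k by simp
    then show ?thesis using bd[OF that] by (simp add: w_def)
  qed
  define s where "s = Sup (w ` A)"
  have bdd: "bdd_above (w ` A)" using wb by (intro bdd_aboveI[of _ "B + k * R\<^sup>2"]) auto
  have ws: "w y \<le> s" if "y \<in> A" for y unfolding s_def by (rule cSup_upper[OF _ bdd]) (use that in simp)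
  have "v x \<le> w x" using k by (simp add: w_def)
  then have sx: "v x \<le> s" using ws[OF x] by simp
  have kh: "k * h\<^sup>2 > 0" using k h by simp
  obtain y where y: "y \<in> A" "s - k * h\<^sup>2 < w y"
  proof -
    have "\<exists>t\<in>w ` A. s - k * h\<^sup>2 < t" unfolding s_def
      by (subst less_cSup_iff[symmetric]) (use x bdd kh in auto)
    then show ?thesis using that by auto
  qed
  have nb: "w z \<le> s" if z: "dist y z = h" for z
  proof (cases "z \<in> A")
    case False
    have "norm z \<le> norm y + dist y z" by (metis add.commute dist_commute dist_norm norm_triangle_sub)
    then have "norm z \<le> R + h" using R y(1) z by auto
    then have "(norm z)\<^sup>2 \<le> (R + h)\<^sup>2" by (intro power_mono) auto
    then have "k * (norm z)\<^sup>2 \<le> (v x - m) / 2" using k kR by (metis less_imp_le mult_left_mono)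
    from add_mono[OF bdry[OF y(1) False z] this] have "w z \<le> m + (v x - m) / 2" by (simp only: w_def)
    then show ?thesis using gap sx by argo
  qed (rule ws)
  have "dlap h w y = dlap h v y + k * dlap h (\<lambda>x. (norm x)\<^sup>2) y"
    by (simp add: dlap_def w_def algebra_simps)
  then have "dlap h w y \<ge> 4 * (k * h\<^sup>2)" using sub[OF y(1)] by (simp add: dlap_norm_sq)
  moreover have "dlap h w y \<le> 4 * s - 4 * w y"
    using nb[of "y + (h,0)"] nb[of "y - (h,0)"] nb[of "y + (0,h)"] nb[of "y - (0,h)"] h
    by (simp add: dlap_def dist_norm norm_Pair)
  ultimately show False using y(2) by argo
qed

definition discrete_dirichlet :: "plane set \<Rightarrow> (plane \<Rightarrow> real) \<Rightarrow> real \<Rightarrow> (plane \<Rightarrow> real) \<Rightarrow> bool" where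
  "discrete_dirichlet E F h u \<longleftrightarrow> (\<forall>x. x \<notin> E \<longrightarrow> u x = F x) \<and> (\<forall>x\<in>E. dlap h u x = 0)"

text \<open>Averaging over the four neighbours is a monotone operation, so iterating it from the lower bound
  \<open>- M\<close> gives increasing bounded functions; finite averages pass to the pointwise limit, which is
  therefore a fixed point, and a measurable one.\<close>

lemma discrete_dirichlet_exists:
  assumes E: "E \<in> sets borel" and F: "F \<in> borel_measurable borel" and M: "\<And>x. \<bar>F x\<bar> \<le> M"
  shows "\<exists>u. u \<in> borel_measurable borel \<and> (\<forall>x. \<bar>u x\<bar> \<le> M) \<and> discrete_dirichlet E F h u"
proof -
  define T where "T u x = (if x \<in> E then (u (x + (h,0)) + u (x - (h,0)) + u (x + (0,h)) + u (x - (0,h))) / 4 else F x)"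
    for u :: "plane \<Rightarrow> real" and x
  define u where "u n = (T ^^ n) (\<lambda>x. if x \<in> E then - M else F x)" for n
  have u0: "u 0 x = (if x \<in> E then - M else F x)" and uS: "u (Suc n) = T (u n)" for n x by (simp_all add: u_def)
  have b: "-M \<le> F x \<and> F x \<le> M" for x using M[of x] by linarith
  have bnd: "-M \<le> u n x \<and> u n x \<le> M" for n x
  proof (induction n arbitrary: x)
    case 0 then show ?case using b[of x] by (simp add: u0)
  next
    case (Suc n)
    show ?case using b[of x] Suc[of "x + (h,0)"] Suc[of "x - (h,0)"] Suc[of "x + (0,h)"] Suc[of "x - (0,h)"]
      by (simp add: uS T_def)
  qed
  have mono: "u n x \<le> u (Suc n) x" for n x
  proof (induction n arbitrary: x)
    case 0
    show ?case
    proof (cases "x \<in> E")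
      case True then show ?thesis using bnd[of "Suc 0" x] by (simp add: u0)
    next
      case False then show ?thesis by (simp add: u0 uS T_def)
    qed
  next
    case (Suc n)
    show ?case unfolding uS[of "Suc n"] using Suc[of "x + (h,0)"] Suc[of "x - (h,0)"] Suc[of "x + (0,h)"] Suc[of "x - (0,h)"]
      by (subst uS) (simp add: T_def)
  qed
  define v where "v x = lim (\<lambda>n. u n x)" for x
  have lim: "(\<lambda>n. u n x) \<longlonglongrightarrow> v x" for x
  proof -
    have inc: "incseq (\<lambda>n. u n x)" using mono by (rule incseq_SucI)
    obtain L where "(\<lambda>n. u n x) \<longlonglongrightarrow> L"
      by (rule incseq_convergent[OF inc, of M]) (use bnd in auto)
    then show ?thesis by (simp add: v_def limI)
  qed
  have meas: "u n \<in> borel_measurable borel" for n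
  proof (induction n)
    case 0 show ?case unfolding u_def using E F by simp
  next
    case (Suc n) show ?case unfolding uS T_def using E F Suc by measurable
  qed
  have "v \<in> borel_measurable borel" by (rule borel_measurable_LIMSEQ_real[OF lim meas])
  moreover have "\<bar>v x\<bar> \<le> M" for x
    using LIMSEQ_le_const[OF lim, of "-M" x] LIMSEQ_le_const2[OF lim, of x M] bnd by (auto simp: abs_le_iff)
  moreover have "discrete_dirichlet E F h v"
    unfolding discrete_dirichlet_def
  proof (intro conjI allI impI ballI)
    fix x assume "x \<notin> E"
    then have "(\<lambda>n. u (Suc n) x) \<longlonglongrightarrow> F x" by (simp add: uS T_def)
    then show "v x = F x" using LIMSEQ_unique[OF LIMSEQ_Suc[OF lim]] by blast
  next
    fix x assume x: "x \<in> E"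
    have "(\<lambda>n. (u n (x + (h,0)) + u n (x - (h,0)) + u n (x + (0,h)) + u n (x - (0,h))) / 4)
        \<longlonglongrightarrow> (v (x + (h,0)) + v (x - (h,0)) + v (x + (0,h)) + v (x - (0,h))) / 4"
      by (intro tendsto_intros lim) simp
    moreover have "(\<lambda>n. u (Suc n) x) = (\<lambda>n. (u n (x + (h,0)) + u n (x - (h,0)) + u n (x + (0,h)) + u n (x - (0,h))) / 4)"
      using x by (simp add: uS T_def)
    ultimately have "v x = (v (x + (h,0)) + v (x - (h,0)) + v (x + (0,h)) + v (x - (0,h))) / 4"
      using LIMSEQ_unique[OF LIMSEQ_Suc[OF lim[of x]]] by simp
    then show "dlap h v x = 0" by (simp add: dlap_def)
  qed
  ultimately show ?thesis by blast
qed

section \<open>A barrier\<close>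

text \<open>The hypothesis keeps \<open>w\<close> outside a sector around the negative axis, the only place where
  \<open>|w| + Re w\<close>, twice the square of the real part of the root, is small compared with \<open>|w|\<close>.\<close>

lemma Re_csqrt_lower:
  assumes c: "0 < c" "c \<le> 1" and w: "\<And>t. t \<ge> 0 \<Longrightarrow> c * t \<le> cmod (w + of_real t)"
  shows "c / 3 * sqrt (cmod w) \<le> Re (csqrt w)"
proof -
  let ?a = "cmod w"
  have a0: "?a \<ge> 0" by simp
  have c2: "c\<^sup>2 \<le> 1" using c by (simp add: power_le_one)
  have "c\<^sup>2 / 9 * ?a \<le> (?a + Re w) / 2"
  proof (cases "Re w \<ge> 0")
    case True
    have "c\<^sup>2 * ?a \<le> 1 * ?a" by (rule mult_right_mono[OF c2 a0])
    then show ?thesis using True a0 by argo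
  next
    case False
    have "w + of_real (- Re w) = \<i> * of_real (Im w)" by (simp add: complex_eq_iff)
    then have "cmod (w + of_real (- Re w)) = \<bar>Im w\<bar>" by (simp add: norm_mult)
    then have "c * (- Re w) \<le> \<bar>Im w\<bar>" using w[of "- Re w"] False by simp
    then have "(c * (- Re w))\<^sup>2 \<le> \<bar>Im w\<bar>\<^sup>2" using False c by (intro power_mono) (auto simp: mult_nonneg_nonpos)
    then have "c\<^sup>2 * (Re w)\<^sup>2 \<le> (Im w)\<^sup>2" by (simp add: power_mult_distrib)
    moreover have "c\<^sup>2 * (Im w)\<^sup>2 \<le> 1 * (Im w)\<^sup>2" by (rule mult_right_mono[OF c2]) simp
    moreover have sq: "?a\<^sup>2 = (Re w)\<^sup>2 + (Im w)\<^sup>2" by (simp add: cmod_def)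
    ultimately have "c\<^sup>2 * ?a\<^sup>2 \<le> 2 * (Im w)\<^sup>2" by (simp add: distrib_left)
    also have "(Im w)\<^sup>2 = (?a + Re w) * (?a - Re w)" using sq by (simp add: power2_eq_square algebra_simps)
    also have "\<dots> \<le> (?a + Re w) * (2 * ?a)"
      using abs_Re_le_cmod[of w] by (intro mult_left_mono) auto
    finally have "(c\<^sup>2 * ?a) * ?a \<le> (4 * (?a + Re w)) * ?a" by (simp add: power2_eq_square algebra_simps)
    moreover have "?a > 0" using False by (auto simp: complex_eq_iff)
    ultimately have "c\<^sup>2 * ?a \<le> 4 * (?a + Re w)" by (simp only: mult_le_cancel_right_pos)
    then show ?thesis using a0 abs_Re_le_cmod[of w] by argo
  qed
  then have "sqrt ((c / 3)\<^sup>2 * ?a) \<le> Re (csqrt w)" by (simp add: power_divide)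
  then show ?thesis using c by (simp add: real_sqrt_mult)
qed

text \<open>As for every holomorphic function, the second-order terms of the Taylor expansions in the
  directions \<open>e\<close> and \<open>\<i> e\<close> cancel. The remainder is controlled by the third derivative, which is
  bounded at distance \<open>r\<close> from the branch cut.\<close>

lemma csqrt_five_point:
  fixes w e :: complex
  assumes r: "r > 0" and w: "\<And>t. t \<ge> 0 \<Longrightarrow> 2 * r \<le> cmod (w + of_real t)"
    and e: "cmod e = 1" and h: "0 < h" "h \<le> r"
  shows "cmod (csqrt (w + h * e) + csqrt (w - h * e) + csqrt (w + h * (\<i> * e)) + csqrt (w - h * (\<i> * e)) - 4 * csqrt w)
     \<le> h ^ 3 / (r\<^sup>2 * sqrt r)"
proof -
  define f where "f i z = (if i = 0 then csqrt z else if i = 1 then inverse (2 * csqrt z)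
      else if i = 2 then - inverse (4 * (z * csqrt z)) else 3 / (8 * (z\<^sup>2 * csqrt z)))" for i :: nat and z
  let ?S = "cball w r"
  have dom: "z \<notin> \<real>\<^sub>\<le>\<^sub>0 \<and> r \<le> cmod z" if "z \<in> ?S" for z
  proof
    show "r \<le> cmod z" using w[of 0] that norm_triangle_sub[of w z] by (simp add: dist_norm)
    show "z \<notin> \<real>\<^sub>\<le>\<^sub>0"
    proof
      assume "z \<in> \<real>\<^sub>\<le>\<^sub>0"
      then obtain t where "z = of_real t" "t \<le> 0" by (auto simp: nonpos_Reals_def)
      then show False using w[of "-t"] that r by (simp add: dist_norm)
    qed
  qed
  have der: "(f i has_field_derivative f (Suc i) z) (at z within ?S)" if z: "z \<in> ?S" and i: "i \<le> 2" for i z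
  proof -
    have zn: "z \<notin> \<real>\<^sub>\<le>\<^sub>0" "z \<noteq> 0" "csqrt z \<noteq> 0" using dom[OF z] r by auto
    define q where "q = csqrt z"
    have cq: "csqrt z = q" by (simp add: q_def)
    have q: "q \<noteq> 0" "z = q\<^sup>2" using zn by (simp_all add: q_def)
    have D: "(csqrt has_field_derivative inverse (2 * q)) (at z within ?S)"
      unfolding q_def using has_field_derivative_csqrt[OF zn(1)] by (rule DERIV_subset) simp
    consider "i = 0" | "i = 1" | "i = 2" using i by linarith
    then show ?thesis
    proof cases
      case 1 then show ?thesis using D by (simp add: f_def[abs_def] q_def)
    next
      case 2
      have "((\<lambda>z. inverse (2 * csqrt z)) has_field_derivative - inverse (4 * (z * csqrt z))) (at z within ?S)"
        by (rule DERIV_cong[OF DERIV_inverse'[OF DERIV_cmult[OF D]]], use zn in simp, simp only: cq)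
           (use q in \<open>simp add: power2_eq_square field_simps\<close>)
      then show ?thesis using 2 by (simp add: f_def[abs_def])
    next
      case 3
      have "((\<lambda>z. - inverse (4 * (z * csqrt z))) has_field_derivative 3 / (8 * (z\<^sup>2 * csqrt z))) (at z within ?S)"
        by (rule DERIV_cong[OF DERIV_minus[OF DERIV_inverse'[OF DERIV_cmult[OF DERIV_mult[OF DERIV_ident D]]]]], use zn in simp, simp only: cq)
           (use q in \<open>simp add: power2_eq_square field_simps\<close>)
      then show ?thesis using 3 by (simp add: f_def[abs_def])
    qed
  qed
  define B where "B = 3 / (8 * (r\<^sup>2 * sqrt r))"
  have bnd: "cmod (f (Suc 2) z) \<le> B" if "z \<in> ?S" for z
  proof -
    have "r \<le> cmod z" using dom[OF that] by simp
    then have "r\<^sup>2 * sqrt r \<le> (cmod z)\<^sup>2 * sqrt (cmod z)" using r by (intro mult_mono power_mono) auto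
    moreover have "0 < r\<^sup>2 * sqrt r" using r by simp
    ultimately have "3 / (8 * ((cmod z)\<^sup>2 * sqrt (cmod z))) \<le> B"
      unfolding B_def by (intro frac_le) auto
    then show ?thesis by (simp add: f_def norm_mult norm_divide norm_power)
  qed
  have T: "cmod (csqrt (w + d) - (csqrt w + f 1 w * d + f 2 w * d\<^sup>2 / 2)) \<le> B * h ^ 3 / 2" if d: "cmod d = h" for d
  proof -
    have mem: "w \<in> ?S" "w + d \<in> ?S" using d h r by (simp_all add: dist_norm)
    have "cmod (f 0 (w + d) - (\<Sum>i\<le>2. f i w * (w + d - w) ^ i / fact i)) \<le> B * cmod (w + d - w) ^ Suc 2 / fact 2"
      by (rule complex_Taylor[of ?S 2 f B w "w + d", OF convex_cball der bnd mem])
    moreover have "(\<Sum>i\<le>2. f i w * (w + d - w) ^ i / fact i) = csqrt w + f 1 w * d + f 2 w * d\<^sup>2 / 2"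
      by (simp add: atMost_Suc numeral_2_eq_2 f_def)
    moreover have "f 0 (w + d) = csqrt (w + d)" by (simp add: f_def)
    ultimately show ?thesis using d by (simp add: numeral_3_eq_3)
  qed
  let ?R = "\<lambda>d. csqrt (w + d) - (csqrt w + f 1 w * d + f 2 w * d\<^sup>2 / 2)"
  have eq: "csqrt (w + h * e) + csqrt (w - h * e) + csqrt (w + h * (\<i> * e)) + csqrt (w - h * (\<i> * e)) - 4 * csqrt w
     = ?R (h * e) + ?R (- (h * e)) + ?R (h * (\<i> * e)) + ?R (- (h * (\<i> * e)))"
    by (simp add: power_mult_distrib algebra_simps)
  have bd: "cmod (?R (h * e) + ?R (- (h * e)) + ?R (h * (\<i> * e)) + ?R (- (h * (\<i> * e))))
      \<le> B * h ^ 3 / 2 + B * h ^ 3 / 2 + B * h ^ 3 / 2 + B * h ^ 3 / 2"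
    by (intro norm_triangle_mono T) (use e h in \<open>simp_all add: norm_mult\<close>)
  define Q where "Q = h ^ 3 / (r\<^sup>2 * sqrt r)"
  have "Q \<ge> 0" using h r by (simp add: Q_def)
  moreover have "B * h ^ 3 = 3 / 8 * Q" by (simp add: B_def Q_def)
  ultimately have "B * h ^ 3 / 2 + B * h ^ 3 / 2 + B * h ^ 3 / 2 + B * h ^ 3 / 2 \<le> Q" by simp
  then show ?thesis unfolding eq Q_def[symmetric] using bd by linarith
qed

section \<open>The Dirichlet problem\<close>

text \<open>An infinite cone with apex \<open>z\<close> and axis \<open>d\<close>, described by the discs of radius \<open>c t\<close> around the
  points \<open>z + t d\<close> of its axis.\<close>

definition exterior_cones :: "real \<Rightarrow> plane set \<Rightarrow> bool" where
  "exterior_cones c E \<longleftrightarrow>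
     (\<forall>z\<in>frontier E. \<exists>d. norm d = 1 \<and> (\<forall>x\<in>E. \<forall>t\<ge>0. c * t \<le> dist x (z + t *\<^sub>R d)))"

definition to_complex :: "plane \<Rightarrow> complex" where
  "to_complex x = Complex (fst x) (snd x)"

lemma to_complex_simps:
  "to_complex (x + y) = to_complex x + to_complex y"
  "to_complex (x - y) = to_complex x - to_complex y"
  "to_complex (t *\<^sub>R x) = of_real t * to_complex x"
  "to_complex (h, 0) = of_real h"
  "to_complex (0, h) = of_real h * \<i>"
  "cmod (to_complex x) = norm x"
  by (simp_all add: to_complex_def complex_eq_iff cmod_def norm_prod_def)

lemma uniformly_continuous_real:
  fixes F :: "plane \<Rightarrow> real"
  assumes "uniformly_continuous_on UNIV F" "e > 0"
  shows "\<exists>d>0. \<forall>x y. dist x y < d \<longrightarrow> \<bar>F x - F y\<bar> < e"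
  using assms unfolding uniformly_continuous_on_def dist_real_def by (metis UNIV_I)

text \<open>The solution is compared with \<open>F z + e / 4 + A W + k (R\<^sup>2 - |x|\<^sup>2)\<close>, where \<open>W\<close> is the real part of
  a square root with its cut on the axis of the exterior cone. Its branch point is moved from \<open>z\<close> by
  the small distance \<open>s\<close> into the cone: this leaves \<open>W\<close> small near \<open>z\<close> and bounded below away from
  \<open>z\<close>, but makes it smooth near \<open>E\<close>, so that its five-point difference is of order \<open>h\<^sup>3\<close>. The
  quadratic term, whose difference is \<open>- 4 k h\<^sup>2\<close>, then makes the sum discretely superharmonic.\<close>

lemma boundary_upper_estimate:
  fixes F :: "plane \<Rightarrow> real"
  assumes bE: "bounded E" and c: "0 < c" "c \<le> 1" and cone: "exterior_cones c E"
    and uc: "uniformly_continuous_on UNIV F"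
    and M: "\<And>x. \<bar>F x\<bar> \<le> M" and e: "e > 0"
  shows "\<exists>\<delta>>0. \<exists>h0>0. \<forall>h u z x. 0 < h \<longrightarrow> h < h0 \<longrightarrow> discrete_dirichlet E F h u \<longrightarrow> (\<forall>y. \<bar>u y\<bar> \<le> M) \<longrightarrow>
     z \<in> frontier E \<longrightarrow> x \<in> E \<longrightarrow> dist x z < \<delta> \<longrightarrow> u x \<le> F z + e"
proof -
  obtain R0 where R0: "R0 > 0" "\<forall>x\<in>E. norm x \<le> R0"
    using bE unfolding bounded_pos by (elim exE conjE) (rule that)
  define R where "R = R0 + 1"
  have R: "R > 0" using R0 by (simp add: R_def)
  define e' where "e' = e / 4"
  have e': "e' > 0" using e by (simp add: e'_def)
  obtain \<eta> where \<eta>: "\<eta> > 0" "\<And>x y. dist x y < \<eta> \<Longrightarrow> \<bar>F x - F y\<bar> < e'" using uniformly_continuous_real[OF uc e'] by auto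
  have M0: "M \<ge> 0" using M[of 0] by linarith
  define k where "k = e' / R\<^sup>2"
  have k: "k > 0" "k * R\<^sup>2 = e'" using e' R by (simp_all add: k_def)
  define q where "q = c / 3 * sqrt (\<eta> / 2)"
  define A where "A = 2 * M / q"
  have q: "q > 0" using c \<eta> by (simp add: q_def)
  have A: "A \<ge> 0" "A * q = 2 * M" using M0 q by (simp_all add: A_def)
  define s where "s = min (\<eta> / 2) ((e' / (A + 1))\<^sup>2 / 2)"
  have s: "s > 0" "s \<le> \<eta> / 2" "2 * s \<le> (e' / (A + 1))\<^sup>2" using \<eta>(1) e' A(1) by (auto simp: s_def)
  have As: "A * sqrt (2 * s) \<le> e'"
  proof -
    have "sqrt (2 * s) \<le> e' / (A + 1)" using s(3) e' A(1) by (intro real_le_lsqrt) (auto simp: s(1) less_imp_le)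
    then have "A * sqrt (2 * s) \<le> A * (e' / (A + 1))" by (rule mult_left_mono) (rule A(1))
    also have "\<dots> \<le> e'" using A(1) e' by (simp add: field_simps)
    finally show ?thesis .
  qed
  define r where "r = c * s / 2"
  have r: "r > 0" using c s by (simp add: r_def)
  define B where "B = 1 / (r\<^sup>2 * sqrt r)"
  have B: "B > 0" using r by (simp add: B_def)
  define h0 where "h0 = min (min 1 r) (4 * k / (A * B + 1))"
  have AB: "A * B \<ge> 0" using A(1) B by simp
  have h0: "h0 > 0" using r k AB by (simp add: h0_def add_nonneg_pos)
  show ?thesis
  proof (rule exI[of _ s], rule conjI[OF s(1)], rule exI[of _ h0], rule conjI[OF h0], intro allI impI)
    fix h u z x
    assume h: "0 < h" "h < h0" and dd: "discrete_dirichlet E F h u" and uM: "\<forall>y. \<bar>u y\<bar> \<le> M"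
      and z: "z \<in> frontier E" and x: "x \<in> E" "dist x z < s"
    obtain d where d: "norm d = 1" "\<forall>x\<in>E. \<forall>t\<ge>0. c * t \<le> dist x (z + t *\<^sub>R d)"
      using cone z unfolding exterior_cones_def by blast
    have h1: "h < 1" "h < r" "h < 4 * k / (A * B + 1)" using h(2) by (simp_all add: h0_def)
    define a where "a = - to_complex d"
    have a: "a * cnj a = 1" "cmod a = 1" "cmod (cnj a) = 1"
      using d(1) by (simp_all add: a_def to_complex_simps complex_norm_square[symmetric])
    define \<omega> where "\<omega> y = (to_complex y - to_complex (z + s *\<^sub>R d)) * cnj a" for y
    have \<omega>t: "cmod (\<omega> y + of_real t) = dist y (z + (s + t) *\<^sub>R d)" for y t
    proof -
      have "\<omega> y + of_real t = (to_complex y - to_complex (z + s *\<^sub>R d) + of_real t * a) * cnj a"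
        using a(1) by (simp add: \<omega>_def algebra_simps)
      also have "to_complex y - to_complex (z + s *\<^sub>R d) + of_real t * a = to_complex (y - (z + (s + t) *\<^sub>R d))"
        by (simp add: a_def to_complex_simps algebra_simps)
      finally show ?thesis by (simp only: norm_mult to_complex_simps(6) a(3) dist_norm mult_1_right)
    qed
    have \<omega>E: "c * (s + t) \<le> cmod (\<omega> y + of_real t)" if "y \<in> E" "t \<ge> 0" for y t
      unfolding \<omega>t using d(2) that s(1) by simp
    have shift: "\<omega> (y + (h,0)) = \<omega> y + h * cnj a" "\<omega> (y - (h,0)) = \<omega> y - h * cnj a"
       "\<omega> (y + (0,h)) = \<omega> y + h * (\<i> * cnj a)" "\<omega> (y - (0,h)) = \<omega> y - h * (\<i> * cnj a)" for y
      unfolding \<omega>_def to_complex_simps by (simp_all add: algebra_simps)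
    (* Points outside E at distance h from E are still away from the cone with the moved apex. *)
    have near: "c / 3 * sqrt (cmod (\<omega> y')) \<le> Re (csqrt (\<omega> y'))" if y: "y \<in> E" "dist y y' \<le> h" for y y'
    proof (rule Re_csqrt_lower[OF c])
      fix t :: real assume t: "t \<ge> 0"
      have "c * (s + t) \<le> dist y (z + (s + t) *\<^sub>R d)" using \<omega>E[OF y(1) t] by (simp add: \<omega>t)
      also have "\<dots> \<le> h + dist y' (z + (s + t) *\<^sub>R d)" using y(2) dist_triangle[of y "z + (s + t) *\<^sub>R d" y'] by linarith
      finally have "c * s + c * t - h \<le> cmod (\<omega> y' + of_real t)" unfolding \<omega>t[symmetric] distrib_left by linarith
      moreover have "h < c * s" using h1(2) r by (simp add: r_def)
      ultimately show "c * t \<le> cmod (\<omega> y' + of_real t)" by linarith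
    qed
    define W where "W y = Re (csqrt (\<omega> y))" for y
    have W0: "W y \<ge> 0" for y unfolding W_def by (rule Re_csqrt)
    have dW: "dlap h W y \<le> B * h ^ 3" if y: "y \<in> E" for y
    proof -
      have "2 * r \<le> cmod (\<omega> y + of_real t)" if "t \<ge> 0" for t
      proof -
        have "c * s \<le> c * (s + t)" using c that by simp
        then show ?thesis using \<omega>E[OF y that] by (simp add: r_def)
      qed
      then have "cmod (csqrt (\<omega> y + h * cnj a) + csqrt (\<omega> y - h * cnj a) + csqrt (\<omega> y + h * (\<i> * cnj a)) + csqrt (\<omega> y - h * (\<i> * cnj a)) - 4 * csqrt (\<omega> y))
          \<le> h ^ 3 / (r\<^sup>2 * sqrt r)"
        by (rule csqrt_five_point[OF r _ a(3) h(1) less_imp_le[OF h1(2)]])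
      moreover have "dlap h W y = Re (csqrt (\<omega> y + h * cnj a) + csqrt (\<omega> y - h * cnj a) + csqrt (\<omega> y + h * (\<i> * cnj a)) + csqrt (\<omega> y - h * (\<i> * cnj a)) - 4 * csqrt (\<omega> y))"
        unfolding dlap_def W_def shift by (simp del: csqrt.sel)
      ultimately show ?thesis
        using complex_Re_le_cmod[of "csqrt (\<omega> y + h * cnj a) + csqrt (\<omega> y - h * cnj a) + csqrt (\<omega> y + h * (\<i> * cnj a)) + csqrt (\<omega> y - h * (\<i> * cnj a)) - 4 * csqrt (\<omega> y)"]
        by (simp only: B_def) (simp add: mult.commute)
    qed
    define \<Phi> where "\<Phi> y = F z + e' + A * W y + k * (R\<^sup>2 - (norm y)\<^sup>2)" for y
    have inR: "k * (R\<^sup>2 - (norm y)\<^sup>2) \<ge> 0" if "norm y \<le> R" for y :: plane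
    proof -
      have "(norm y)\<^sup>2 \<le> R\<^sup>2" using that by (intro power_mono) auto
      then show ?thesis using k(1) by simp
    qed
    have "u x - \<Phi> x \<le> 0"
    proof (rule discrete_maximum_principle[OF bE h(1) _ _ _ x(1)])
      fix y assume y: "y \<in> E"
      have "dlap h (\<lambda>y. u y - \<Phi> y) y = dlap h u y - A * dlap h W y + k * dlap h (\<lambda>y. (norm y)\<^sup>2) y"
        by (simp add: dlap_def \<Phi>_def algebra_simps)
      also have "\<dots> = k * (4 * h\<^sup>2) - A * dlap h W y"
        using dd y by (simp add: discrete_dirichlet_def dlap_norm_sq)
      also have "\<dots> \<ge> 0"
      proof -
        have "A * dlap h W y \<le> A * (B * h ^ 3)" by (rule mult_left_mono[OF dW[OF y] A(1)])
        also have "\<dots> = (A * B * h) * h\<^sup>2" by (simp add: power2_eq_square power3_eq_cube)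
        also have "\<dots> \<le> (4 * k) * h\<^sup>2"
        proof (rule mult_right_mono)
          have "h * (A * B + 1) < 4 * k" using h1(3) AB by (simp add: pos_less_divide_eq)
          then show "A * B * h \<le> 4 * k" using h(1) by (simp add: algebra_simps)
        qed simp
        finally show ?thesis by simp
      qed
      finally show "0 \<le> dlap h (\<lambda>y. u y - \<Phi> y) y" .
      have "norm y \<le> R" using R0(2) y by (auto simp: R_def)
      then have "F z \<le> \<Phi> y" using inR[of y] mult_nonneg_nonneg[OF A(1) W0[of y]] e' by (simp add: \<Phi>_def)
      then show "u y - \<Phi> y \<le> 2 * M" using uM[rule_format, of y] M[of z] by linarith
    next
      fix y y' assume y: "y \<in> E" "y' \<notin> E" "dist y y' = h"
      have "norm y' \<le> norm y + dist y y'" by (metis add.commute dist_commute dist_norm norm_triangle_sub)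
      then have nR: "norm y' \<le> R" using R0(2) y h1(1) by (auto simp: R_def)
      have uy: "u y' = F y'" using dd y(2) by (simp add: discrete_dirichlet_def)
      show "u y' - \<Phi> y' \<le> 0"
      proof (cases "dist y' z < \<eta>")
        case True
        then have "F y' \<le> F z + e'" using \<eta>(2)[of y' z] by linarith
        then show ?thesis using uy inR[OF nR] mult_nonneg_nonneg[OF A(1) W0[of y']] by (simp add: \<Phi>_def)
      next
        case False
        have "dist y' z \<le> dist y' (z + s *\<^sub>R d) + dist (z + s *\<^sub>R d) z" by (rule dist_triangle)
        moreover have "dist (z + s *\<^sub>R d) z = s" using d(1) s(1) by (simp add: dist_norm)
        moreover have "cmod (\<omega> y') = dist y' (z + s *\<^sub>R d)" using \<omega>t[of y' 0] by simp
        ultimately have "\<eta> / 2 \<le> cmod (\<omega> y')" using False s(2) by linarith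
        then have "c / 3 * sqrt (\<eta> / 2) \<le> c / 3 * sqrt (cmod (\<omega> y'))" using c by (intro mult_left_mono) auto
        also have "\<dots> \<le> W y'" unfolding W_def by (rule near[OF y(1)]) (use y(3) in simp)
        finally have "q \<le> W y'" by (simp only: q_def)
        from mult_left_mono[OF this A(1)] have "2 * M \<le> A * W y'" by (simp only: A(2))
        then show ?thesis using uy inR[OF nR] M[of y'] M[of z] e' unfolding \<Phi>_def by linarith
      qed
    qed
    moreover have "W x \<le> sqrt (2 * s)"
    proof -
      have "W x \<le> cmod (csqrt (\<omega> x))" unfolding W_def by (rule complex_Re_le_cmod)
      also have "\<dots> = sqrt (dist x (z + s *\<^sub>R d))" using \<omega>t[of x 0] by simp
      also have "\<dots> \<le> sqrt (2 * s)"
      proof -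
        have "dist x (z + s *\<^sub>R d) \<le> dist x z + dist z (z + s *\<^sub>R d)" by (rule dist_triangle)
        moreover have "dist z (z + s *\<^sub>R d) = s" using d(1) s(1) by (simp add: dist_norm)
        ultimately show ?thesis using x(2) by simp
      qed
      finally show ?thesis .
    qed
    then have "A * W x \<le> e'" using mult_left_mono[OF _ A(1)] As by (meson order_trans)
    moreover have "k * (R\<^sup>2 - (norm x)\<^sup>2) \<le> e'" using k by (simp add: right_diff_distrib)
    ultimately show "u x \<le> F z + e" using e unfolding \<Phi>_def e'_def by argo
  qed
qed

lemma discrete_dirichlet_uminus:
  "discrete_dirichlet E F h u \<Longrightarrow> discrete_dirichlet E (\<lambda>x. - F x) h (\<lambda>x. - u x)"
  by (auto simp: discrete_dirichlet_def dlap_def)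

lemma frontier_crossing:
  fixes a b :: plane
  assumes "a \<notin> E" "b \<in> E"
  shows "\<exists>z\<in>frontier E. dist b z \<le> dist a b \<and> dist a z \<le> dist a b"
proof -
  have "closed_segment a b \<inter> frontier E \<noteq> {}"
    by (rule connected_Int_frontier) (use assms in auto)
  then obtain z where z: "z \<in> frontier E" "z \<in> closed_segment a b" by blast
  have "dist z a \<le> dist a b" "dist z b \<le> dist a b"
    using dist_in_closed_segment[OF z(2)] by auto
  then show ?thesis using z(1) by (intro bexI[of _ z]) (auto simp: dist_commute)
qed

text \<open>The function \<open>x \<mapsto> u (x + t) - u x\<close> is discretely harmonic where both points lie in \<open>E\<close>. By the
  maximum principle it is bounded by its values where one of them is outside \<open>E\<close>, and there the
  other one is within distance \<open>|t|\<close> of the boundary.\<close>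

lemma discrete_dirichlet_modulus:
  fixes F :: "plane \<Rightarrow> real"
  assumes bE: "bounded E" and c: "0 < c" "c \<le> 1" and cone: "exterior_cones c E"
    and uc: "uniformly_continuous_on UNIV F"
    and M: "\<And>x. \<bar>F x\<bar> \<le> M" and e: "e > 0"
  shows "\<exists>\<delta>>0. \<exists>h0>0. \<forall>h u x y. 0 < h \<longrightarrow> h < h0 \<longrightarrow> discrete_dirichlet E F h u \<longrightarrow> (\<forall>y. \<bar>u y\<bar> \<le> M) \<longrightarrow>
     dist x y < \<delta> \<longrightarrow> \<bar>u x - u y\<bar> \<le> e"
proof -
  have e2: "e / 2 > 0" using e by simp
  obtain d1 h1 where 1: "d1 > 0" "h1 > 0" "\<forall>h u z x. 0 < h \<longrightarrow> h < h1 \<longrightarrow> discrete_dirichlet E F h u \<longrightarrow> (\<forall>y. \<bar>u y\<bar> \<le> M) \<longrightarrow>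
     z \<in> frontier E \<longrightarrow> x \<in> E \<longrightarrow> dist x z < d1 \<longrightarrow> u x \<le> F z + e / 2"
    using boundary_upper_estimate[OF bE c cone uc M e2] by (elim exE conjE) (rule that)
  have uc': "uniformly_continuous_on UNIV (\<lambda>x. - F x)" using uc by (rule uniformly_continuous_on_minus)
  have M': "\<bar>- F x\<bar> \<le> M" for x using M by simp
  obtain d2 h2 where 2: "d2 > 0" "h2 > 0" "\<forall>h u z x. 0 < h \<longrightarrow> h < h2 \<longrightarrow> discrete_dirichlet E (\<lambda>x. - F x) h u \<longrightarrow> (\<forall>y. \<bar>u y\<bar> \<le> M) \<longrightarrow>
     z \<in> frontier E \<longrightarrow> x \<in> E \<longrightarrow> dist x z < d2 \<longrightarrow> u x \<le> - F z + e / 2"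
    using boundary_upper_estimate[OF bE c cone uc' M' e2] by (elim exE conjE) (rule that)
  obtain d3 where 3: "d3 > 0" "\<forall>x y. dist x y < d3 \<longrightarrow> \<bar>F x - F y\<bar> < e / 2"
    using uniformly_continuous_real[OF uc e2] by (elim exE conjE) (rule that)
  define \<delta> where "\<delta> = min d1 (min d2 d3)"
  define h0 where "h0 = min h1 h2"
  show ?thesis
  proof (rule exI[of _ \<delta>], intro conjI, simp add: \<delta>_def 1 2 3, rule exI[of _ h0], intro conjI, simp add: h0_def 1 2, intro allI impI)
    fix h u and x y :: plane
    assume h: "0 < h" "h < h0" and dd: "discrete_dirichlet E F h u" and uM: "\<forall>y. \<bar>u y\<bar> \<le> M"
      and xy: "dist x y < \<delta>"
    have hh: "h < h1" "h < h2" using h by (simp_all add: h0_def)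
    have uM': "\<forall>y. \<bar>- u y\<bar> \<le> M" using uM by simp
    have star: "\<bar>u p - u q\<bar> \<le> e" if p: "p \<notin> E" and pq: "dist p q < \<delta>" for p q :: plane
    proof (cases "q \<in> E")
      case False
      have "u p = F p" "u q = F q" using dd p False by (simp_all add: discrete_dirichlet_def)
      moreover have "\<bar>F p - F q\<bar> < e / 2" using 3(2) pq by (simp add: \<delta>_def)
      ultimately show ?thesis using e by linarith
    next
      case True
      obtain z where z: "z \<in> frontier E" "dist q z \<le> dist p q" "dist p z \<le> dist p q"
        using frontier_crossing[OF p True] by blast
      have "u q \<le> F z + e / 2" using 1(3)[rule_format, OF h(1) hh(1) dd _ z(1) True] uM z(2) pq by (simp add: \<delta>_def)
      moreover have "- u q \<le> - F z + e / 2"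
        using 2(3)[rule_format, OF h(1) hh(2) discrete_dirichlet_uminus[OF dd] _ z(1) True] uM z(2) pq by (simp add: \<delta>_def)
      moreover have "\<bar>F p - F z\<bar> < e / 2" using 3(2) z(3) pq by (simp add: \<delta>_def)
      moreover have "u p = F p" using dd p by (simp add: discrete_dirichlet_def)
      ultimately show ?thesis by linarith
    qed
    have one_sided: "u (p + t) - u p \<le> e" if t: "norm t < \<delta>" for p t
    proof (cases "p \<in> E \<and> p + t \<in> E")
      case False
      then show ?thesis using star[of p "p + t"] star[of "p + t" p] t by (auto simp: dist_norm)
    next
      case True
      define A where "A = {p \<in> E. p + t \<in> E}"
      show ?thesis
      proof (rule discrete_maximum_principle[of A h "\<lambda>p. u (p + t) - u p" "2 * M"])
        show "bounded A" using bE by (rule bounded_subset) (auto simp: A_def)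
        show "p \<in> A" using True by (simp add: A_def)
        show "h > 0" by (rule h(1))
        fix q assume q: "q \<in> A"
        have "dlap h (\<lambda>p. u (p + t) - u p) q = dlap h u (q + t) - dlap h u q"
          by (simp add: dlap_def algebra_simps)
        then show "0 \<le> dlap h (\<lambda>p. u (p + t) - u p) q" using q dd by (simp add: A_def discrete_dirichlet_def)
        show "u (q + t) - u q \<le> 2 * M" using uM[rule_format, of q] uM[rule_format, of "q + t"] by linarith
      next
        fix q q' assume "q' \<notin> A"
        then have "q' \<notin> E \<or> q' + t \<notin> E" by (simp add: A_def)
        then show "u (q' + t) - u q' \<le> e" using star[of q' "q' + t"] star[of "q' + t" q'] t by (auto simp: dist_norm)
      qed
    qed
    show "\<bar>u x - u y\<bar> \<le> e"
      using one_sided[of "x - y" y] one_sided[of "y - x" x] xy by (simp add: dist_norm norm_minus_commute)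
  qed
qed

text \<open>The discrete solutions have a common modulus of continuity only up to an error that vanishes with
  the step. That suffices for a subsequence converging on a countable dense set to converge
  everywhere, and for the limit to be continuous.\<close>

theorem weak_dirichlet:
  fixes F :: "plane \<Rightarrow> real"
  assumes E: "open E" "bounded E" and c: "0 < c" "c \<le> 1" and cone: "exterior_cones c E"
    and uc: "uniformly_continuous_on UNIV F"
    and M: "\<And>x. \<bar>F x\<bar> \<le> M"
  shows "\<exists>u. continuous_on UNIV u \<and> (\<forall>x. x \<notin> E \<longrightarrow> u x = F x) \<and> has_weak_laplacian E u (\<lambda>_. 0)"
proof -
  have mF: "F \<in> borel_measurable borel"
    using uc by (intro borel_measurable_continuous_onI uniformly_continuous_imp_continuous)
  define h where "h n = inverse (real (Suc n))" for n
  have h: "h n > 0" for n by (simp add: h_def)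
  have hlim: "h \<longlonglongrightarrow> 0" unfolding h_def by (rule LIMSEQ_inverse_real_of_nat)
  have "\<forall>n. \<exists>u. u \<in> borel_measurable borel \<and> (\<forall>x. \<bar>u x\<bar> \<le> M) \<and> discrete_dirichlet E F (h n) u"
    by (rule allI, rule discrete_dirichlet_exists[OF _ mF M]) (use E(1) in simp)
  from choice[OF this] obtain w where w: "\<forall>n. w n \<in> borel_measurable borel \<and> (\<forall>x. \<bar>w n x\<bar> \<le> M) \<and> discrete_dirichlet E F (h n) (w n)"
    by (elim exE) (rule that)
  obtain D :: "plane set" where D: "countable D" "\<And>X. open X \<Longrightarrow> X \<noteq> {} \<Longrightarrow> \<exists>d\<in>D. d \<in> X"
    using countable_dense_exists by blast
  obtain \<tau> :: "nat \<Rightarrow> nat" where \<tau>: "strict_mono \<tau>" "\<And>x. x \<in> D \<Longrightarrow> \<exists>l. (\<lambda>n. w (\<tau> n) x) \<longlonglongrightarrow> l"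
    using function_convergent_subsequence[OF D(1), of w M] w by auto
  define u where "u n = w (\<tau> n)" for n
  define H where "H n = h (\<tau> n)" for n
  have H: "H n > 0" for n by (simp add: H_def h)
  have Hlim: "H \<longlonglongrightarrow> 0" unfolding H_def using LIMSEQ_subseq_LIMSEQ[OF hlim \<tau>(1)] by (simp add: o_def)
  have u: "u n \<in> borel_measurable borel" "\<forall>x. \<bar>u n x\<bar> \<le> M" "discrete_dirichlet E F (H n) (u n)" for n
    using w by (simp_all add: u_def H_def)
  have modulus: "\<exists>\<delta>>0. \<exists>N. \<forall>n\<ge>N. \<forall>x y. dist x y < \<delta> \<longrightarrow> \<bar>u n x - u n y\<bar> \<le> e" if e: "e > 0" for e
  proof -
    obtain \<delta> h0 where d: "\<delta> > 0" "h0 > 0" "\<forall>h u x y. 0 < h \<longrightarrow> h < h0 \<longrightarrow> discrete_dirichlet E F h u \<longrightarrow> (\<forall>y. \<bar>u y\<bar> \<le> M) \<longrightarrow>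
     dist x y < \<delta> \<longrightarrow> \<bar>u x - u y\<bar> \<le> e"
      using discrete_dirichlet_modulus[OF E(2) c cone uc M e] by (elim exE conjE) (rule that)
    obtain N where N: "\<forall>n\<ge>N. H n < h0" using order_tendstoD(2)[OF Hlim d(2)] by (auto simp: eventually_sequentially)
    have "\<bar>u n x - u n y\<bar> \<le> e" if "n \<ge> N" "dist x y < \<delta>" for n x y
      by (rule d(3)[rule_format, OF H _ u(3) _ that(2)]) (use N that u(2) in auto)
    then show ?thesis using d(1) by (intro exI[of _ \<delta>] conjI exI[of _ N]) auto
  qed
  have conv: "convergent (\<lambda>n. u n x)" for x
  proof (rule Cauchy_convergent, rule CauchyI)
    fix e :: real assume e: "e > 0"
    obtain \<delta> N where \<delta>: "\<delta> > 0" "\<forall>n\<ge>N. \<forall>x y. dist x y < \<delta> \<longrightarrow> \<bar>u n x - u n y\<bar> \<le> e / 4"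
      using modulus[of "e / 4"] e by auto
    obtain d where d: "d \<in> D" "d \<in> ball x \<delta>" using D(2)[of "ball x \<delta>"] \<delta>(1) by auto
    have "convergent (\<lambda>n. u n d)" using \<tau>(2)[OF d(1)] by (simp add: u_def convergent_def)
    then have "Cauchy (\<lambda>n. u n d)" by (rule convergent_Cauchy)
    then obtain N' where N': "\<forall>m\<ge>N'. \<forall>n\<ge>N'. norm (u m d - u n d) < e / 4" using CauchyD[of "\<lambda>n. u n d" "e / 4"] e by auto
    show "\<exists>M. \<forall>m\<ge>M. \<forall>n\<ge>M. norm (u m x - u n x) < e"
    proof (intro exI[of _ "max N N'"] allI impI)
      fix m n assume mn: "max N N' \<le> m" "max N N' \<le> n"
      have "\<bar>u m x - u m d\<bar> \<le> e / 4" "\<bar>u n x - u n d\<bar> \<le> e / 4" using \<delta>(2) d(2) mn by auto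
      moreover have "\<bar>u m d - u n d\<bar> < e / 4" using N' mn by simp
      ultimately show "norm (u m x - u n x) < e" unfolding real_norm_def by linarith
    qed
  qed
  define v where "v x = lim (\<lambda>n. u n x)" for x
  have lim: "(\<lambda>n. u n x) \<longlonglongrightarrow> v x" for x using conv[of x] by (simp add: v_def convergent_LIMSEQ_iff)
  have "continuous_on UNIV v"
    unfolding continuous_on_iff
  proof (intro ballI allI impI)
    fix x :: plane and e :: real assume e: "e > 0"
    obtain \<delta> N where \<delta>: "\<delta> > 0" "\<forall>n\<ge>N. \<forall>x y. dist x y < \<delta> \<longrightarrow> \<bar>u n x - u n y\<bar> \<le> e / 2"
      using modulus[of "e / 2"] e by auto
    have "dist (v y) (v x) < e" if "dist y x < \<delta>" for y
    proof -
      have "(\<lambda>n. \<bar>u n y - u n x\<bar>) \<longlonglongrightarrow> \<bar>v y - v x\<bar>" by (intro tendsto_intros lim)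
      then have "\<bar>v y - v x\<bar> \<le> e / 2" by (rule LIMSEQ_le_const2) (use \<delta>(2) that in auto)
      then show ?thesis using e by (simp add: dist_real_def)
    qed
    then show "\<exists>d>0. \<forall>x'\<in>UNIV. dist x' x < d \<longrightarrow> dist (v x') (v x) < e" using \<delta>(1) by blast
  qed
  moreover have "v x = F x" if "x \<notin> E" for x
    using u(3) that LIMSEQ_unique[OF lim[of x]] by (simp add: discrete_dirichlet_def)
  moreover have "has_weak_laplacian E v (\<lambda>_. 0)"
  proof (rule weak_laplacian_of_dlap[OF E H Hlim u(1) _ lim, of M _ 0])
    show "\<bar>u n x\<bar> \<le> M" for n x using u(2) by blast
    show "(\<lambda>n. dlap (H n) (u n) x / (H n)\<^sup>2) \<longlonglongrightarrow> 0" if "x \<in> E" for x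
      using u(3) that by (simp add: discrete_dirichlet_def)
    show "\<bar>dlap (H n) (u n) x / (H n)\<^sup>2\<bar> \<le> 0" if "x \<in> E" for n x
      using u(3) that by (simp add: discrete_dirichlet_def)
  qed
  ultimately show ?thesis by blast
qed

section \<open>Polynomials in two variables\<close>

definition mono2 :: "nat \<Rightarrow> nat \<Rightarrow> plane \<Rightarrow> real" where
  "mono2 i j z = fst z ^ i * snd z ^ j"

lemma finite_exponents: "finite {(i, j). i + j \<le> (k::nat)}"
  by (rule finite_subset[of _ "{..k} \<times> {..k}"]) auto

lemma poly_fun2_eq: "f \<in> poly_fun2 k \<longleftrightarrow> (\<exists>c. f = (\<Sum>(i, j) | i + j \<le> k. c i j *\<^sub>R mono2 i j))"
proof -
  have *: "(\<Sum>(i, j) | i + j \<le> k. c i j *\<^sub>R mono2 i j) (x, y) = (\<Sum>(i, j) | i + j \<le> k. c i j * x ^ i * y ^ j)" for c x y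
    unfolding sum_fun_apply by (intro sum.cong) (auto simp: scaleR_fun_def mono2_def)
  show ?thesis unfolding poly_fun2_def fun_eq_iff mem_Collect_eq
    by (auto simp: * split_paired_All)
qed

lemma mono2_in_poly_fun2:
  assumes "i + j \<le> k" shows "mono2 i j \<in> poly_fun2 k"
  unfolding poly_fun2_eq
proof (rule exI)
  have "(\<Sum>(i', j') | i' + j' \<le> k. (if i' = i \<and> j' = j then 1 else 0) *\<^sub>R mono2 i' j')
      = (\<Sum>p\<in>{(i, j). i + j \<le> k}. if p = (i, j) then mono2 i j else 0)"
    by (intro sum.cong) auto
  also have "\<dots> = mono2 i j" using assms finite_exponents by (subst sum.delta) auto
  finally show "mono2 i j = (\<Sum>(i', j') | i' + j' \<le> k. (if i' = i \<and> j' = j then 1 else 0) *\<^sub>R mono2 i' j')" ..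
qed

lemma subspace_poly_fun2: "subspace (poly_fun2 k)"
  unfolding subspace_def
proof (intro conjI ballI allI)
  show "0 \<in> poly_fun2 k" unfolding poly_fun2_eq by (rule exI[of _ "\<lambda>_ _. 0"]) (simp add: case_prod_unfold)
  fix f g assume "f \<in> poly_fun2 k" "g \<in> poly_fun2 k"
  then obtain c d where "f = (\<Sum>(i, j) | i + j \<le> k. c i j *\<^sub>R mono2 i j)" "g = (\<Sum>(i, j) | i + j \<le> k. d i j *\<^sub>R mono2 i j)"
    unfolding poly_fun2_eq by (elim exE) (rule that)
  then have "f + g = (\<Sum>(i, j) | i + j \<le> k. (c i j + d i j) *\<^sub>R mono2 i j)"
    by (simp add: case_prod_unfold sum.distrib scaleR_add_left)
  then show "f + g \<in> poly_fun2 k" unfolding poly_fun2_eq by (rule exI[of _ "\<lambda>i j. c i j + d i j"])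
next
  fix a f assume "f \<in> poly_fun2 k"
  then obtain c where "f = (\<Sum>(i, j) | i + j \<le> k. c i j *\<^sub>R mono2 i j)"
    unfolding poly_fun2_eq by (elim exE) (rule that)
  then have "a *\<^sub>R f = (\<Sum>(i, j) | i + j \<le> k. (a * c i j) *\<^sub>R mono2 i j)"
    by (simp add: case_prod_unfold scaleR_sum_right)
  then show "a *\<^sub>R f \<in> poly_fun2 k" unfolding poly_fun2_eq by (rule exI[of _ "\<lambda>i j. a * c i j"])
qed

lemma poly_fun2_in_subspace:
  assumes "f \<in> poly_fun2 k" "subspace V" "\<And>i j. i + j \<le> k \<Longrightarrow> mono2 i j \<in> V"
  shows "f \<in> V"
proof -
  obtain c where "f = (\<Sum>(i, j) | i + j \<le> k. c i j *\<^sub>R mono2 i j)"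
    using assms(1) unfolding poly_fun2_eq by (elim exE) (rule that)
  also have "\<dots> \<in> V" using assms(2,3) by (intro subspace_sum) (auto intro: subspace_scale)
  finally show ?thesis .
qed

lemma subspace_continuous: "subspace {f :: plane \<Rightarrow> real. continuous_on S f}"
  unfolding subspace_def plus_fun_def scaleR_fun_def zero_fun_def by (auto intro!: continuous_intros)

lemma continuous_mono2: "continuous_on S (mono2 i j)"
  by (auto simp: mono2_def[abs_def] intro!: continuous_intros)

lemma continuous_poly_fun2:
  assumes "f \<in> poly_fun2 k" shows "continuous_on UNIV f"
proof -
  have "f \<in> {f. continuous_on UNIV f}"
    by (rule poly_fun2_in_subspace[OF assms subspace_continuous]) (simp add: continuous_mono2)
  then show ?thesis by simp
qed

section \<open>Linearity of weak Laplacians\<close>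

lemma set_integrable_continuous:
  fixes f :: "plane \<Rightarrow> real"
  assumes E: "open E" "bounded E" and c: "continuous_on (closure E) f"
  shows "set_integrable lborel E f"
proof -
  have K: "compact (closure E)" using E(2) by (simp add: compact_closure)
  have "bounded (f ` closure E)" by (intro compact_imp_bounded compact_continuous_image c K)
  then obtain B where B: "B > 0" "\<forall>y\<in>f ` closure E. norm y \<le> B" unfolding bounded_pos by (elim exE conjE) (rule that)
  have "integrable lborel (\<lambda>x. indicator E x *\<^sub>R f x)"
  proof (rule integrable_bounded_support[of _ B E])
    have "continuous_on E f" using c closure_subset by (rule continuous_on_subset)
    then show "(\<lambda>x. indicator E x *\<^sub>R f x) \<in> borel_measurable borel"
      using E(1) by (intro borel_measurable_continuous_on_indicator) auto
    fix x show "\<bar>indicator E x *\<^sub>R f x\<bar> \<le> B"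
    proof (cases "x \<in> E")
      case True then have "f x \<in> f ` closure E" using closure_subset by blast
      then have "norm (f x) \<le> B" using B(2) by blast
      then show ?thesis using True by simp
    qed (use B in simp)
  qed (use E in auto)
  then show ?thesis by (simp add: set_integrable_def)
qed

lemma weak_laplacian_lincomb:
  assumes E: "open E" "bounded E"
    and w: "has_weak_laplacian E f g" "has_weak_laplacian E f' g'"
    and c: "continuous_on (closure E) f" "continuous_on (closure E) g" "continuous_on (closure E) f'" "continuous_on (closure E) g'"
  shows "has_weak_laplacian E (\<lambda>x. a * f x + b * f' x) (\<lambda>x. a * g x + b * g' x)"
  unfolding has_weak_laplacian_def
proof
  fix \<psi> assume \<psi>: "\<psi> \<in> test_functions E"
  then have sm: "\<forall>m. C_diff m \<psi>" by (simp add: test_functions_def)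
  have c\<psi>: "continuous_on (closure E) \<psi>" "continuous_on (closure E) (laplacian \<psi>)"
    using C_diff_continuous sm C_diff_laplacian_continuous[OF sm] by (blast intro: continuous_on_subset)+
  have i: "set_integrable lborel E (\<lambda>x. f x * laplacian \<psi> x)" "set_integrable lborel E (\<lambda>x. f' x * laplacian \<psi> x)"
     "set_integrable lborel E (\<lambda>x. g x * \<psi> x)" "set_integrable lborel E (\<lambda>x. g' x * \<psi> x)"
    by (intro set_integrable_continuous E continuous_intros c c\<psi>)+
  have "(LINT x:E|lborel. (a * f x + b * f' x) * laplacian \<psi> x) = (LINT x:E|lborel. a * (f x * laplacian \<psi> x) + b * (f' x * laplacian \<psi> x))"
    by (simp add: algebra_simps)
  also have "\<dots> = a * (LINT x:E|lborel. f x * laplacian \<psi> x) + b * (LINT x:E|lborel. f' x * laplacian \<psi> x)"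
    using i by (subst set_integral_add) (auto intro: set_integrable_mult_right)
  also have "\<dots> = a * (LINT x:E|lborel. g x * \<psi> x) + b * (LINT x:E|lborel. g' x * \<psi> x)"
    using w \<psi> unfolding has_weak_laplacian_def by simp
  also have "\<dots> = (LINT x:E|lborel. a * (g x * \<psi> x) + b * (g' x * \<psi> x))"
    using i by (subst set_integral_add) (auto intro: set_integrable_mult_right)
  also have "\<dots> = (LINT x:E|lborel. (a * g x + b * g' x) * \<psi> x)" by (simp add: algebra_simps)
  finally show "(LINT x:E|lborel. (a * f x + b * f' x) * laplacian \<psi> x) = (LINT x:E|lborel. (a * g x + b * g' x) * \<psi> x)" .
qed

lemma weak_laplacian_cong:
  assumes "has_weak_laplacian E f g" "\<And>x. x \<in> E \<Longrightarrow> f x = f' x" "\<And>x. x \<in> E \<Longrightarrow> g x = g' x"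
  shows "has_weak_laplacian E f' g'"
proof -
  have "(LINT x:E|lborel. f' x * q x) = (LINT x:E|lborel. f x * q x)" "(LINT x:E|lborel. g' x * q x) = (LINT x:E|lborel. g x * q x)" for q
    unfolding set_lebesgue_integral_def
    by (intro Bochner_Integration.integral_cong; use assms in \<open>auto simp: indicator_def\<close>)+
  then show ?thesis using assms(1) unfolding has_weak_laplacian_def by simp
qed

lemma weak_laplacian_0: "has_weak_laplacian E (\<lambda>_. 0) (\<lambda>_. 0)"
  by (simp add: has_weak_laplacian_def)

section \<open>Polynomials and the Laplacian\<close>

lemma second_derivs_mono2:
  "has_second_derivs (mono2 i j) (\<lambda>z. real i * real (i - 1) * mono2 (i - 2) j z) (\<lambda>z. real j * real (j - 1) * mono2 i (j - 2) z)"
  unfolding has_second_derivs_def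
proof (intro conjI)
  show "\<exists>f1 f2. \<forall>x y. ((\<lambda>t. mono2 i j (t, y)) has_real_derivative f1 (x, y)) (at x) \<and>
      ((\<lambda>t. f1 (t, y)) has_real_derivative real i * real (i - 1) * mono2 (i - 2) j (x, y)) (at x) \<and>
      ((\<lambda>t. mono2 i j (x, t)) has_real_derivative f2 (x, y)) (at y) \<and>
      ((\<lambda>t. f2 (x, t)) has_real_derivative real j * real (j - 1) * mono2 i (j - 2) (x, y)) (at y)"
    by (rule exI[of _ "\<lambda>z. real i * mono2 (i - 1) j z"], rule exI[of _ "\<lambda>z. real j * mono2 i (j - 1) z"])
       (auto simp: mono2_def numeral_2_eq_2 intro!: derivative_eq_intros)
qed (auto simp: mono2_def[abs_def] intro!: continuous_intros)

lemma weak_laplacian_mono2: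
  assumes "open E" "bounded E"
  shows "has_weak_laplacian E (mono2 i j)
    (\<lambda>z. real i * real (i - 1) * mono2 (i - 2) j z + real j * real (j - 1) * mono2 i (j - 2) z)"
  by (rule weak_laplacian_classical[OF assms second_derivs_mono2 continuous_mono2])

text \<open>Continuity of both functions makes the relation stable under linear combinations.\<close>

definition weakly_solves :: "(plane \<Rightarrow> real) \<Rightarrow> (plane \<Rightarrow> real) \<Rightarrow> bool" where
  "weakly_solves f g \<longleftrightarrow> continuous_on UNIV f \<and> continuous_on UNIV g \<and>
     (\<forall>E. open E \<longrightarrow> bounded E \<longrightarrow> has_weak_laplacian E f g)"

lemma weakly_solves_lincomb:
  assumes "weakly_solves f g" "weakly_solves f' g'"
  shows "weakly_solves (\<lambda>x. a * f x + b * f' x) (\<lambda>x. a * g x + b * g' x)"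
  using assms unfolding weakly_solves_def
  by (auto intro!: weak_laplacian_lincomb continuous_intros intro: continuous_on_subset)

lemma weakly_solves_add: "weakly_solves f g \<Longrightarrow> weakly_solves f' g' \<Longrightarrow> weakly_solves (f + f') (g + g')"
  using weakly_solves_lincomb[of f g f' g' 1 1] by (simp add: plus_fun_def)

lemma weakly_solves_scale: "weakly_solves f g \<Longrightarrow> weakly_solves (a *\<^sub>R f) (a *\<^sub>R g)"
  using weakly_solves_lincomb[of f g f g a 0] by (simp add: scaleR_fun_def)

lemma weakly_solves_0: "weakly_solves 0 0"
  by (auto simp: weakly_solves_def zero_fun_def weak_laplacian_0)

lemma poly_laplacian:
  assumes "p \<in> poly_fun2 k"
  shows "\<exists>g\<in>poly_fun2 k. weakly_solves p g"
proof -
  let ?V = "{p. \<exists>g\<in>poly_fun2 k. weakly_solves p g}"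
  have "p \<in> ?V"
  proof (rule poly_fun2_in_subspace[OF assms])
    show "subspace ?V" unfolding subspace_def
      using weakly_solves_0 weakly_solves_add weakly_solves_scale subspace_poly_fun2[of k]
      unfolding subspace_def by blast
    fix i j assume ij: "i + j \<le> k"
    let ?g = "(real i * real (i - 1)) *\<^sub>R mono2 (i - 2) j + (real j * real (j - 1)) *\<^sub>R mono2 i (j - 2)"
    have "?g \<in> poly_fun2 k"
      using ij by (intro subspace_add subspace_scale subspace_poly_fun2 mono2_in_poly_fun2) auto
    moreover have "weakly_solves (mono2 i j) ?g"
      unfolding weakly_solves_def plus_fun_def scaleR_fun_def
      using weak_laplacian_mono2[of _ i j] by (auto intro!: continuous_intros continuous_mono2)
    ultimately show "mono2 i j \<in> ?V" by blast
  qed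
  then show ?thesis by simp
qed

text \<open>Integrating twice in the first variable leaves an error in which the exponent of the second
  variable has dropped by two.\<close>

lemma mono2_has_potential: "\<exists>q. weakly_solves q (mono2 i j)"
proof (induction j arbitrary: i rule: less_induct)
  case (less j)
  have "\<exists>q. weakly_solves q ((real j * real (j - 1)) *\<^sub>R mono2 (i + 2) (j - 2))"
  proof (cases "j < 2")
    case True
    then have "(real j * real (j - 1)) *\<^sub>R mono2 (i + 2) (j - 2) = 0" by auto
    then show ?thesis using weakly_solves_0 by metis
  next
    case False
    then obtain q where "weakly_solves q (mono2 (i + 2) (j - 2))" using less[of "j - 2" "i + 2"] by auto
    then show ?thesis using weakly_solves_scale by blast
  qed
  then obtain q where q: "weakly_solves q ((real j * real (j - 1)) *\<^sub>R mono2 (i + 2) (j - 2))" ..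
  define N where "N = real (i + 2) * real (i + 1)"
  have N: "N \<noteq> 0" by (simp add: N_def)
  have P: "weakly_solves (mono2 (i + 2) j) (N *\<^sub>R mono2 i j + (real j * real (j - 1)) *\<^sub>R mono2 (i + 2) (j - 2))"
    unfolding weakly_solves_def plus_fun_def scaleR_fun_def
    using weak_laplacian_mono2[of _ "i + 2" j] by (auto intro!: continuous_intros continuous_mono2 simp: N_def)
  have "weakly_solves ((1 / N) *\<^sub>R (mono2 (i + 2) j + (- 1) *\<^sub>R q))
      ((1 / N) *\<^sub>R ((N *\<^sub>R mono2 i j + (real j * real (j - 1)) *\<^sub>R mono2 (i + 2) (j - 2)) + (- 1) *\<^sub>R ((real j * real (j - 1)) *\<^sub>R mono2 (i + 2) (j - 2))))"
    by (intro weakly_solves_scale weakly_solves_add P q)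
  moreover have "(1 / N) *\<^sub>R ((N *\<^sub>R mono2 i j + (real j * real (j - 1)) *\<^sub>R mono2 (i + 2) (j - 2)) + (- 1) *\<^sub>R ((real j * real (j - 1)) *\<^sub>R mono2 (i + 2) (j - 2))) = mono2 i j"
    using N by simp
  ultimately show ?case by metis
qed

lemma poly_has_potential:
  assumes "p \<in> poly_fun2 k"
  shows "\<exists>q. weakly_solves q p"
proof -
  let ?V = "{p. \<exists>q. weakly_solves q p}"
  have "p \<in> ?V"
  proof (rule poly_fun2_in_subspace[OF assms])
    show "subspace ?V" unfolding subspace_def
      using weakly_solves_0 weakly_solves_add weakly_solves_scale by blast
  qed (use mono2_has_potential in blast)
  then show ?thesis by simp
qed

section \<open>Polygons\<close>

lemma connected_component_set_image:
  fixes f :: "'a::topological_space \<Rightarrow> 'b::topological_space"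
  assumes cf: "continuous_on UNIV f" and cg: "continuous_on UNIV g" and gf: "\<And>x. g (f x) = x" and fg: "\<And>y. f (g y) = y"
  shows "connected_component_set (- f ` S) (f x) = f ` connected_component_set (- S) x"
proof (cases "x \<in> S")
  case True
  then have "f x \<notin> - f ` S" "x \<notin> - S" by auto
  then have "connected_component_set (- f ` S) (f x) = {}" "connected_component_set (- S) x = {}"
    by (simp_all only: connected_component_eq_empty simp_thms)
  then show ?thesis by (simp only: image_empty)
next
  case False
  have inj: "f a = f b \<longleftrightarrow> a = b" for a b using gf by metis
  have sub: "f ` connected_component_set (- S) x \<subseteq> connected_component_set (- f ` S) (f x)"
  proof (rule connected_component_maximal)
    show "f x \<in> f ` connected_component_set (- S) x" using False by (auto simp: connected_component_refl)
    show "connected (f ` connected_component_set (- S) x)"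
      by (intro connected_continuous_image continuous_on_subset[OF cf] connected_connected_component) auto
    show "f ` connected_component_set (- S) x \<subseteq> - f ` S"
      using connected_component_subset[of "- S" x] inj by auto
  qed
  have "g ` connected_component_set (- f ` S) (f x) \<subseteq> connected_component_set (- S) x"
  proof (rule connected_component_maximal)
    have "f x \<in> - f ` S" using False inj by auto
    then show "x \<in> g ` connected_component_set (- f ` S) (f x)"
      using gf by (intro image_eqI[of _ _ "f x"]) (auto simp: connected_component_refl)
    show "connected (g ` connected_component_set (- f ` S) (f x))"
      by (intro connected_continuous_image continuous_on_subset[OF cg] connected_connected_component) auto
    show "g ` connected_component_set (- f ` S) (f x) \<subseteq> - S"
    proof
      fix w assume "w \<in> g ` connected_component_set (- f ` S) (f x)"
      then obtain y where y: "w = g y" "y \<in> connected_component_set (- f ` S) (f x)" by (rule imageE)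
      have "y \<notin> f ` S" using y(2) connected_component_subset[of "- f ` S" "f x"] by blast
      then show "w \<in> - S" unfolding y(1) using imageI[of "g y" S f] fg[of y] by auto
    qed
  qed
  then have "f ` g ` connected_component_set (- f ` S) (f x) \<subseteq> f ` connected_component_set (- S) x" by (rule image_mono)
  then show ?thesis using sub fg by (simp add: image_comp o_def subset_antisym)
qed

text \<open>The bounded components of the complement are preserved by a linear homeomorphism. This carries
  the Jordan curve theorem from the complex numbers to pairs of reals.\<close>

lemma inside_image:
  fixes f :: "'a::real_normed_vector \<Rightarrow> 'b::real_normed_vector"
  assumes bf: "bounded_linear f" and bg: "bounded_linear g" and gf: "\<And>x. g (f x) = x" and fg: "\<And>y. f (g y) = y"
  shows "inside (f ` S) = f ` inside S"
proof -
  have c: "continuous_on UNIV f" "continuous_on UNIV g"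
    using bf bg by (simp_all add: linear_continuous_on)
  have inj: "f a = f b \<longleftrightarrow> a = b" for a b using gf by metis
  have b: "bounded (f ` T) \<longleftrightarrow> bounded T" for T
  proof
    assume "bounded (f ` T)"
    then have "bounded (g ` f ` T)" using bg by (rule bounded_linear_image)
    then show "bounded T" by (simp add: image_comp o_def gf)
  qed (rule bounded_linear_image[OF _ bf])
  have "f x \<in> inside (f ` S) \<longleftrightarrow> x \<in> inside S" for x
    unfolding inside_def mem_Collect_eq connected_component_set_image[OF c gf fg] b using inj by auto
  then show ?thesis using fg by (auto simp: image_iff) metis
qed

definition of_complex :: "complex \<Rightarrow> plane" where
  "of_complex w = (Re w, Im w)"

lemma to_of_complex: "of_complex (to_complex x) = x" "to_complex (of_complex w) = w"
  by (simp_all add: to_complex_def of_complex_def)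

lemma bounded_linear_to_complex: "bounded_linear to_complex"
  by (rule bounded_linear_intro[of _ 1]) (simp_all add: to_complex_simps scaleR_conv_of_real)

lemma bounded_linear_of_complex: "bounded_linear of_complex"
  by (rule bounded_linear_intro[of _ 1]) (simp_all add: of_complex_def norm_prod_def cmod_def)

lemma Jordan_inside_plane:
  fixes c :: "real \<Rightarrow> plane"
  assumes "simple_path c" "pathfinish c = pathstart c"
  shows "inside (path_image c) \<noteq> {}" "path_image c \<subseteq> closure (inside (path_image c))"
proof -
  let ?J = to_complex
  note ins = inside_image[OF bounded_linear_to_complex bounded_linear_of_complex to_of_complex]
  have inj: "inj ?J" using to_of_complex(1) by (rule inj_on_inverseI)
  have cJ: "continuous_on S ?J" for S using bounded_linear_to_complex by (simp add: linear_continuous_on)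
  have cK: "continuous_on S of_complex" for S using bounded_linear_of_complex by (simp add: linear_continuous_on)
  have "simple_path (?J \<circ> c)"
    using assms(1) inj by (intro simple_path_continuous_image cJ) (auto intro: inj_on_subset)
  moreover have "pathfinish (?J \<circ> c) = pathstart (?J \<circ> c)" using assms(2) by (simp add: pathfinish_compose pathstart_compose)
  ultimately have J: "inside (path_image (?J \<circ> c)) \<noteq> {}" "frontier (inside (path_image (?J \<circ> c))) = path_image (?J \<circ> c)"
    using Jordan_inside_outside[of "?J \<circ> c"] by auto
  have e: "inside (path_image (?J \<circ> c)) = ?J ` inside (path_image c)" by (simp add: path_image_compose ins)
  show "inside (path_image c) \<noteq> {}" using J(1) e by auto
  have "?J ` path_image c \<subseteq> closure (?J ` inside (path_image c))"
    using J(2) unfolding path_image_compose ins frontier_def by blast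
  then have "of_complex ` ?J ` path_image c \<subseteq> of_complex ` closure (?J ` inside (path_image c))" by (rule image_mono)
  also have "\<dots> \<subseteq> closure (of_complex ` ?J ` inside (path_image c))"
    by (rule image_closure_subset[OF cK]) (auto simp: closure_subset)
  finally show "path_image c \<subseteq> closure (inside (path_image c))"
    by (simp add: image_comp o_def to_of_complex)
qed

lemma polygon_simple_path:
  assumes n: "3 \<le> length vs" and dist: "distinct vs"
    and meet: "\<And>i j. i < length vs \<Longrightarrow> j < length vs \<Longrightarrow> i \<noteq> j \<Longrightarrow>
        edge vs i \<inter> edge vs j = {vs ! i, edge_end vs i} \<inter> {vs ! j, edge_end vs j}"
  shows "\<exists>c. simple_path c \<and> pathfinish c = pathstart c \<and> path_image c = (\<Union>i<length vs. edge vs i)"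
proof -
  let ?n = "length vs"
  have ee: "edge_end vs i = vs ! Suc i" if "Suc i < ?n" for i using that by (simp add: edge_end_def)
  have inj: "vs ! i = vs ! j \<longleftrightarrow> i = j" if "i < ?n" "j < ?n" for i j using dist that by (simp add: nth_eq_iff_index_eq)
  have arcs: "\<exists>g. arc g \<and> pathstart g = vs ! 0 \<and> pathfinish g = vs ! Suc m \<and> path_image g = (\<Union>i<Suc m. edge vs i)"
    if "Suc m < ?n" for m
    using that
  proof (induction m)
    case 0
    have n01: "0 < ?n" "1 < ?n" using n by linarith+
    then have "vs ! 0 \<noteq> vs ! 1" using inj[OF n01] by simp
    then show ?case using ee[OF 0]
      by (intro exI[of _ "linepath (vs ! 0) (vs ! 1)"]) (auto simp: edge_def lessThan_Suc)
  next
    case (Suc m)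
    then obtain g where g: "arc g" "pathstart g = vs ! 0" "pathfinish g = vs ! Suc m" "path_image g = (\<Union>i<Suc m. edge vs i)" by auto
    let ?l = "linepath (vs ! Suc m) (vs ! Suc (Suc m))"
    have el: "path_image ?l = edge vs (Suc m)" using ee[of "Suc m"] Suc.prems by (simp add: edge_def)
    have "path_image g \<inter> path_image ?l \<subseteq> {pathstart ?l}"
    proof
      fix x assume x: "x \<in> path_image g \<inter> path_image ?l"
      then obtain i where i: "i < Suc m" "x \<in> edge vs i" "x \<in> edge vs (Suc m)" unfolding g(4) el by auto
      then have "x \<in> {vs ! i, vs ! Suc i} \<inter> {vs ! Suc m, vs ! Suc (Suc m)}"
        using meet[of i "Suc m"] Suc.prems ee[of i] ee[of "Suc m"] by auto
      moreover have "vs ! i \<noteq> vs ! Suc m" "vs ! i \<noteq> vs ! Suc (Suc m)" "vs ! Suc i \<noteq> vs ! Suc (Suc m)"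
        using inj i(1) Suc.prems by auto
      ultimately show "x \<in> {pathstart ?l}" by auto
    qed
    moreover have "arc ?l" using inj[of "Suc m" "Suc (Suc m)"] Suc.prems by (intro arc_linepath) auto
    ultimately have "arc (g +++ ?l)" using g by (intro arc_join) auto
    moreover have "path_image (g +++ ?l) = (\<Union>i<Suc (Suc m). edge vs i)"
      using g(3,4) el by (subst path_image_join) (auto simp: lessThan_Suc)
    ultimately show ?case using g(2) by (intro exI[of _ "g +++ ?l"]) auto
  qed
  obtain m where m: "?n = Suc (Suc m)" using n by (cases ?n; cases "?n - 1") auto
  obtain g where g: "arc g" "pathstart g = vs ! 0" "pathfinish g = vs ! Suc m" "path_image g = (\<Union>i<Suc m. edge vs i)"
    using arcs[of m] m by auto
  let ?l = "linepath (vs ! Suc m) (vs ! 0)"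
  have el: "path_image ?l = edge vs (Suc m)" using m by (simp add: edge_def edge_end_def)
  have "simple_path (g +++ ?l)"
  proof (rule simple_path_join_loop[OF g(1)])
    show "arc ?l" using inj[of "Suc m" 0] m n by (intro arc_linepath) auto
    show "path_image g \<inter> path_image ?l \<subseteq> {pathstart g, pathstart ?l}"
    proof
      fix x assume x: "x \<in> path_image g \<inter> path_image ?l"
      then obtain i where i: "i < Suc m" "x \<in> edge vs i" "x \<in> edge vs (Suc m)" unfolding g(4) el by auto
      then show "x \<in> {pathstart g, pathstart ?l}"
        using meet[of i "Suc m"] m g(2) by (auto simp: edge_end_def)
    qed
  qed (use g in auto)
  moreover have "path_image (g +++ ?l) = (\<Union>i<?n. edge vs i)"
    using g(3,4) el m by (subst path_image_join) (auto simp: lessThan_Suc)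
  ultimately show ?thesis using g(2) by (intro exI[of _ "g +++ ?l"]) auto
qed

text \<open>The Jordan curve theorem gives the nonemptiness and the inclusion of the edges in the closure of
  \<open>E\<close>; the rest holds for the inside of any compact set.\<close>

lemma polygon_topology:
  assumes "polygon E vs"
  shows "open E" "bounded E" "E \<noteq> {}" "frontier E = (\<Union>i<length vs. edge vs i)"
proof -
  let ?S = "\<Union>i<length vs. edge vs i"
  have E: "E = inside ?S" using assms by (simp add: polygon_def)
  obtain c where c: "simple_path c" "pathfinish c = pathstart c" "path_image c = ?S"
    using polygon_simple_path[of vs] assms unfolding polygon_def by blast
  have cS: "compact ?S" unfolding edge_def by (intro compact_UN compact_segment) auto
  show "open E" unfolding E by (rule open_inside[OF compact_imp_closed[OF cS]])
  show "bounded E" unfolding E by (rule bounded_inside[OF compact_imp_bounded[OF cS]])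
  show "E \<noteq> {}" unfolding E using Jordan_inside_plane(1)[OF c(1,2)] c(3) by simp
  have "?S \<subseteq> closure E" unfolding E using Jordan_inside_plane(2)[OF c(1,2)] c(3) by simp
  moreover have "?S \<inter> E = {}" unfolding E by (rule inside_no_overlap[unfolded Int_commute[of "inside _"]])
  moreover have "frontier E \<subseteq> ?S" unfolding E by (rule frontier_inside_subset[OF compact_imp_closed[OF cS]])
  ultimately show "frontier E = ?S" using \<open>open E\<close> by (auto simp: frontier_def interior_open)
qed

text \<open>The cone at \<open>z\<close> is the reflection in \<open>z\<close> of the cone spanned by the disc. If it contained a
  point of \<open>E\<close>, then \<open>z\<close> would lie on the segment from a point of the disc to that point,
  hence in \<open>E\<close>.\<close>

lemma star_shaped_exterior_cones:
  fixes E :: "plane set"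
  assumes E: "open E" "bounded E" and r: "r > 0"
    and star: "\<And>x y. x \<in> ball p r \<Longrightarrow> y \<in> E \<Longrightarrow> closed_segment x y \<subseteq> E" and p: "p \<in> E"
  shows "\<exists>c>0. c \<le> 1 \<and> exterior_cones c E"
proof -
  have "bounded (closure E)" using E(2) by (rule bounded_closure)
  then obtain B where B: "\<forall>z\<in>closure E. dist p z \<le> B" unfolding bounded_any_center[of _ p] by (elim exE) (rule that)
  define c where "c = min 1 (r / (\<bar>B\<bar> + 1))"
  have c: "0 < c" "c \<le> 1" using r by (simp_all add: c_def)
  have "exterior_cones c E"
    unfolding exterior_cones_def
  proof
    fix z assume z: "z \<in> frontier E"
    have zE: "z \<notin> E" using z E(1) by (simp add: frontier_def interior_open)
    define L where "L = norm (z - p)"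
    have L: "L > 0" using zE p by (auto simp: L_def)
    have "L \<le> B" using B z by (auto simp: L_def frontier_def dist_norm norm_minus_commute)
    then have "c * L \<le> r / (\<bar>B\<bar> + 1) * (\<bar>B\<bar> + 1)" using L r by (intro mult_mono) (auto simp: c_def)
    then have cL: "c * L \<le> r" by simp
    define d where "d = (1 / L) *\<^sub>R (z - p)"
    have "norm d = 1" using L by (simp add: d_def L_def)
    moreover have "c * t \<le> dist x (z + t *\<^sub>R d)" if x: "x \<in> E" and t: "t \<ge> 0" for x t
    proof (rule ccontr)
      assume "\<not> c * t \<le> dist x (z + t *\<^sub>R d)"
      then have lt: "dist x (z + t *\<^sub>R d) < c * t" by simp
      then have t0: "t > 0" using t c(1) by (cases "t = 0") auto
      define e where "e = x - (z + t *\<^sub>R d)"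
      define s where "s = t / L"
      have s: "s > 0" using t0 L by (simp add: s_def)
      define y where "y = p - (1 / s) *\<^sub>R e"
      have "norm e < c * t" using lt by (simp add: e_def dist_norm)
      then have "(1 / s) * norm e < (1 / s) * (c * t)" by (rule mult_strict_left_mono) (use s in simp)
      also have "(1 / s) * (c * t) = c * L" using t0 L by (simp add: s_def)
      finally have "y \<in> ball p r" using cL s by (simp add: y_def dist_norm)
      then have seg: "closed_segment y x \<subseteq> E" using star x by blast
      have td: "t *\<^sub>R d = s *\<^sub>R (z - p)" by (simp add: d_def s_def)
      have "x = z + s *\<^sub>R (z - y)"
        using s by (simp add: y_def e_def td scaleR_diff_right scaleR_add_right)
      then have "(1 + s) *\<^sub>R z = x + s *\<^sub>R y" by (simp add: algebra_simps)
      then have "z = (1 / (1 + s)) *\<^sub>R (x + s *\<^sub>R y)" using s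
        by (metis add_pos_pos divide_inverse less_numeral_extra(1) less_numeral_extra(3) mult_1 scaleR_one scaleR_scaleR left_inverse)
      also have "\<dots> = (1 - 1 / (1 + s)) *\<^sub>R y + (1 / (1 + s)) *\<^sub>R x"
      proof -
        have "1 - 1 / (1 + s) = s / (1 + s)" using s by (simp add: field_simps)
        then show ?thesis by (simp add: scaleR_add_right)
      qed
      finally have "z \<in> closed_segment y x" unfolding in_segment using s by (intro exI[of _ "1 / (1 + s)"]) simp
      then show False using seg zE by blast
    qed
    ultimately show "\<exists>d. norm d = 1 \<and> (\<forall>x\<in>E. \<forall>t\<ge>0. c * t \<le> dist x (z + t *\<^sub>R d))" by blast
  qed
  then show ?thesis using c by blast
qed

lemma polygon_exterior_cones:
  assumes "polygon E vs" "shape_regular \<rho> E vs"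
  shows "\<exists>c>0. c \<le> 1 \<and> exterior_cones c E"
proof -
  note top = polygon_topology[OF assms(1)]
  have "\<not> (\<exists>x. E \<subseteq> {x})"
  proof
    assume "\<exists>x. E \<subseteq> {x}"
    then have "finite E" by (auto intro: finite_subset)
    then show False using top(1,3) finite_imp_not_open by blast
  qed
  have "0 < diameter E"
  proof (rule ccontr)
    assume "\<not> 0 < diameter E"
    then have d0: "dist x y = 0" if "x \<in> E" "y \<in> E" for x y
      using diameter_bounded_bound[OF top(2) that] zero_le_dist[of x y] by linarith
    obtain x where "x \<in> E" using top(3) by auto
    have "E \<subseteq> {x}"
    proof
      fix y assume "y \<in> E"
      from d0[OF \<open>x \<in> E\<close> this] show "y \<in> {x}" by simp
    qed
    then show False using \<open>\<not> (\<exists>x. E \<subseteq> {x})\<close> by blast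
  qed
  then have r: "\<rho> * diameter E > 0" using assms(2) by (simp add: shape_regular_def)
  obtain p where p: "\<forall>x\<in>ball p (\<rho> * diameter E). x \<in> E \<and> (\<forall>y\<in>E. closed_segment x y \<subseteq> E)"
    using assms(2) unfolding shape_regular_def by blast
  show ?thesis
    by (rule star_shaped_exterior_cones[OF top(1,2) r, of p]) (use p r in auto)
qed

section \<open>Polynomials on an edge\<close>

definition edge_param :: "plane \<Rightarrow> plane \<Rightarrow> plane \<Rightarrow> real" where
  "edge_param a b x = ((x - a) \<bullet> (b - a)) / ((b - a) \<bullet> (b - a))"

lemma edge_param_linepath: "a \<noteq> b \<Longrightarrow> edge_param a b (linepath a b t) = t"
proof -
  assume "a \<noteq> b"
  have "linepath a b t - a = t *\<^sub>R (b - a)" by (simp add: linepath_def algebra_simps)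
  then show ?thesis using \<open>a \<noteq> b\<close> by (simp add: edge_param_def)
qed

lemma continuous_edge_param: "continuous_on S (edge_param a b)"
  unfolding edge_param_def by (cases "a = b") (auto intro!: continuous_intros)

lemma in_closed_segment_linepath: "x \<in> closed_segment a b \<longleftrightarrow> (\<exists>t\<in>{0..1}. x = linepath a b t)"
  by (auto simp: linepath_image_01[symmetric])

definition edge_fun :: "plane \<Rightarrow> plane \<Rightarrow> real poly \<Rightarrow> plane \<Rightarrow> real" where
  "edge_fun a b p = restr (closed_segment a b) (\<lambda>x. poly p (edge_param a b x))"

lemma linepath_mem: "t \<in> {0..1} \<Longrightarrow> linepath a b t \<in> closed_segment a b"
  by (auto simp: in_closed_segment_linepath)

lemma edge_fun_linepath: "a \<noteq> b \<Longrightarrow> t \<in> {0..1} \<Longrightarrow> edge_fun a b p (linepath a b t) = poly p t"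
  by (simp add: edge_fun_def restr_def edge_param_linepath linepath_mem)

lemma edge_fun_in_Pk_edge:
  assumes "a \<noteq> b" "p = 0 \<or> int (degree p) \<le> m"
  shows "edge_fun a b p \<in> Pk_edge m a b"
  unfolding Pk_edge_def mem_Collect_eq
proof (intro conjI allI impI)
  show "edge_fun a b p x = 0" if "x \<notin> closed_segment a b" for x using that by (simp add: edge_fun_def restr_def)
  show "\<exists>p'. (p' = 0 \<or> int (degree p') \<le> m) \<and> (\<forall>t\<in>{0..1}. edge_fun a b p (linepath a b t) = poly p' t)"
    using assms by (intro exI[of _ p]) (simp add: edge_fun_linepath)
qed

lemma Pk_edge_linepath_continuous:
  assumes "f \<in> Pk_edge m a b" shows "continuous_on {0..1} (\<lambda>t. f (linepath a b t))"
proof -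
  obtain p where "\<forall>t\<in>{0..1}. f (linepath a b t) = poly p t"
    using assms unfolding Pk_edge_def mem_Collect_eq by (elim exE conjE) (rule that)
  then show ?thesis by (subst continuous_on_cong[OF refl, of _ _ "poly p"]) (auto intro: continuous_intros)
qed

lemma set_integrable_unit: "continuous_on {0..1::real} f \<Longrightarrow> set_integrable lborel {0..1} (f :: real \<Rightarrow> real)"
  unfolding set_integrable_def by (rule borel_integrable_compact) simp

lemma unit_integral_zero:
  fixes f :: "real \<Rightarrow> real"
  assumes c: "continuous_on {0..1} f" and nn: "\<And>t. t \<in> {0..1} \<Longrightarrow> 0 \<le> f t"
    and z: "(LINT t:{0..1}|lborel. f t) = 0" and t: "t \<in> {0..1}"
  shows "f t = 0"
proof (rule has_integral_0_cbox_imp_0[of 0 1 f])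
  have i: "set_integrable lborel {0..1} f" by (rule set_integrable_unit[OF c])
  then have "f integrable_on {0..1}" "integral {0..1} f = 0"
    using set_borel_integral_eq_integral[OF i] z by auto
  then show "(f has_integral 0) (cbox 0 1)" by (simp add: has_integral_iff)
qed (use c nn t in auto)

lemma edge_moment_add:
  assumes "continuous_on {0..1} (\<lambda>t. f (linepath a b t))" "continuous_on {0..1} (\<lambda>t. g (linepath a b t))"
    "continuous_on {0..1} (\<lambda>t. q (linepath a b t))"
  shows "edge_moment a b (f + g) q = edge_moment a b f q + edge_moment a b g q"
proof -
  have "set_integrable lborel {0..1} (\<lambda>t. f (linepath a b t) * q (linepath a b t))"
    "set_integrable lborel {0..1} (\<lambda>t. g (linepath a b t) * q (linepath a b t))"
    by (intro set_integrable_unit continuous_intros assms)+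
  then show ?thesis unfolding edge_moment_def plus_fun_def distrib_right
    by (subst set_integral_add) (auto simp: distrib_left)
qed

lemma edge_moment_scale: "edge_moment a b (c *\<^sub>R f) q = c * edge_moment a b f q"
  unfolding edge_moment_def scaleR_fun_def by (simp add: mult.assoc)

lemma edge_moment_commute: "edge_moment a b f q = edge_moment a b q f"
  unfolding edge_moment_def by (simp add: mult.commute)

lemma edge_moment_cong:
  assumes "\<And>t. t \<in> {0..1} \<Longrightarrow> f (linepath a b t) = g (linepath a b t)"
  shows "edge_moment a b f q = edge_moment a b g q"
  unfolding edge_moment_def set_lebesgue_integral_def
  by (intro arg_cong[where f="(*) (dist a b)"] Bochner_Integration.integral_cong) (use assms in \<open>auto simp: indicator_def\<close>)

text \<open>Multiplication by this function raises the degree along the edge from \<open>k - 2\<close> to \<open>k\<close> and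
  produces zeros at both end points.\<close>

definition bubble :: "plane \<Rightarrow> plane \<Rightarrow> plane \<Rightarrow> real" where
  "bubble a b x = edge_param a b x * (1 - edge_param a b x)"

context
  fixes a b :: plane and k :: nat and B :: "(plane \<Rightarrow> real) set"
  assumes ab: "a \<noteq> b" and k: "1 \<le> k" and B: "is_basis B (Pk_edge (int k - 2) a b)" and fB: "finite B"
begin

lemma span_edge_basis: "span B = Pk_edge (int k - 2) a b" and independent_edge_basis: "independent B"
  using B by (simp_all add: is_basis_def)

lemma continuous_edge_span: "r \<in> span B \<Longrightarrow> continuous_on {0..1} (\<lambda>t. r (linepath a b t))"
  unfolding span_edge_basis by (rule Pk_edge_linepath_continuous)

lemma bubble_moment_eq:
  "edge_moment a b (\<lambda>x. bubble a b x * r x) q = dist a b * (LINT t:{0..1}|lborel. t * (1 - t) * r (linepath a b t) * q (linepath a b t))"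
  unfolding edge_moment_def bubble_def by (simp add: edge_param_linepath[OF ab])

lemma continuous_bubble: "r \<in> span B \<Longrightarrow> continuous_on {0..1} (\<lambda>t. (\<lambda>x. bubble a b x * r x) (linepath a b t))"
  using continuous_edge_span[of r] by (simp add: bubble_def edge_param_linepath[OF ab]) (intro continuous_intros)

lemma edge_moment_linear_right:
  assumes "continuous_on {0..1} (\<lambda>t. f (linepath a b t))"
  shows "linear_functional_on (span B) (\<lambda>q. edge_moment a b f q)"
  unfolding linear_functional_on_def edge_moment_commute[of a b f] edge_moment_scale
proof (intro conjI ballI allI refl)
  fix u v assume "u \<in> span B" "v \<in> span B"
  then show "edge_moment a b (u + v) f = edge_moment a b u f + edge_moment a b v f"
    by (intro edge_moment_add continuous_edge_span assms)
qed

text \<open>Tested with \<open>r\<close> itself, the hypothesis says that \<open>t (1 - t) r\<^sup>2\<close> has integral zero.\<close>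

lemma bubble_injective:
  assumes r: "r \<in> span B" and z: "\<forall>q\<in>B. edge_moment a b (\<lambda>x. bubble a b x * r x) q = 0"
  shows "r = 0"
proof -
  obtain c where c: "r = (\<Sum>q\<in>B. c q *\<^sub>R q)" using r unfolding span_finite[OF fB] by auto
  have "edge_moment a b (\<lambda>x. bubble a b x * r x) (\<Sum>q\<in>B. c q *\<^sub>R q) = (\<Sum>q\<in>B. c q * edge_moment a b (\<lambda>x. bubble a b x * r x) q)"
    by (rule linear_functional_on_sum[OF edge_moment_linear_right[OF continuous_bubble[OF r]]]) (auto simp: span_base)
  then have "edge_moment a b (\<lambda>x. bubble a b x * r x) r = 0" using z by (simp flip: c)
  then have I0: "(LINT t:{0..1}|lborel. t * (1 - t) * r (linepath a b t) * r (linepath a b t)) = 0"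
    unfolding bubble_moment_eq using ab by simp
  have 0: "t * (1 - t) * r (linepath a b t) * r (linepath a b t) = 0" if "t \<in> {0..1}" for t
  proof (rule unit_integral_zero[of "\<lambda>t. t * (1 - t) * r (linepath a b t) * r (linepath a b t)" t])
    show "continuous_on {0..1} (\<lambda>t. t * (1 - t) * r (linepath a b t) * r (linepath a b t))"
      by (intro continuous_intros continuous_edge_span[OF r])
    fix t :: real assume "t \<in> {0..1}"
    then have "0 \<le> (t * (1 - t)) * (r (linepath a b t) * r (linepath a b t))"
      by (intro mult_nonneg_nonneg[OF _ zero_le_square] mult_nonneg_nonneg) auto
    then show "0 \<le> t * (1 - t) * r (linepath a b t) * r (linepath a b t)" by (simp only: mult.assoc)
  qed (rule I0, rule that)
  obtain p where p: "\<forall>t\<in>{0..1}. r (linepath a b t) = poly p t" and off: "\<forall>x. x \<notin> closed_segment a b \<longrightarrow> r x = 0"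
    using r unfolding span_edge_basis Pk_edge_def mem_Collect_eq by (elim exE conjE) (rule that)
  have "p = 0"
  proof (rule ccontr)
    assume "p \<noteq> 0"
    then have "finite {t. poly p t = 0}" by (rule poly_roots_finite)
    moreover have "{0<..<1} \<subseteq> {t. poly p t = 0}"
    proof
      fix t :: real assume t: "t \<in> {0<..<1}"
      then have t01: "t \<in> {0..1}" by simp
      have "t * (1 - t) * poly p t * poly p t = 0" using 0[OF t01] p t01 by simp
      then show "t \<in> {t. poly p t = 0}" using t by simp
    qed
    ultimately have "finite {0<..<1::real}" using finite_subset by blast
    then show False by (simp add: infinite_Ioo)
  qed
  then have "r x = 0" for x using p off by (cases "x \<in> closed_segment a b") (auto simp: in_closed_segment_linepath)
  then show ?thesis by (simp add: fun_eq_iff zero_fun_def)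
qed

text \<open>The end values fix a linear part; the moments are corrected by a bubble times a polynomial of
  degree \<open>k - 2\<close>, which exists because \<open>bubble_injective\<close> concerns as many unknowns as moments.\<close>

lemma edge_interpolation:
  "\<exists>p :: real poly. degree p \<le> k \<and> poly p 0 = \<alpha> \<and> poly p 1 = \<beta> \<and> (\<forall>q\<in>B. edge_moment a b (edge_fun a b p) q = c q)"
proof -
  define l where "l = [:\<alpha>, \<beta> - \<alpha>:]"
  have "\<exists>r\<in>span B. \<forall>q\<in>B. edge_moment a b (\<lambda>x. bubble a b x * r x) q = c q - edge_moment a b (edge_fun a b l) q"
  proof (rule span_system[OF fB independent_edge_basis fB refl])
    fix q assume q: "q \<in> B"
    have s: "(\<lambda>x. bubble a b x * (u + v) x) = (\<lambda>x. bubble a b x * u x) + (\<lambda>x. bubble a b x * v x)"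
      "(\<lambda>x. bubble a b x * (e *\<^sub>R u) x) = e *\<^sub>R (\<lambda>x. bubble a b x * u x)" for u v e
      by (simp_all add: fun_eq_iff plus_fun_def scaleR_fun_def algebra_simps)
    show "linear_functional_on (span B) (\<lambda>r. edge_moment a b (\<lambda>x. bubble a b x * r x) q)"
      unfolding linear_functional_on_def s edge_moment_scale
    proof (intro conjI ballI allI refl)
      fix u v assume u: "u \<in> span B" and v: "v \<in> span B"
      show "edge_moment a b ((\<lambda>x. bubble a b x * u x) + (\<lambda>x. bubble a b x * v x)) q =
          edge_moment a b (\<lambda>x. bubble a b x * u x) q + edge_moment a b (\<lambda>x. bubble a b x * v x) q"
        by (rule edge_moment_add[OF continuous_bubble[OF u] continuous_bubble[OF v] continuous_edge_span[OF span_base[OF q]]])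
    qed
  qed (rule bubble_injective)
  then obtain r where r: "r \<in> span B" "\<forall>q\<in>B. edge_moment a b (\<lambda>x. bubble a b x * r x) q = c q - edge_moment a b (edge_fun a b l) q" by blast
  obtain p where p: "p = 0 \<or> int (degree p) \<le> int k - 2" "\<forall>t\<in>{0..1}. r (linepath a b t) = poly p t"
    using r(1) unfolding span_edge_basis Pk_edge_def mem_Collect_eq by (elim exE conjE) (rule that)
  define P where "P = l + [:0, 1, -1:] * p"
  have "degree P \<le> k"
  proof -
    have "degree l \<le> k" using k by (simp add: l_def)
    moreover have "degree ([:0, 1, -1:] * p) \<le> k"
    proof (cases "p = 0")
      case False
      have "degree ([:0, 1, -1:] * p) \<le> degree [:0, 1, -1::real:] + degree p" by (rule degree_mult_le)
      also have "\<dots> \<le> 2 + degree p" by simp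
      also have "\<dots> \<le> k" using p(1) False by simp
      finally show ?thesis .
    qed simp
    ultimately show ?thesis unfolding P_def by (rule degree_add_le)
  qed
  moreover have "poly P 0 = \<alpha>" "poly P 1 = \<beta>" by (simp_all add: P_def l_def)
  moreover have "edge_moment a b (edge_fun a b P) q = c q" if q: "q \<in> B" for q
  proof -
    have cl: "continuous_on {0..1} (\<lambda>t. edge_fun a b l (linepath a b t))"
      using edge_fun_in_Pk_edge[OF ab, of l "int (degree l)"] by (intro Pk_edge_linepath_continuous) auto
    have "edge_moment a b (edge_fun a b P) q = edge_moment a b (edge_fun a b l + (\<lambda>x. bubble a b x * r x)) q"
    proof (rule edge_moment_cong)
      fix t :: real assume t: "t \<in> {0..1}"
      show "edge_fun a b P (linepath a b t) = (edge_fun a b l + (\<lambda>x. bubble a b x * r x)) (linepath a b t)"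
        using p(2) t by (simp add: edge_fun_linepath[OF ab] plus_fun_def bubble_def edge_param_linepath[OF ab] P_def algebra_simps)
    qed
    also have "\<dots> = edge_moment a b (edge_fun a b l) q + edge_moment a b (\<lambda>x. bubble a b x * r x) q"
      by (rule edge_moment_add[OF cl continuous_bubble[OF r(1)] continuous_edge_span[OF span_base[OF q]]])
    finally show ?thesis using r(2) q by simp
  qed
  ultimately show ?thesis by blast
qed

lemma edge_vanishing:
  assumes f: "f \<in> Pk_edge (int k) a b" and ends: "f a = 0" "f b = 0"
    and z: "\<forall>q\<in>B. edge_moment a b f q = 0"
  shows "f = 0"
proof -
  obtain p where p: "p = 0 \<or> int (degree p) \<le> int k" "\<forall>t\<in>{0..1}. f (linepath a b t) = poly p t"
    and off: "\<forall>x. x \<notin> closed_segment a b \<longrightarrow> f x = 0"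
    using f unfolding Pk_edge_def mem_Collect_eq by (elim exE conjE) (rule that)
  have p01: "poly p 0 = 0" "poly p 1 = 0"
    using p(2)[rule_format, of 0] p(2)[rule_format, of 1] ends by (simp_all add: linepath_def)
  then obtain s where s: "p = [:0, 1:] * s" using poly_eq_0_iff_dvd[of p 0] by (auto elim: dvdE)
  then have "poly s 1 = 0" using p01(2) by simp
  then obtain w where w: "s = [:-1, 1:] * w" using poly_eq_0_iff_dvd[of s 1] by (auto elim: dvdE)
  have deg: "w = 0 \<or> int (degree w) \<le> int k - 2"
  proof (cases "w = 0")
    case False
    have nz: "[:-1, 1:] * w \<noteq> 0" "[:0, 1:] * ([:-1, 1:] * w) \<noteq> 0"
      using False unfolding mult_eq_0_iff by simp_all
    have "degree p = degree [:0, 1::real:] + (degree [:-1, 1::real:] + degree w)" unfolding s w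
      using degree_mult_eq[of "[:0, 1:]" "[:-1, 1:] * w"] degree_mult_eq[of "[:-1, 1::real:]" w] nz(1) False
      by (simp only: pCons_eq_0_iff one_neq_zero simp_thms)
    then have "degree p = 2 + degree w" by simp
    moreover have "p \<noteq> 0" unfolding s w by (rule nz(2))
    ultimately show ?thesis using p(1) by simp
  qed simp
  define r where "r = edge_fun a b (- w)"
  have r: "r \<in> span B" unfolding span_edge_basis r_def by (rule edge_fun_in_Pk_edge[OF ab]) (use deg in simp)
  have fr: "f (linepath a b t) = bubble a b (linepath a b t) * r (linepath a b t)" if t: "t \<in> {0..1}" for t
    using p(2) t by (simp add: r_def edge_fun_linepath[OF ab] bubble_def edge_param_linepath[OF ab] s w algebra_simps)
  have "edge_moment a b (\<lambda>x. bubble a b x * r x) q = 0" if "q \<in> B" for q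
    using z that edge_moment_cong[of f a b "\<lambda>x. bubble a b x * r x" q] fr by simp
  then have "r = 0" using bubble_injective[OF r] by blast
  then have "f x = 0" for x using fr off by (cases "x \<in> closed_segment a b") (auto simp: in_closed_segment_linepath zero_fun_def)
  then show ?thesis by (simp add: fun_eq_iff zero_fun_def)
qed

end

section \<open>Unisolvence of the full space\<close>

text \<open>A bounded continuous extension is made uniformly continuous by composing it with the nearest-point
  projection onto a disc.\<close>

lemma uniformly_continuous_extension:
  fixes F0 :: "plane \<Rightarrow> real"
  assumes K: "compact K" "K \<subseteq> cball 0 R" and R: "R \<ge> 0" and c: "continuous_on K F0"
  shows "\<exists>F M. uniformly_continuous_on UNIV F \<and> (\<forall>x\<in>K. F x = F0 x) \<and> (\<forall>x. \<bar>F x\<bar> \<le> M)"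
proof -
  have "bounded (F0 ` K)" by (intro compact_imp_bounded compact_continuous_image c K)
  then obtain M where M: "M > 0" "\<forall>y\<in>F0 ` K. norm y \<le> M" unfolding bounded_pos by (elim exE conjE) (rule that)
  have cK: "closedin (top_of_set UNIV) K" using compact_imp_closed[OF K(1)] by simp
  obtain G where G: "continuous_on UNIV G" "\<And>x. x \<in> K \<Longrightarrow> G x = F0 x" "\<And>x. x \<in> UNIV \<Longrightarrow> norm (G x) \<le> M"
    using Tietze[OF c cK less_imp_le[OF M(1)]] M(2) by auto
  let ?B = "cball (0::plane) R"
  have B: "convex ?B" "closed ?B" "?B \<noteq> {}" using R by auto
  have mem: "closest_point ?B x \<in> ?B" for x by (rule closest_point_in_set[OF B(2,3)])
  have "uniformly_continuous_on ?B G" by (intro compact_uniformly_continuous continuous_on_subset[OF G(1)]) auto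
  then have "uniformly_continuous_on UNIV (\<lambda>x. G (closest_point ?B x))"
    unfolding uniformly_continuous_on_def
    using closest_point_lipschitz[OF B] mem by (meson UNIV_I le_less_trans)
  moreover have "G (closest_point ?B x) = F0 x" if "x \<in> K" for x
  proof -
    have "x \<in> ?B" using that K(2) by blast
    then show ?thesis using G(2)[OF that] by (simp only: closest_point_self)
  qed
  moreover have "\<bar>G (closest_point ?B x)\<bar> \<le> M" for x using G(3) by simp
  ultimately show ?thesis by blast
qed

text \<open>A function with Laplacian \<open>p\<close> is known explicitly, so only its boundary values have to be corrected
  by a weakly harmonic function.\<close>

lemma weak_poisson:
  fixes F0 :: "plane \<Rightarrow> real"
  assumes E: "open E" "bounded E" and cone: "0 < c" "c \<le> 1" "exterior_cones c E"
    and F0: "continuous_on (frontier E) F0" and p: "p \<in> poly_fun2 k"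
  shows "\<exists>u. continuous_on UNIV u \<and> (\<forall>x\<in>frontier E. u x = F0 x) \<and> has_weak_laplacian E u p"
proof -
  obtain q where "weakly_solves q p" using poly_has_potential[OF p] by blast
  then have q: "continuous_on UNIV q" "has_weak_laplacian E q p" using E by (simp_all add: weakly_solves_def)
  have K: "compact (frontier E)" using E(2) by (simp add: compact_frontier_bounded)
  then obtain R where R: "R > 0" "\<forall>x\<in>frontier E. norm x \<le> R"
    using compact_imp_bounded[OF K] unfolding bounded_pos by (elim exE conjE) (rule that)
  have KR: "frontier E \<subseteq> cball 0 R" using R(2) by (simp add: subset_iff)
  have cK: "continuous_on (frontier E) (\<lambda>x. F0 x - q x)"
    by (intro continuous_intros F0 continuous_on_subset[OF q(1)]) auto
  obtain F M where F: "uniformly_continuous_on UNIV F" "\<forall>x\<in>frontier E. F x = F0 x - q x" "\<forall>x. \<bar>F x\<bar> \<le> M"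
    using uniformly_continuous_extension[OF K KR less_imp_le[OF R(1)] cK] by (elim exE conjE) (rule that)
  obtain u where u: "continuous_on UNIV u" "\<forall>x. x \<notin> E \<longrightarrow> u x = F x" "has_weak_laplacian E u (\<lambda>_. 0)"
    using weak_dirichlet[OF E cone F(1) F(3)[rule_format]] by (elim exE conjE) (rule that)
  have "has_weak_laplacian E (\<lambda>x. 1 * u x + 1 * q x) (\<lambda>x. 1 * 0 + 1 * p x)"
    by (rule weak_laplacian_lincomb[OF E u(3) q(2)])
       (use u q continuous_poly_fun2[OF p] in \<open>auto intro: continuous_on_subset\<close>)
  moreover have "x \<notin> E" if "x \<in> frontier E" for x using that E(1) by (simp add: frontier_def interior_open)
  ultimately show ?thesis using u q(1) F(2) by (intro exI[of _ "\<lambda>x. u x + q x"]) (auto intro!: continuous_intros)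
qed

text \<open>If \<open>p\<close> were positive at \<open>x\<close>, a mollifier concentrated near \<open>x\<close> would be a test function with a
  positive integral against \<open>p\<close>.\<close>

lemma weak_laplacian_of_zero:
  fixes p :: "plane \<Rightarrow> real"
  assumes E: "open E" and w: "has_weak_laplacian E (\<lambda>_. 0) p" and p: "continuous_on UNIV p" and x: "x \<in> E"
  shows "p x = 0"
proof -
  have main: False if w: "has_weak_laplacian E (\<lambda>_. 0) p" and p: "continuous_on UNIV p" and pos: "p x > 0" for p
  proof -
    have "isCont p x" using p by (simp add: continuous_on_eq_continuous_at)
    then obtain d where d: "d > 0" "\<forall>y. dist y x < d \<longrightarrow> dist (p y) (p x) < p x / 2"
      unfolding continuous_at_eps_delta using pos by (meson half_gt_zero)
    obtain r where r: "r > 0" "ball x r \<subseteq> E" using E x open_contains_ball by blast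
    define \<rho> where "\<rho> = min d r / 2"
    have \<rho>: "\<rho> > 0" "\<rho> < d" "\<rho> < r" using d(1) r(1) by (auto simp: \<rho>_def min_def)
    obtain \<eta> :: "plane \<Rightarrow> real" where sm: "\<forall>m. C_diff m \<eta>" and nn: "\<And>x. 0 \<le> \<eta> x" and z: "\<And>x. x \<notin> cball 0 \<rho> \<Longrightarrow> \<eta> x = 0"
      and i: "integrable lborel \<eta>" and one: "(LINT x|lborel. \<eta> x) = 1"
      using mollifier_exists[OF \<rho>(1)] by metis
    have sub: "cball x \<rho> \<subseteq> E" using r(2) \<rho>(3) by (auto simp: subset_iff)
    have z': "\<eta> (y - x) = 0" if "y \<notin> cball x \<rho>" for y using z[of "y - x"] that by (simp add: dist_norm norm_minus_commute)
    have "(\<lambda>y. \<eta> (y - x)) \<in> test_functions E"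
      unfolding test_functions_def mem_Collect_eq
      using sm C_diff_shift z' sub by (intro conjI allI exI[of _ "cball x \<rho>"]) auto
    then have "(LINT y:E|lborel. p y * \<eta> (y - x)) = 0" using w unfolding has_weak_laplacian_def by fastforce
    then have 0: "(LINT y|lborel. p y * \<eta> (y - x)) = 0"
    proof (subst (asm) set_integral_support)
      fix y assume "y \<notin> E"
      then have "y \<notin> cball x \<rho>" using sub by blast
      then show "p y * \<eta> (y - x) = 0" by (simp add: z')
    qed
    have c\<eta>: "continuous_on UNIV (\<lambda>y. \<eta> (y - x))"
      by (rule C_diff_continuous[OF C_diff_shift]) (use sm in blast)
    have ip: "integrable lborel (\<lambda>y. p y * \<eta> (y - x))"
      by (rule integrable_compact_support[of _ "cball x \<rho>"]) (auto intro!: continuous_intros p c\<eta> simp: z')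
    have i': "integrable lborel (\<lambda>y. \<eta> (y - x))" using integrable_shift[OF i, of "-x"] by simp
    have "p x / 2 = (LINT y|lborel. p x / 2 * \<eta> (y - x))"
      using integral_shift[of \<eta> "-x"] i one by simp
    also have "\<dots> \<le> (LINT y|lborel. p y * \<eta> (y - x))"
    proof (rule integral_mono)
      fix y show "p x / 2 * \<eta> (y - x) \<le> p y * \<eta> (y - x)"
      proof (cases "y \<in> cball x \<rho>")
        case True
        then have "dist y x < d" using \<rho>(2) by (simp add: dist_commute)
        then have "dist (p y) (p x) < p x / 2" using d(2) by blast
        then have "p x / 2 \<le> p y" unfolding dist_real_def by linarith
        then show ?thesis using nn by (rule mult_right_mono)
      qed (simp add: z')
    qed (use ip i' in auto)
    finally show False using 0 pos by simp
  qed
  have "has_weak_laplacian E (\<lambda>_. 0) (\<lambda>x. - p x)" using weak_laplacian_uminus[OF w] by simp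
  then show ?thesis using main[OF w p] main[of "\<lambda>x. - p x"] p continuous_on_minus[OF p] by (cases "p x" "0::real" rule: linorder_cases) auto
qed

lemma continuous_extended_by_zero:
  fixes \<phi> :: "plane \<Rightarrow> real"
  assumes E: "open E" and c: "continuous_on (closure E) \<phi>" and z: "\<And>x. x \<notin> E \<Longrightarrow> \<phi> x = 0"
  shows "continuous_on UNIV \<phi>"
proof -
  have "continuous_on (closure E \<union> - E) \<phi>"
  proof (rule continuous_on_closed_Un)
    show "continuous_on (- E) \<phi>" by (subst continuous_on_cong[OF refl, of _ _ "\<lambda>_. 0"]) (auto simp: z)
  qed (use E c in auto)
  moreover have "closure E \<union> - E = UNIV" using closure_subset by blast
  ultimately show ?thesis by simp
qed

lemma subspace_Pk: "subspace (Pk k D)"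
proof -
  have "linear (restr D)" by (rule linearI) (auto simp: restr_def fun_eq_iff plus_fun_def scaleR_fun_def)
  then show ?thesis unfolding Pk_def using subspace_poly_fun2 by (rule linear_subspace_image)
qed

lemma continuous_Pk:
  assumes "q \<in> Pk k D" shows "continuous_on D q"
proof -
  obtain p where p: "p \<in> poly_fun2 k" "q = restr D p" using assms unfolding Pk_def by blast
  have "continuous_on D p" using continuous_poly_fun2[OF p(1)] by (rule continuous_on_subset) simp
  then show ?thesis by (rule continuous_on_eq) (simp add: p(2) restr_def)
qed

context
  fixes k :: nat and E :: "plane set" and vs :: "plane list" and \<rho> :: real
    and Be :: "nat \<Rightarrow> (plane \<Rightarrow> real) set" and Bi :: "(plane \<Rightarrow> real) set"
  assumes k: "1 \<le> k" and poly: "polygon E vs" and reg: "shape_regular \<rho> E vs"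
    and edge_bases: "\<forall>i<length vs. is_basis (Be i) (Pk_edge (int k - 2) (vs ! i) (edge_end vs i))"
    and Bi: "is_basis Bi (Pk k (closure E))"
    and fin: "finite (all_dofs vs Be Bi)"
begin

lemma edge_basis: "i < length vs \<Longrightarrow> is_basis (Be i) (Pk_edge (int k - 2) (vs ! i) (edge_end vs i))"
  using edge_bases by blast

lemma E_open: "open E" and E_bounded: "bounded E" and E_frontier: "frontier E = (\<Union>i<length vs. edge vs i)"
  using polygon_topology[OF poly] by simp_all

lemma frontier_closure: "x \<in> frontier E \<longleftrightarrow> x \<in> closure E \<and> x \<notin> E"
  using E_open by (simp add: frontier_def interior_open)

lemma three_vertices: "3 \<le> length vs" and vs_distinct: "distinct vs"
  using poly by (simp_all add: polygon_def)

lemma edge_end_nth: "Suc i mod length vs < length vs"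
  using three_vertices by (intro mod_less_divisor) linarith

lemma edge_nondegenerate:
  assumes "i < length vs" shows "vs ! i \<noteq> edge_end vs i"
proof -
  have "i \<noteq> Suc i mod length vs" using assms three_vertices by (cases "Suc i = length vs") auto
  then show ?thesis using vs_distinct assms edge_end_nth by (simp add: edge_end_def nth_eq_iff_index_eq)
qed

lemma edge_closure: "i < length vs \<Longrightarrow> edge vs i \<subseteq> closure E"
  using E_frontier frontier_closure by blast

lemma finite_bases: "finite Bi" "i < length vs \<Longrightarrow> finite (Be i)"
proof -
  have "finite (InternalMoment ` Bi)" using fin by (rule finite_subset[rotated]) (auto simp: all_dofs_def)
  then show "finite Bi" by (rule finite_imageD) (auto intro: inj_onI)
  assume "i < length vs"
  then have "EdgeMoment i ` Be i \<subseteq> all_dofs vs Be Bi"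
    unfolding all_dofs_def boundary_dofs_def by blast
  then have "finite (EdgeMoment i ` Be i)" using fin by (rule finite_subset)
  then show "finite (Be i)" by (rule finite_imageD) (auto intro: inj_onI)
qed

lemma Vkk_continuous: "\<phi> \<in> Vkk k E vs \<Longrightarrow> continuous_on (closure E) \<phi>"
  by (simp add: Vkk_def)

lemma continuous_on_edge:
  assumes "continuous_on (closure E) \<phi>" "i < length vs"
  shows "continuous_on {0..1} (\<lambda>t. \<phi> (linepath (vs ! i) (edge_end vs i) t))"
  using assms(1)
proof (rule continuous_on_compose2)
  show "linepath (vs ! i) (edge_end vs i) ` {0..1} \<subseteq> closure E"
    using edge_closure[OF assms(2)] by (simp add: edge_def linepath_image_01)
qed (rule continuous_on_linepath)

lemma subspace_Pk_edge: "subspace (Pk_edge m a b)"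
  unfolding subspace_def
proof (intro conjI ballI allI)
  show "0 \<in> Pk_edge m a b" by (auto simp: Pk_edge_def zero_fun_def intro!: exI[of _ 0])
  fix f g assume "f \<in> Pk_edge m a b" "g \<in> Pk_edge m a b"
  then obtain p q where *: "\<forall>x. x \<notin> closed_segment a b \<longrightarrow> f x = 0" "p = 0 \<or> int (degree p) \<le> m" "\<forall>t\<in>{0..1}. f (linepath a b t) = poly p t"
    "\<forall>x. x \<notin> closed_segment a b \<longrightarrow> g x = 0" "q = 0 \<or> int (degree q) \<le> m" "\<forall>t\<in>{0..1}. g (linepath a b t) = poly q t"
    unfolding Pk_edge_def mem_Collect_eq by (elim exE conjE) (rule that)
  have "p + q = 0 \<or> int (degree (p + q)) \<le> m"
  proof (cases "p = 0 \<or> q = 0")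
    case False
    then have "degree (p + q) \<le> nat m" using *(2,5) by (intro degree_add_le) auto
    then show ?thesis using *(2) False by auto
  qed (use *(2,5) in auto)
  moreover have "\<forall>t\<in>{0..1}. f (linepath a b t) + g (linepath a b t) = poly (p + q) t" using *(3,6) by simp
  ultimately show "f + g \<in> Pk_edge m a b" using *(1,4) unfolding Pk_edge_def plus_fun_def mem_Collect_eq
    by (intro conjI exI[of _ "p + q"]) simp_all
next
  fix c f assume "f \<in> Pk_edge m a b"
  then obtain p where *: "\<forall>x. x \<notin> closed_segment a b \<longrightarrow> f x = 0" "p = 0 \<or> int (degree p) \<le> m" "\<forall>t\<in>{0..1}. f (linepath a b t) = poly p t"
    unfolding Pk_edge_def mem_Collect_eq by (elim exE conjE) (rule that)
  have "smult c p = 0 \<or> int (degree (smult c p)) \<le> m" using *(2) by (cases "c = 0") auto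
  then show "c *\<^sub>R f \<in> Pk_edge m a b" using * unfolding Pk_edge_def scaleR_fun_def
    by (auto intro!: exI[of _ "smult c p"])
qed

lemma subspace_Vkk: "subspace (Vkk k E vs)"
proof -
  have lin: "u + c *\<^sub>R v \<in> Vkk k E vs" if u: "u \<in> Vkk k E vs" and v: "v \<in> Vkk k E vs" for u v c
  proof -
    obtain g h where g: "g \<in> Pk k E" "has_weak_laplacian E u g" and h: "h \<in> Pk k E" "has_weak_laplacian E v h"
      using u v unfolding Vkk_def by blast
    obtain g' h' where g': "g' \<in> poly_fun2 k" "g = restr E g'" and h': "h' \<in> poly_fun2 k" "h = restr E h'"
      using g(1) h(1) unfolding Pk_def by blast
    have "has_weak_laplacian E u g'" "has_weak_laplacian E v h'"
      by (rule weak_laplacian_cong[OF g(2)] weak_laplacian_cong[OF h(2)]; simp add: g' h' restr_def)+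
    then have "has_weak_laplacian E (\<lambda>x. 1 * u x + c * v x) (\<lambda>x. 1 * g' x + c * h' x)"
      by (intro weak_laplacian_lincomb[OF E_open E_bounded])
         (use u v continuous_poly_fun2 g' h' in \<open>auto intro: Vkk_continuous continuous_on_subset\<close>)
    then have "has_weak_laplacian E (u + c *\<^sub>R v) (g + c *\<^sub>R h)"
      by (rule weak_laplacian_cong) (auto simp: plus_fun_def scaleR_fun_def g' h' restr_def)
    moreover have "g + c *\<^sub>R h \<in> Pk k E"
      using g(1) h(1) by (intro subspace_add subspace_scale subspace_Pk)
    moreover have "restr (edge vs i) (u + c *\<^sub>R v) \<in> Pk_edge (int k) (vs ! i) (edge_end vs i)" if "i < length vs" for i
    proof -
      have "restr (edge vs i) (u + c *\<^sub>R v) = restr (edge vs i) u + c *\<^sub>R restr (edge vs i) v"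
        by (auto simp: restr_def fun_eq_iff plus_fun_def scaleR_fun_def)
      then show ?thesis using u v that by (auto simp: Vkk_def intro!: subspace_add subspace_scale subspace_Pk_edge)
    qed
    ultimately show ?thesis using u v unfolding Vkk_def
      by (auto simp: plus_fun_def scaleR_fun_def intro!: continuous_intros)
  qed
  have "restr (edge vs i) 0 = 0" for i by (auto simp: restr_def zero_fun_def)
  then have 0: "0 \<in> Vkk k E vs" unfolding Vkk_def
    using subspace_0[OF subspace_Pk_edge] subspace_0[OF subspace_Pk] weak_laplacian_0[of E]
    by (auto simp: zero_fun_def intro!: bexI[of _ 0])
  show ?thesis unfolding subspace_def
    using lin[of _ _ 1] lin[OF 0] 0 by auto
qed

lemma restr_in_Vkk:
  assumes c: "continuous_on UNIV u" and w: "has_weak_laplacian E u p" and p: "p \<in> poly_fun2 k"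
    and e: "\<And>i. i < length vs \<Longrightarrow> \<exists>q. degree q \<le> k \<and> (\<forall>t\<in>{0..1}. u (linepath (vs ! i) (edge_end vs i) t) = poly q t)"
  shows "restr (closure E) u \<in> Vkk k E vs"
  unfolding Vkk_def mem_Collect_eq
proof (intro conjI allI impI)
  show "restr (closure E) u x = 0" if "x \<notin> closure E" for x using that by (simp add: restr_def)
  have "continuous_on (closure E) u" using c by (rule continuous_on_subset) simp
  then show "continuous_on (closure E) (restr (closure E) u)"
    by (rule continuous_on_eq) (simp add: restr_def)
  show "restr (edge vs i) (restr (closure E) u) \<in> Pk_edge (int k) (vs ! i) (edge_end vs i)" if i: "i < length vs" for i
  proof -
    obtain q where q: "degree q \<le> k" "\<forall>t\<in>{0..1}. u (linepath (vs ! i) (edge_end vs i) t) = poly q t" using e[OF i] by blast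
    have "restr (edge vs i) (restr (closure E) u) = restr (edge vs i) u"
      using edge_closure[OF i] by (auto simp: restr_def fun_eq_iff)
    then show ?thesis using q unfolding Pk_edge_def
      by (auto simp: restr_def edge_def linepath_mem intro!: exI[of _ q])
  qed
  show "\<exists>g\<in>Pk k E. has_weak_laplacian E (restr (closure E) u) g"
  proof (rule bexI)
    show "has_weak_laplacian E (restr (closure E) u) (restr E p)"
      by (rule weak_laplacian_cong[OF w]) (use closure_subset in \<open>auto simp: restr_def\<close>)
    show "restr E p \<in> Pk k E" using p by (simp add: Pk_def)
  qed
qed

lemma mono2_on_line: "\<exists>q. degree q \<le> i + j \<and> (\<forall>t. mono2 i j (linepath a b t) = poly q t)"
proof (intro exI conjI allI)
  let ?x = "[:fst a, fst b - fst a:]" and ?y = "[:snd a, snd b - snd a:]"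
  have "degree (?x ^ i * ?y ^ j) \<le> degree (?x ^ i) + degree (?y ^ j)" by (rule degree_mult_le)
  also have "\<dots> \<le> degree ?x * i + degree ?y * j" by (intro add_mono degree_power_le)
  also have "\<dots> \<le> 1 * i + 1 * j" by (intro add_mono mult_right_mono) auto
  finally show "degree (?x ^ i * ?y ^ j) \<le> i + j" by simp
  show "mono2 i j (linepath a b t) = poly (?x ^ i * ?y ^ j) t" for t
    by (simp add: mono2_def linepath_def algebra_simps)
qed

lemma poly_fun2_on_line:
  assumes "p \<in> poly_fun2 k"
  shows "\<exists>q. degree q \<le> k \<and> (\<forall>t. p (linepath a b t) = poly q t)"
proof -
  let ?V = "{p. \<exists>q. degree q \<le> k \<and> (\<forall>t. p (linepath a b t) = poly q t)}"
  have "p \<in> ?V"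
  proof (rule poly_fun2_in_subspace[OF assms])
    show "subspace ?V" unfolding subspace_def mem_Collect_eq
    proof (intro conjI ballI allI)
      show "\<exists>q. degree q \<le> k \<and> (\<forall>t. (0::plane \<Rightarrow> real) (linepath a b t) = poly q t)"
        by (rule exI[of _ 0]) (simp add: zero_fun_def)
      fix f g assume "f \<in> ?V" "g \<in> ?V"
      then obtain q r where "degree q \<le> k" "\<forall>t. f (linepath a b t) = poly q t" "degree r \<le> k" "\<forall>t. g (linepath a b t) = poly r t"
        unfolding mem_Collect_eq by (elim exE conjE) (rule that)
      then show "\<exists>q. degree q \<le> k \<and> (\<forall>t. (f + g) (linepath a b t) = poly q t)"
        by (intro exI[of _ "q + r"]) (auto simp: plus_fun_def intro: degree_add_le)
    next
      fix c f assume "f \<in> ?V"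
      then obtain q where "degree q \<le> k" "\<forall>t. f (linepath a b t) = poly q t"
        unfolding mem_Collect_eq by (elim exE conjE) (rule that)
      then show "\<exists>q. degree q \<le> k \<and> (\<forall>t. (c *\<^sub>R f) (linepath a b t) = poly q t)"
        by (intro exI[of _ "smult c q"]) (auto simp: scaleR_fun_def intro: order_trans[OF degree_smult_le])
    qed
    fix i j assume "i + j \<le> k"
    then show "mono2 i j \<in> ?V" using mono2_on_line[of i j a b] order_trans by blast
  qed
  then show ?thesis by simp
qed

lemma Pk_subset_Vkk: "Pk k (closure E) \<subseteq> Vkk k E vs"
proof
  fix f assume "f \<in> Pk k (closure E)"
  then obtain p where p: "p \<in> poly_fun2 k" "f = restr (closure E) p" unfolding Pk_def by blast
  obtain g where g: "g \<in> poly_fun2 k" "weakly_solves p g" using poly_laplacian[OF p(1)] by blast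
  show "f \<in> Vkk k E vs" unfolding p(2)
  proof (rule restr_in_Vkk[OF _ _ g(1)])
    show "continuous_on UNIV p" "has_weak_laplacian E p g"
      using g(2) E_open E_bounded by (simp_all add: weakly_solves_def)
    fix i
    obtain q where "degree q \<le> k" "\<forall>t. p (linepath (vs ! i) (edge_end vs i) t) = poly q t"
      using poly_fun2_on_line[OF p(1), of "vs ! i" "edge_end vs i"] by (elim exE conjE) (rule that)
    then show "\<exists>q. degree q \<le> k \<and> (\<forall>t\<in>{0..1}. p (linepath (vs ! i) (edge_end vs i) t) = poly q t)" by blast
  qed
qed

lemma moment_add:
  assumes "continuous_on (closure E) f" "continuous_on (closure E) g" "continuous_on (closure E) q"
  shows "moment E (f + g) q = moment E f q + moment E g q"
proof -
  have "set_integrable lborel E (\<lambda>x. f x * q x)" "set_integrable lborel E (\<lambda>x. g x * q x)"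
    by (intro set_integrable_continuous E_open E_bounded continuous_intros assms)+
  then show ?thesis unfolding moment_def plus_fun_def distrib_right by (rule set_integral_add)
qed

lemma moment_scale: "moment E (c *\<^sub>R f) q = c * moment E f q"
  unfolding moment_def scaleR_fun_def by (simp add: mult.assoc)

lemma moment_commute: "moment E f q = moment E q f"
  unfolding moment_def by (simp add: mult.commute)

lemma moment_cong: "(\<And>x. x \<in> E \<Longrightarrow> f x = g x) \<Longrightarrow> moment E f q = moment E g q"
  unfolding moment_def set_lebesgue_integral_def
  by (intro Bochner_Integration.integral_cong) (auto simp: indicator_def)

lemma moment_linear_right:
  assumes "continuous_on (closure E) f"
  shows "linear_functional_on (Pk k (closure E)) (\<lambda>q. moment E f q)"
  unfolding linear_functional_on_def moment_commute[of f] moment_scale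
proof (intro conjI ballI allI refl)
  fix u v assume "u \<in> Pk k (closure E)" "v \<in> Pk k (closure E)"
  then show "moment E (u + v) f = moment E u f + moment E v f"
    by (intro moment_add assms continuous_Pk)
qed

lemma dof_linear:
  assumes d: "d \<in> all_dofs vs Be Bi"
  shows "linear_functional_on (Vkk k E vs) (dof_value E vs d)"
  unfolding linear_functional_on_def
proof (intro conjI ballI allI)
  fix u v c assume u: "u \<in> Vkk k E vs" and v: "v \<in> Vkk k E vs"
  note cu = Vkk_continuous[OF u] and cv = Vkk_continuous[OF v]
  show "dof_value E vs d (u + v) = dof_value E vs d u + dof_value E vs d v"
  proof (cases d)
    case (Vertex i) then show ?thesis by (simp add: plus_fun_def)
  next
    case (EdgeMoment i q)
    then have i: "i < length vs" "q \<in> Be i" using d by (auto simp: all_dofs_def boundary_dofs_def)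
    then have "q \<in> Pk_edge (int k - 2) (vs ! i) (edge_end vs i)" using edge_basis[OF i(1)] span_base unfolding is_basis_def by blast
    then show ?thesis unfolding EdgeMoment dof_value.simps
      by (intro edge_moment_add continuous_on_edge cu cv i(1) Pk_edge_linepath_continuous)
  next
    case (InternalMoment q)
    then have "q \<in> Bi" using d by (auto simp: all_dofs_def boundary_dofs_def)
    then have "q \<in> Pk k (closure E)" using Bi span_base unfolding is_basis_def by blast
    then show ?thesis unfolding InternalMoment dof_value.simps by (intro moment_add cu cv continuous_Pk)
  qed
next
  fix u c show "dof_value E vs d (c *\<^sub>R u) = c * dof_value E vs d u"
    by (cases d) (simp_all add: edge_moment_scale moment_scale, simp add: scaleR_fun_def)
qed

lemma zero_boundary_unique:
  assumes u: "continuous_on (closure E) u" and z: "\<And>x. x \<notin> E \<Longrightarrow> u x = 0"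
    and w: "has_weak_laplacian E u g" and g: "g \<in> Pk k D" "E \<subseteq> D" and m: "moment E u g = 0"
  shows "u x = 0"
proof -
  obtain p where p: "p \<in> poly_fun2 k" "g = restr D p" using g(1) unfolding Pk_def by blast
  show ?thesis
    by (rule energy_uniqueness[OF E_open E_bounded continuous_extended_by_zero[OF E_open u z] z w continuous_poly_fun2[OF p(1)] _ m])
       (use p(2) g(2) in \<open>auto simp: restr_def\<close>)
qed

text \<open>On each edge the boundary degrees of freedom determine a polynomial of degree \<open>k\<close>, so \<open>\<phi>\<close> vanishes
  on the boundary. The internal moments test \<open>\<phi>\<close> with all polynomials of degree \<open>k\<close>, in particular
  with its own Laplacian, and the energy argument applies.\<close>

lemma dofs_injective:
  assumes \<phi>: "\<phi> \<in> Vkk k E vs" and z: "\<forall>d\<in>all_dofs vs Be Bi. dof_value E vs d \<phi> = 0"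
  shows "\<phi> = 0"
proof -
  note c = Vkk_continuous[OF \<phi>]
  obtain g where g: "g \<in> Pk k E" "has_weak_laplacian E \<phi> g" using \<phi> unfolding Vkk_def by blast
  obtain p where p: "p \<in> poly_fun2 k" "g = restr E p" using g(1) unfolding Pk_def by blast
  have vertex: "\<phi> (vs ! i) = 0" if "i < length vs" for i
    using bspec[OF z, of "Vertex i"] that by (simp add: all_dofs_def boundary_dofs_def)
  have edge0: "\<phi> x = 0" if i: "i < length vs" and x: "x \<in> edge vs i" for i x
  proof -
    let ?r = "restr (edge vs i) \<phi>"
    have lin: "linepath (vs ! i) (edge_end vs i) t \<in> edge vs i" if "t \<in> {0..1}" for t
      using that by (simp add: edge_def linepath_mem)
    have ends: "vs ! i \<in> edge vs i" "edge_end vs i \<in> edge vs i" by (simp_all add: edge_def)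
    have "?r = 0"
    proof (rule edge_vanishing[OF edge_nondegenerate[OF i] k edge_basis[OF i] finite_bases(2)[OF i]])
      show "?r \<in> Pk_edge (int k) (vs ! i) (edge_end vs i)" using \<phi> i unfolding Vkk_def by blast
      show "?r (vs ! i) = 0" using vertex[OF i] by (simp add: restr_def)
      show "?r (edge_end vs i) = 0" using vertex edge_end_nth by (simp add: restr_def edge_end_def)
      show "\<forall>q\<in>Be i. edge_moment (vs ! i) (edge_end vs i) ?r q = 0"
      proof
        fix q assume q: "q \<in> Be i"
        have "edge_moment (vs ! i) (edge_end vs i) ?r q = edge_moment (vs ! i) (edge_end vs i) \<phi> q"
          by (rule edge_moment_cong) (use lin in \<open>simp add: restr_def\<close>)
        also have "\<dots> = 0" using bspec[OF z, of "EdgeMoment i q"] i q by (auto simp: all_dofs_def boundary_dofs_def)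
        finally show "edge_moment (vs ! i) (edge_end vs i) ?r q = 0" .
      qed
    qed
    then have "?r x = 0" by (simp add: zero_fun_def)
    then show ?thesis using x by (simp add: restr_def)
  qed
  have out: "\<phi> x = 0" if "x \<notin> E" for x
  proof (cases "x \<in> closure E")
    case True
    then have "x \<in> frontier E" using that frontier_closure by blast
    then show ?thesis using E_frontier edge0 by blast
  next
    case False then show ?thesis using \<phi> by (simp add: Vkk_def)
  qed
  have m: "moment E \<phi> g = 0"
  proof -
    let ?p = "restr (closure E) p"
    have pP: "?p \<in> Pk k (closure E)" using p(1) by (simp add: Pk_def)
    then obtain a where a: "?p = (\<Sum>q\<in>Bi. a q *\<^sub>R q)"
      using Bi span_finite[OF finite_bases(1)] unfolding is_basis_def by auto
    have "moment E \<phi> ?p = (\<Sum>q\<in>Bi. a q * moment E \<phi> q)" unfolding a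
      by (rule linear_functional_on_sum[OF moment_linear_right[OF c] subspace_Pk])
         (use Bi span_base in \<open>auto simp: is_basis_def\<close>)
    also have "\<dots> = 0"
    proof (rule sum.neutral, rule ballI)
      fix q assume "q \<in> Bi"
      then have "moment E \<phi> q = 0" using bspec[OF z, of "InternalMoment q"] by (simp add: all_dofs_def)
      then show "a q * moment E \<phi> q = 0" by simp
    qed
    also have "moment E \<phi> ?p = moment E \<phi> g"
      unfolding moment_commute[of \<phi>] using closure_subset by (intro moment_cong) (auto simp: p(2) restr_def)
    finally show ?thesis .
  qed
  have "\<phi> x = 0" for x by (rule zero_boundary_unique[OF c out g(2) g(1) subset_refl m])
  then show ?thesis by (simp add: fun_eq_iff zero_fun_def)
qed

text \<open>Distinct edges meet only in vertices, where all edge polynomials take the prescribed value.\<close>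

lemma boundary_data_glue:
  fixes p :: "nat \<Rightarrow> real poly" and \<alpha> :: "nat \<Rightarrow> real"
  assumes p: "\<And>i. i < length vs \<Longrightarrow> poly (p i) 0 = \<alpha> i" "\<And>i. i < length vs \<Longrightarrow> poly (p i) 1 = \<alpha> (Suc i mod length vs)"
  shows "\<exists>F. continuous_on (frontier E) F \<and> (\<forall>i<length vs. \<forall>t\<in>{0..1}. F (linepath (vs ! i) (edge_end vs i) t) = poly (p i) t)"
proof -
  define G where "G i x = poly (p i) (edge_param (vs ! i) (edge_end vs i) x)" for i x
  have G: "G i (linepath (vs ! i) (edge_end vs i) t) = poly (p i) t" if "i < length vs" for i t
    using edge_param_linepath[OF edge_nondegenerate[OF that]] by (simp add: G_def)
  have vert: "G i (vs ! m) = \<alpha> m" if i: "i < length vs" and m: "m < length vs" "vs ! m \<in> {vs ! i, edge_end vs i}" for i m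
  proof (cases "vs ! m = vs ! i")
    case True
    then have "m = i" using vs_distinct i m(1) by (simp add: nth_eq_iff_index_eq)
    then show ?thesis using G[OF i, of 0] p(1)[OF i] by (simp add: linepath_def)
  next
    case False
    then have "vs ! m = vs ! (Suc i mod length vs)" using m(2) by (simp add: edge_end_def)
    then have e: "m = Suc i mod length vs" using vs_distinct m(1) edge_end_nth by (simp add: nth_eq_iff_index_eq)
    then have "edge_end vs i = vs ! m" by (simp add: edge_end_def)
    then show ?thesis using G[OF i, of 1] p(2)[OF i] e by (simp add: linepath_def)
  qed
  have agree: "G i x = G j x" if i: "i < length vs" "x \<in> edge vs i" and j: "j < length vs" "x \<in> edge vs j" for i j x
  proof (cases "i = j")
    case False
    have "edge vs i \<inter> edge vs j = {vs ! i, edge_end vs i} \<inter> {vs ! j, edge_end vs j}"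
      using poly i j False by (simp add: polygon_def)
    then have x: "x \<in> {vs ! i, edge_end vs i}" "x \<in> {vs ! j, edge_end vs j}" using i j by blast+
    then obtain m where m: "m < length vs" "x = vs ! m" using i(1) edge_end_nth by (auto simp: edge_end_def)
    then show ?thesis using vert[OF i(1) m(1)] vert[OF j(1) m(1)] x by simp
  qed simp
  define F where "F x = G (SOME i. i < length vs \<and> x \<in> edge vs i) x" for x
  have F: "F x = G i x" if "i < length vs" "x \<in> edge vs i" for i x
    unfolding F_def using someI[of "\<lambda>i. i < length vs \<and> x \<in> edge vs i" i] that agree by blast
  have "continuous_on (\<Union>i\<in>{..<length vs}. edge vs i) F"
  proof (rule continuous_on_closed_Union)
    fix i assume i: "i \<in> {..<length vs}"
    show "closed (edge vs i)" by (simp add: edge_def)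
    have "continuous_on (edge vs i) (G i)" unfolding G_def by (intro continuous_intros continuous_edge_param)
    then show "continuous_on (edge vs i) F" by (rule continuous_on_eq) (use F i in simp)
  qed simp
  then have "continuous_on (frontier E) F" by (simp add: E_frontier)
  moreover have "F (linepath (vs ! i) (edge_end vs i) t) = poly (p i) t" if "i < length vs" "t \<in> {0..1}" for i t
    using F[OF that(1), of "linepath (vs ! i) (edge_end vs i) t"] G[OF that(1)] linepath_mem[OF that(2), of "vs ! i" "edge_end vs i"] that(1) by (simp add: edge_def)
  ultimately show ?thesis by blast
qed

lemma boundary_dofs_realized:
  fixes c :: "dof \<Rightarrow> real"
  shows "\<exists>\<phi>\<in>Vkk k E vs. \<forall>d\<in>boundary_dofs vs Be. dof_value E vs d \<phi> = c d"
proof -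
  have "\<forall>i. \<exists>p. i < length vs \<longrightarrow> degree p \<le> k \<and> poly p 0 = c (Vertex i) \<and> poly p 1 = c (Vertex (Suc i mod length vs)) \<and>
     (\<forall>q\<in>Be i. edge_moment (vs ! i) (edge_end vs i) (edge_fun (vs ! i) (edge_end vs i) p) q = c (EdgeMoment i q))"
  proof
    fix i
    show "\<exists>p. i < length vs \<longrightarrow> degree p \<le> k \<and> poly p 0 = c (Vertex i) \<and> poly p 1 = c (Vertex (Suc i mod length vs)) \<and>
     (\<forall>q\<in>Be i. edge_moment (vs ! i) (edge_end vs i) (edge_fun (vs ! i) (edge_end vs i) p) q = c (EdgeMoment i q))"
    proof (cases "i < length vs")
      case True
      show ?thesis
        using edge_interpolation[OF edge_nondegenerate[OF True] k edge_basis[OF True] finite_bases(2)[OF True],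
            of "c (Vertex i)" "c (Vertex (Suc i mod length vs))" "\<lambda>q. c (EdgeMoment i q)"] by blast
    qed blast
  qed
  from choice[OF this] obtain p where p: "\<forall>i. i < length vs \<longrightarrow> degree (p i) \<le> k \<and> poly (p i) 0 = c (Vertex i) \<and> poly (p i) 1 = c (Vertex (Suc i mod length vs)) \<and>
     (\<forall>q\<in>Be i. edge_moment (vs ! i) (edge_end vs i) (edge_fun (vs ! i) (edge_end vs i) (p i)) q = c (EdgeMoment i q))"
    by (elim exE) (rule that)
  have "\<exists>F. continuous_on (frontier E) F \<and> (\<forall>i<length vs. \<forall>t\<in>{0..1}. F (linepath (vs ! i) (edge_end vs i) t) = poly (p i) t)"
    by (rule boundary_data_glue[of p "\<lambda>i. c (Vertex i)"]) (use p in auto)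
  then obtain F where F: "continuous_on (frontier E) F" "\<forall>i<length vs. \<forall>t\<in>{0..1}. F (linepath (vs ! i) (edge_end vs i) t) = poly (p i) t"
    by (elim exE conjE) (rule that)
  obtain C where C: "C > 0" "C \<le> 1" "exterior_cones C E" using polygon_exterior_cones[OF poly reg] by blast
  obtain u where u: "continuous_on UNIV u" "\<forall>x\<in>frontier E. u x = F x" "has_weak_laplacian E u 0"
    using weak_poisson[OF E_open E_bounded C F(1) subspace_0[OF subspace_poly_fun2]] by (elim exE conjE) (rule that)
  have ul: "u (linepath (vs ! i) (edge_end vs i) t) = poly (p i) t" if "i < length vs" "t \<in> {0..1}" for i t
  proof -
    have "linepath (vs ! i) (edge_end vs i) t \<in> frontier E"
      using that linepath_mem[OF that(2)] unfolding E_frontier edge_def by blast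
    then show ?thesis using u(2) F(2) that by simp
  qed
  define \<phi> where "\<phi> = restr (closure E) u"
  have \<phi>l: "\<phi> (linepath (vs ! i) (edge_end vs i) t) = poly (p i) t" if "i < length vs" "t \<in> {0..1}" for i t
  proof -
    have "linepath (vs ! i) (edge_end vs i) t \<in> closure E"
      using edge_closure[OF that(1)] linepath_mem[OF that(2)] unfolding edge_def by blast
    then show ?thesis using ul[OF that] by (simp add: \<phi>_def restr_def)
  qed
  have "\<phi> \<in> Vkk k E vs" unfolding \<phi>_def
  proof (rule restr_in_Vkk[OF u(1,3) subspace_0[OF subspace_poly_fun2]])
    fix i assume "i < length vs"
    then show "\<exists>q. degree q \<le> k \<and> (\<forall>t\<in>{0..1}. u (linepath (vs ! i) (edge_end vs i) t) = poly q t)"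
      using ul p by blast
  qed
  moreover have "dof_value E vs d \<phi> = c d" if d: "d \<in> boundary_dofs vs Be" for d
  proof (cases d)
    case (Vertex i)
    then have i: "i < length vs" using d by (auto simp: boundary_dofs_def)
    have "\<phi> (vs ! i) = poly (p i) 0" using \<phi>l[OF i, of 0] by (simp add: linepath_def)
    then show ?thesis using p i Vertex by simp
  next
    case (EdgeMoment i q)
    then have i: "i < length vs" "q \<in> Be i" using d by (auto simp: boundary_dofs_def)
    have "edge_moment (vs ! i) (edge_end vs i) \<phi> q = edge_moment (vs ! i) (edge_end vs i) (edge_fun (vs ! i) (edge_end vs i) (p i)) q"
      by (rule edge_moment_cong) (use \<phi>l[OF i(1)] edge_nondegenerate[OF i(1)] in \<open>simp add: edge_fun_linepath\<close>)
    then show ?thesis using p i EdgeMoment by simp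
  next
    case (InternalMoment q) then show ?thesis using d by (auto simp: boundary_dofs_def)
  qed
  ultimately show ?thesis by blast
qed

lemma interior_solution_exists:
  assumes "g \<in> Pk k (closure E)"
  shows "\<exists>u\<in>Vkk k E vs. (\<forall>x. x \<notin> E \<longrightarrow> u x = 0) \<and> has_weak_laplacian E u g"
proof -
  obtain p where p: "p \<in> poly_fun2 k" "g = restr (closure E) p" using assms unfolding Pk_def by blast
  obtain C where C: "C > 0" "C \<le> 1" "exterior_cones C E" using polygon_exterior_cones[OF poly reg] by blast
  obtain u where u: "continuous_on UNIV u" "\<forall>x\<in>frontier E. u x = 0" "has_weak_laplacian E u p"
    using weak_poisson[OF E_open E_bounded C continuous_on_const[of _ 0] p(1)] by (elim exE conjE) (rule that)
  have "restr (closure E) u \<in> Vkk k E vs"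
  proof (rule restr_in_Vkk[OF u(1,3) p(1)])
    fix i assume i: "i < length vs"
    have "u (linepath (vs ! i) (edge_end vs i) t) = poly 0 t" if "t \<in> {0..1}" for t
      using u(2) i linepath_mem[OF that] unfolding E_frontier edge_def by auto
    then show "\<exists>q. degree q \<le> k \<and> (\<forall>t\<in>{0..1}. u (linepath (vs ! i) (edge_end vs i) t) = poly q t)"
      by (intro exI[of _ 0]) simp
  qed
  moreover have "restr (closure E) u x = 0" if "x \<notin> E" for x
    using u(2) that frontier_closure[of x] by (auto simp: restr_def)
  moreover have "has_weak_laplacian E (restr (closure E) u) g"
    by (rule weak_laplacian_cong[OF u(3)]) (use closure_subset in \<open>auto simp: restr_def p(2)\<close>)
  ultimately show ?thesis by blast
qed

text \<open>The unknown is the Laplacian \<open>g\<close>. If all moments of the solution vanish, so does its moment against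
  \<open>g\<close>; then the solution is zero by the energy argument, and so is \<open>g\<close>.\<close>

lemma interior_moments_realized:
  fixes c :: "(plane \<Rightarrow> real) \<Rightarrow> real"
  shows "\<exists>u\<in>Vkk k E vs. (\<forall>x. x \<notin> E \<longrightarrow> u x = 0) \<and> (\<forall>q\<in>Bi. moment E u q = c q)"
proof -
  let ?P = "Pk k (closure E)"
  have sB: "span Bi = ?P" "independent Bi" using Bi by (simp_all add: is_basis_def)
  have "\<forall>g. \<exists>u. g \<in> ?P \<longrightarrow> u \<in> Vkk k E vs \<and> (\<forall>x. x \<notin> E \<longrightarrow> u x = 0) \<and> has_weak_laplacian E u g"
    using interior_solution_exists by blast
  from choice[OF this] obtain U where U: "\<forall>g. g \<in> ?P \<longrightarrow> U g \<in> Vkk k E vs \<and> (\<forall>x. x \<notin> E \<longrightarrow> U g x = 0) \<and> has_weak_laplacian E (U g) g"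
    by (elim exE) (rule that)
  have cU: "continuous_on (closure E) (U g)" if "g \<in> ?P" for g using U that Vkk_continuous by blast
  have lin: "U (a *\<^sub>R g + h) = a *\<^sub>R U g + U h" if g: "g \<in> ?P" and h: "h \<in> ?P" for a g h
  proof -
    have gh: "a *\<^sub>R g + h \<in> ?P" using g h by (intro subspace_add subspace_scale subspace_Pk)
    have w1: "has_weak_laplacian E (\<lambda>x. a * U g x + 1 * U h x) (\<lambda>x. a * g x + 1 * h x)"
      using U g h by (intro weak_laplacian_lincomb[OF E_open E_bounded] cU continuous_Pk) auto
    have w2: "has_weak_laplacian E (\<lambda>x. 1 * U (a *\<^sub>R g + h) x + (-1) * (a * U g x + 1 * U h x)) (\<lambda>x. 1 * (a *\<^sub>R g + h) x + (-1) * (a * g x + 1 * h x))"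
    proof (rule weak_laplacian_lincomb[OF E_open E_bounded _ w1 cU[OF gh] continuous_Pk[OF gh]])
      show "has_weak_laplacian E (U (a *\<^sub>R g + h)) (a *\<^sub>R g + h)" using U gh by blast
    qed (intro continuous_intros cU[OF g] cU[OF h] continuous_Pk[OF g] continuous_Pk[OF h])+
    let ?d = "\<lambda>x. U (a *\<^sub>R g + h) x - (a * U g x + U h x)"
    have w: "has_weak_laplacian E ?d 0"
      by (rule weak_laplacian_cong[OF w2]) (auto simp: plus_fun_def scaleR_fun_def zero_fun_def)
    have "?d x = 0" for x
    proof (rule zero_boundary_unique[OF _ _ w subspace_0[OF subspace_Pk] subset_UNIV])
      show "continuous_on (closure E) ?d" by (intro continuous_intros cU gh g h)
      show "?d x = 0" if "x \<notin> E" for x using U gh g h that by simp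
    qed (simp add: moment_def zero_fun_def)
    then show ?thesis by (simp add: fun_eq_iff plus_fun_def scaleR_fun_def)
  qed
  have U0: "U 0 = 0"
  proof -
    have "U (1 *\<^sub>R 0 + 0) = 1 *\<^sub>R U 0 + U 0" by (rule lin) (rule subspace_0[OF subspace_Pk])+
    then show ?thesis by simp
  qed
  have "\<exists>g\<in>span Bi. \<forall>q\<in>Bi. moment E (U g) q = c q"
  proof (rule span_system[OF finite_bases(1) sB(2) finite_bases(1) refl])
    fix q assume "q \<in> Bi"
    then have q: "q \<in> ?P" using span_base sB(1) by blast
    show "linear_functional_on (span Bi) (\<lambda>g. moment E (U g) q)"
      unfolding linear_functional_on_def sB(1)
    proof (intro conjI ballI allI)
      fix u v assume u: "u \<in> ?P" and v: "v \<in> ?P"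
      have "U (u + v) = U u + U v" using lin[OF u v, of 1] by simp
      then show "moment E (U (u + v)) q = moment E (U u) q + moment E (U v) q"
        using moment_add[OF cU[OF u] cU[OF v] continuous_Pk[OF q]] by simp
    next
      fix a u assume u: "u \<in> ?P"
      have "U (a *\<^sub>R u) = a *\<^sub>R U u" using lin[OF u subspace_0[OF subspace_Pk], of a] U0 by simp
      then show "moment E (U (a *\<^sub>R u)) q = a * moment E (U u) q" by (simp add: moment_scale)
    qed
  next
    fix g assume g: "g \<in> span Bi" and z: "\<forall>q\<in>Bi. moment E (U g) q = 0"
    have gP: "g \<in> ?P" using g sB(1) by simp
    obtain a where a: "g = (\<Sum>q\<in>Bi. a q *\<^sub>R q)" using g span_finite[OF finite_bases(1)] by auto
    have "moment E (U g) (\<Sum>q\<in>Bi. a q *\<^sub>R q) = (\<Sum>q\<in>Bi. a q * moment E (U g) q)"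
      by (rule linear_functional_on_sum[OF moment_linear_right[OF cU[OF gP]] subspace_Pk])
         (use sB(1) span_base in blast)
    then have m: "moment E (U g) g = 0" using z by (simp flip: a)
    have U': "\<And>x. x \<notin> E \<Longrightarrow> U g x = 0" "has_weak_laplacian E (U g) g" using U gP by blast+
    have "U g x = 0" for x by (rule zero_boundary_unique[OF cU[OF gP] U' gP closure_subset m])
    then have w0: "has_weak_laplacian E (\<lambda>_. 0) g" using weak_laplacian_cong[OF U'(2)] by simp
    obtain p where p: "p \<in> poly_fun2 k" "g = restr (closure E) p" using gP unfolding Pk_def by blast
    have wp: "has_weak_laplacian E (\<lambda>_. 0) p"
      by (rule weak_laplacian_cong[OF w0]) (use closure_subset in \<open>auto simp: p(2) restr_def\<close>)
    have cp: "continuous_on UNIV p" by (rule continuous_poly_fun2[OF p(1)])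
    have pE: "p x = 0" if "x \<in> E" for x by (rule weak_laplacian_of_zero[OF E_open wp cp that])
    have "p x = 0" if "x \<in> closure E" for x
      by (rule continuous_constant_on_closure[OF continuous_on_subset[OF cp subset_UNIV] pE that])
    then show "g = 0" by (auto simp: p(2) restr_def fun_eq_iff zero_fun_def)
  qed
  then obtain g where g: "g \<in> ?P" "\<forall>q\<in>Bi. moment E (U g) q = c q" using sB(1) by blast
  then show ?thesis using U by blast
qed

text \<open>A function with the prescribed boundary degrees of freedom is corrected by one that vanishes on the
  boundary and adjusts the internal moments.\<close>

lemma dofs_surjective:
  fixes c :: "dof \<Rightarrow> real"
  shows "\<exists>\<phi>\<in>Vkk k E vs. \<forall>d\<in>all_dofs vs Be Bi. dof_value E vs d \<phi> = c d"
proof -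
  obtain \<phi> where \<phi>: "\<phi> \<in> Vkk k E vs" "\<forall>d\<in>boundary_dofs vs Be. dof_value E vs d \<phi> = c d"
    using boundary_dofs_realized by blast
  obtain u where u: "u \<in> Vkk k E vs" "\<forall>x. x \<notin> E \<longrightarrow> u x = 0" "\<forall>q\<in>Bi. moment E u q = c (InternalMoment q) - moment E \<phi> q"
    using interior_moments_realized[of "\<lambda>q. c (InternalMoment q) - moment E \<phi> q"] by blast
  have out: "u x = 0" if "i < length vs" "x \<in> edge vs i" for i x
  proof -
    have "x \<in> frontier E" using that E_frontier by blast
    then show ?thesis using u(2) frontier_closure by blast
  qed
  have "\<phi> + u \<in> Vkk k E vs" by (rule subspace_add[OF subspace_Vkk \<phi>(1) u(1)])
  moreover have "dof_value E vs d (\<phi> + u) = c d" if d: "d \<in> all_dofs vs Be Bi" for d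
  proof -
    have add: "dof_value E vs d (\<phi> + u) = dof_value E vs d \<phi> + dof_value E vs d u"
      using dof_linear[OF d] \<phi>(1) u(1) unfolding linear_functional_on_def by blast
    show ?thesis
    proof (cases "d \<in> boundary_dofs vs Be")
      case True
      have "dof_value E vs d u = 0"
      proof (cases d)
        case (Vertex i)
        then have "i < length vs" using True by (auto simp: boundary_dofs_def)
        then show ?thesis using out[of i "vs ! i"] Vertex by (simp add: edge_def)
      next
        case (EdgeMoment i q)
        then have i: "i < length vs" using True by (auto simp: boundary_dofs_def)
        have "edge_moment (vs ! i) (edge_end vs i) u q = edge_moment (vs ! i) (edge_end vs i) (0 *\<^sub>R u) q"
        proof (rule edge_moment_cong)
          fix t :: real assume "t \<in> {0..1}"
          from linepath_mem[OF this] have "u (linepath (vs ! i) (edge_end vs i) t) = 0"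
            by (intro out[OF i]) (simp add: edge_def)
          then show "u (linepath (vs ! i) (edge_end vs i) t) = (0 *\<^sub>R u) (linepath (vs ! i) (edge_end vs i) t)"
            by (simp add: scaleR_fun_def)
        qed
        then show ?thesis unfolding edge_moment_scale using EdgeMoment by simp
      next
        case (InternalMoment q) then show ?thesis using True by (auto simp: boundary_dofs_def)
      qed
      then show ?thesis using add \<phi>(2) True by simp
    next
      case False
      then obtain q where "d = InternalMoment q" "q \<in> Bi" using d by (auto simp: all_dofs_def)
      then show ?thesis using add u(3) by simp
    qed
  qed
  ultimately show ?thesis by blast
qed

lemma L2_definite:
  assumes p: "p \<in> Pk k (closure E)" and m: "moment E p p = 0"
  shows "p = 0"
proof -
  note cp = continuous_Pk[OF p]
  have "set_integrable lborel E (\<lambda>x. p x * p x)"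
    by (intro set_integrable_continuous E_open E_bounded continuous_intros cp)
  then have i: "integrable lborel (\<lambda>x. indicator E x * (p x * p x))" by (simp add: set_integrable_def)
  have pE: "p x = 0" if "x \<in> E" for x
  proof -
    have "p x * p x = 0"
    proof (rule integral_zero_imp_zero[OF _ E_open i _ _ that])
      show "continuous_on E (\<lambda>x. p x * p x)"
        by (intro continuous_intros continuous_on_subset[OF cp closure_subset])
      show "(LINT x|lborel. indicator E x * (p x * p x)) = 0"
        using m by (simp add: moment_def set_lebesgue_integral_def)
    qed simp
    then show ?thesis by simp
  qed
  have "p x = 0" for x
  proof (cases "x \<in> closure E")
    case True show ?thesis by (rule continuous_constant_on_closure[OF cp pE True])
  next
    case False then show ?thesis using p by (auto simp: Pk_def restr_def)
  qed
  then show ?thesis by (simp add: fun_eq_iff zero_fun_def)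
qed

lemma moment_determined_by_basis:
  assumes c: "continuous_on (closure E) f" "continuous_on (closure E) g" and e: "\<forall>q\<in>Bi. moment E f q = moment E g q"
    and q: "q \<in> Pk k (closure E)"
  shows "moment E f q = moment E g q"
proof -
  have sB: "span Bi = Pk k (closure E)" using Bi by (simp add: is_basis_def)
  obtain a where a: "q = (\<Sum>x\<in>Bi. a x *\<^sub>R x)" using q span_finite[OF finite_bases(1)] sB by auto
  have "moment E h q = (\<Sum>x\<in>Bi. a x * moment E h x)" if "continuous_on (closure E) h" for h
    unfolding a by (rule linear_functional_on_sum[OF moment_linear_right[OF that] subspace_Pk]) (use sB span_base in blast)
  then show ?thesis using c e by simp
qed

lemma moment_linear_left:
  assumes "q \<in> Pk k (closure E)"
  shows "linear_functional_on (Vkk k E vs) (\<lambda>f. moment E f q)"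
  unfolding linear_functional_on_def moment_scale
proof (intro conjI ballI allI refl)
  fix u v assume "u \<in> Vkk k E vs" "v \<in> Vkk k E vs"
  then show "moment E (u + v) q = moment E u q + moment E v q"
    by (intro moment_add Vkk_continuous continuous_Pk[OF assms])
qed

lemma polynomial_with_moments: "\<exists>p\<in>Pk k (closure E). \<forall>q\<in>Bi. moment E p q = c q"
proof -
  have sB: "span Bi = Pk k (closure E)" "independent Bi" using Bi by (simp_all add: is_basis_def)
  have "\<exists>p\<in>span Bi. \<forall>q\<in>Bi. moment E p q = c q"
  proof (rule span_system[OF finite_bases(1) sB(2) finite_bases(1) refl])
    fix q assume "q \<in> Bi"
    then have "q \<in> Pk k (closure E)" using sB(1) span_base by blast
    from moment_linear_left[OF this] show "linear_functional_on (span Bi) (\<lambda>p. moment E p q)"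
      using Pk_subset_Vkk unfolding sB(1) linear_functional_on_def by blast
  next
    fix p assume p: "p \<in> span Bi" "\<forall>q\<in>Bi. moment E p q = 0"
    have pP: "p \<in> Pk k (closure E)" using p(1) sB(1) by simp
    have "moment E p p = moment E 0 p"
      by (rule moment_determined_by_basis[OF continuous_Pk[OF pP] _ _ pP])
         (use p(2) in \<open>simp_all add: zero_fun_def moment_def\<close>)
    then show "p = 0" by (intro L2_definite[OF pP]) (simp add: zero_fun_def moment_def)
  qed
  then show ?thesis using sB(1) by simp
qed

lemma Pi0_eqI:
  assumes c: "continuous_on (closure E) \<phi>" and p: "p \<in> Pk k (closure E)"
    and e: "\<forall>q\<in>Bi. moment E p q = moment E \<phi> q"
  shows "Pi0 k E \<phi> = p"
proof -
  have diff: "moment E (f - g) q = moment E f q - moment E g q"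
    if "continuous_on (closure E) f" "continuous_on (closure E) g" "q \<in> Pk k (closure E)" for f g q
  proof -
    have "continuous_on (closure E) ((-1) *\<^sub>R g)" using that(2) by (simp add: scaleR_fun_def continuous_on_minus)
    from moment_add[OF that(1) this continuous_Pk[OF that(3)]] show ?thesis by (simp only: moment_scale) simp
  qed
  show ?thesis unfolding Pi0_def
  proof (rule the_equality, intro conjI ballI p)
    fix q assume q: "q \<in> Pk k (closure E)"
    show "moment E (p - \<phi>) q = 0"
      using diff[OF continuous_Pk[OF p] c q] moment_determined_by_basis[OF continuous_Pk[OF p] c e q] by simp
  next
    fix p' assume p': "p' \<in> Pk k (closure E) \<and> (\<forall>q\<in>Pk k (closure E). moment E (p' - \<phi>) q = 0)"
    have d: "p' - p \<in> Pk k (closure E)" using p p' by (intro subspace_diff subspace_Pk) auto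
    have "moment E (p' - p) (p' - p) = moment E p' (p' - p) - moment E p (p' - p)"
      using p p' d by (intro diff continuous_Pk) auto
    also have "moment E p (p' - p) = moment E \<phi> (p' - p)"
      by (rule moment_determined_by_basis[OF continuous_Pk[OF p] c e d])
    also have "moment E p' (p' - p) - moment E \<phi> (p' - p) = moment E (p' - \<phi>) (p' - p)"
      by (rule diff[OF continuous_Pk c d, symmetric]) (use p' in blast)
    also have "\<dots> = 0" using p' d by blast
    finally have "moment E (p' - p) (p' - p) = 0" .
    from L2_definite[OF d this] show "p' = p" by (rule eq_iff_diff_eq_0[THEN iffD2])
  qed
qed

end

section \<open>The serendipity projection\<close>

lemma subspace_RS: "subspace (RS S)"
  by (auto simp: subspace_def RS_def plus_fun_def scaleR_fun_def zero_fun_def)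

lemma dof_vector_in_RS: "dof_vector S \<delta> \<phi> \<in> RS S"
  by (simp add: dof_vector_def RS_def)

definition unit_vector :: "nat \<Rightarrow> nat \<Rightarrow> real" where
  "unit_vector r = (\<lambda>i. if i = r then 1 else 0)"

lemma unit_vector_in_RS: "r \<in> {1..S} \<Longrightarrow> unit_vector r \<in> RS S"
  by (auto simp: unit_vector_def RS_def)

lemma RS_expansion: "u \<in> RS S \<Longrightarrow> u = (\<Sum>r = 1..S. u r *\<^sub>R unit_vector r)"
proof
  fix i assume u: "u \<in> RS S"
  have "(\<Sum>r = 1..S. u r *\<^sub>R unit_vector r) i = (\<Sum>r = 1..S. if r = i then u i else 0)"
    unfolding sum_fun_apply by (intro sum.cong) (auto simp: scaleR_fun_def unit_vector_def)
  then show "u i = (\<Sum>r = 1..S. u r *\<^sub>R unit_vector r) i"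
    using u by (cases "i \<in> {1..S}") (auto simp: RS_def sum.delta')
qed

context
  fixes V :: "(plane \<Rightarrow> real) set" and S :: nat and \<delta> :: "nat \<Rightarrow> (plane \<Rightarrow> real) \<Rightarrow> real"
  assumes V: "subspace V" and dofs_linear: "\<forall>r\<in>{1..S}. linear_functional_on V (\<delta> r)"
begin

lemma dof_functional_linear: "r \<in> {1..S} \<Longrightarrow> linear_functional_on V (\<delta> r)"
  using dofs_linear by blast

lemma dof_vector_linear:
  "u \<in> V \<Longrightarrow> v \<in> V \<Longrightarrow> dof_vector S \<delta> (u + v) = dof_vector S \<delta> u + dof_vector S \<delta> v"
  "u \<in> V \<Longrightarrow> dof_vector S \<delta> (c *\<^sub>R u) = c *\<^sub>R dof_vector S \<delta> u"
  using dof_functional_linear by (auto simp: fun_eq_iff dof_vector_def plus_fun_def scaleR_fun_def linear_functional_on_def)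

lemma dof_vector_diff:
  assumes "u \<in> V" "v \<in> V" shows "dof_vector S \<delta> (u - v) = dof_vector S \<delta> u - dof_vector S \<delta> v"
  using dof_vector_linear(1)[OF assms(1), of "(-1) *\<^sub>R v"] dof_vector_linear(2)[OF assms(2), of "-1"]
    subspace_scale[OF V assms(2), of "-1"] by simp

text \<open>The functions dual to the \<open>S\<close> degrees of freedom form a basis.\<close>

lemma dim_of_unisolvent:
  assumes bij: "bij_betw (dof_vector S \<delta>) V (RS S)"
  shows "dim V = S"
proof -
  let ?D = "dof_vector S \<delta>"
  have inj: "u = v" if "u \<in> V" "v \<in> V" "?D u = ?D v" for u v
    using bij that by (meson bij_betw_def inj_on_def)
  have "\<forall>r. \<exists>g. r \<in> {1..S} \<longrightarrow> g \<in> V \<and> ?D g = unit_vector r"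
    using bij unit_vector_in_RS[of _ S] unfolding bij_betw_def by (metis imageE)
  from choice[OF this] obtain g where g: "\<forall>r. r \<in> {1..S} \<longrightarrow> g r \<in> V \<and> ?D (g r) = unit_vector r" by (elim exE) (rule that)
  have expand: "?D (\<Sum>r = 1..S. a r *\<^sub>R g r) i = (if i \<in> {1..S} then a i else 0)" for a i
  proof (cases "i \<in> {1..S}")
    case True
    have "\<delta> i (\<Sum>r = 1..S. a r *\<^sub>R g r) = (\<Sum>r = 1..S. a r * \<delta> i (g r))"
      by (rule linear_functional_on_sum[OF dof_functional_linear[OF True] V]) (use g in blast)
    also have "\<dots> = (\<Sum>r = 1..S. if r = i then a i else 0)"
    proof (rule sum.cong[OF refl])
      fix r assume "r \<in> {1..S}"
      then have "?D (g r) i = unit_vector r i" using g by simp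
      then show "a r * \<delta> i (g r) = (if r = i then a i else 0)" using True by (auto simp: dof_vector_def unit_vector_def)
    qed
    finally show ?thesis using True by (simp add: dof_vector_def)
  qed (auto simp: dof_vector_def)
  have injg: "inj_on g {1..S}"
  proof (rule inj_onI)
    fix x y assume xy: "x \<in> {1..S}" "y \<in> {1..S}" "g x = g y"
    then have "unit_vector x = unit_vector y" using g by metis
    then have "unit_vector x x = unit_vector y x" by simp
    then show "x = y" by (simp add: unit_vector_def split: if_splits)
  qed
  have "independent (g ` {1..S})"
    unfolding dependent_finite[OF finite_imageI[OF finite_atLeastAtMost]]
  proof
    assume "\<exists>u. (\<exists>v\<in>g ` {1..S}. u v \<noteq> 0) \<and> (\<Sum>v\<in>g ` {1..S}. u v *\<^sub>R v) = 0"
    then obtain u r where u: "r \<in> {1..S}" "u (g r) \<noteq> 0" "(\<Sum>v\<in>g ` {1..S}. u v *\<^sub>R v) = 0" by blast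
    have "(\<Sum>r = 1..S. u (g r) *\<^sub>R g r) = 0" using u(3) sum.reindex[OF injg, of "\<lambda>v. u v *\<^sub>R v"] by (simp add: o_def)
    then have "?D 0 r = u (g r)" using expand[of "\<lambda>r. u (g r)" r] u(1) by simp
    moreover have "?D 0 = 0" using dof_vector_linear(2)[OF subspace_0[OF V], of 0] by simp
    ultimately show False using u(2) by (simp add: zero_fun_def)
  qed
  moreover have "span (g ` {1..S}) = V"
  proof
    show "span (g ` {1..S}) \<subseteq> V" by (rule span_minimal[OF _ V]) (use g in auto)
    show "V \<subseteq> span (g ` {1..S})"
    proof
      fix v assume v: "v \<in> V"
      have "v = (\<Sum>r = 1..S. \<delta> r v *\<^sub>R g r)"
      proof (rule inj[OF v])
        show "(\<Sum>r = 1..S. \<delta> r v *\<^sub>R g r) \<in> V" using g by (intro subspace_sum[OF V] subspace_scale[OF V]) auto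
        show "?D v = ?D (\<Sum>r = 1..S. \<delta> r v *\<^sub>R g r)" by (rule ext) (simp only: expand, simp add: dof_vector_def)
      qed
      also have "\<dots> \<in> span (g ` {1..S})" by (intro span_sum span_scale span_base) auto
      finally show "v \<in> span (g ` {1..S})" .
    qed
  qed
  ultimately have "dim V = card (g ` {1..S})" by (metis dim_eq_card span_span)
  then show ?thesis using card_image[OF injg] by simp
qed

context
  fixes k :: nat and E :: "plane set" and B :: "(plane \<Rightarrow> real) set" and b :: "(nat \<Rightarrow> real) \<Rightarrow> (nat \<Rightarrow> real) \<Rightarrow> real"
  assumes PV: "Pk k (closure E) \<subseteq> V" and B: "is_basis B (Pk k (closure E))" and fB: "finite B"
    and ps: "property_S k E S \<delta>" and spd: "spd_form S b"
begin

private abbreviation (input) "P \<equiv> Pk k (closure E)"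
private abbreviation (input) "D \<equiv> dof_vector S \<delta>"

lemma form_linear: "w \<in> RS S \<Longrightarrow> linear_functional_on (RS S) (\<lambda>u. b u w)"
  and form_sym: "u \<in> RS S \<Longrightarrow> w \<in> RS S \<Longrightarrow> b u w = b w u"
  and form_pos: "u \<in> RS S \<Longrightarrow> b u u = 0 \<Longrightarrow> u = 0"
proof -
  note spd' = spd[unfolded spd_form_def]
  show "w \<in> RS S \<Longrightarrow> linear_functional_on (RS S) (\<lambda>u. b u w)" by (rule bspec[OF conjunct1[OF spd']])
  show "u \<in> RS S \<Longrightarrow> w \<in> RS S \<Longrightarrow> b u w = b w u" by (rule bspec[OF bspec[OF conjunct1[OF conjunct2[OF spd']]]])
  show "u = 0" if "u \<in> RS S" "b u u = 0"
    using bspec[OF conjunct2[OF conjunct2[OF spd']] that(1)] that(2) by (cases "u = 0") simp_all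
qed

lemma form_diff:
  assumes "u \<in> RS S" "v \<in> RS S" "w \<in> RS S" shows "b (u - v) w = b u w - b v w"
proof -
  have "b (u + (-1) *\<^sub>R v) w = b u w + b ((-1) *\<^sub>R v) w" "b ((-1) *\<^sub>R v) w = -1 * b v w"
    using form_linear[OF assms(3)] assms(1,2) subspace_scale[OF subspace_RS assms(2), of "-1"]
    unfolding linear_functional_on_def by blast+
  then show ?thesis by simp
qed

lemma form_linear_P:
  assumes "w \<in> RS S" shows "linear_functional_on P (\<lambda>p. b (D p) w)"
  unfolding linear_functional_on_def
proof (intro conjI ballI allI)
  note lin_b = form_linear[OF assms, unfolded linear_functional_on_def]
  fix u v assume "u \<in> P" "v \<in> P"
  then have "u \<in> V" "v \<in> V" using PV by blast+
  then show "b (D (u + v)) w = b (D u) w + b (D v) w"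
    unfolding dof_vector_linear(1)[OF \<open>u \<in> V\<close> \<open>v \<in> V\<close>]
    by (intro bspec[OF bspec[OF conjunct1[OF lin_b]]] dof_vector_in_RS)
next
  note lin_b = form_linear[OF assms, unfolded linear_functional_on_def]
  fix c u assume "u \<in> P"
  then have "u \<in> V" using PV by blast
  then show "b (D (c *\<^sub>R u)) w = c * b (D u) w"
    unfolding dof_vector_linear(2)[OF \<open>u \<in> V\<close>]
    by (intro bspec[OF spec[OF conjunct2[OF lin_b]]] dof_vector_in_RS)
qed

lemma dof_vector_definite_on_P:
  assumes "p \<in> P" "D p = 0" shows "p = 0"
proof -
  have "\<delta> r p = 0" if "r \<in> {1..S}" for r
    using fun_cong[OF assms(2), of r] that by (simp add: dof_vector_def zero_fun_def)
  then show ?thesis using ps assms(1) unfolding property_S_def by simp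
qed

lemma orthogonal_on_basis:
  assumes w: "w \<in> RS S" and z: "\<forall>q\<in>B. b w (D q) = 0" and q: "q \<in> P"
  shows "b w (D q) = 0"
proof -
  have sB: "span B = P" using B by (simp add: is_basis_def)
  obtain a where a: "q = (\<Sum>x\<in>B. a x *\<^sub>R x)" using q span_finite[OF fB] sB by auto
  have BP: "x \<in> P" if "x \<in> B" for x using that sB span_base by blast
  have "b (D q) w = (\<Sum>x\<in>B. a x * b (D x) w)"
    unfolding a by (rule linear_functional_on_sum[OF form_linear_P[OF w] subspace_Pk BP])
  also have "\<dots> = 0" using z form_sym[OF dof_vector_in_RS w] by simp
  finally show ?thesis using form_sym[OF dof_vector_in_RS w] by simp
qed

text \<open>These are the normal equations of a least squares problem; \<open>property_S\<close> makes them uniquely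
  solvable, since only the zero polynomial has a vanishing vector of degrees of freedom.\<close>

lemma projection_exists:
  assumes w: "w \<in> RS S"
  shows "\<exists>p\<in>P. \<forall>q\<in>P. b (D p - w) (D q) = 0"
proof -
  have sB: "span B = P" "independent B" using B by (simp_all add: is_basis_def)
  have "\<exists>p\<in>span B. \<forall>q\<in>B. b (D p) (D q) = b w (D q)"
  proof (rule span_system[OF fB sB(2) fB refl])
    show "linear_functional_on (span B) (\<lambda>p. b (D p) (D q))" for q
      unfolding sB(1) by (rule form_linear_P[OF dof_vector_in_RS])
    fix p assume p: "p \<in> span B" "\<forall>q\<in>B. b (D p) (D q) = 0"
    then have "b (D p) (D p) = 0" using orthogonal_on_basis[OF dof_vector_in_RS p(2)] sB(1) by blast
    then have "D p = 0" by (rule form_pos[OF dof_vector_in_RS])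
    then show "p = 0" using dof_vector_definite_on_P p(1) sB(1) by blast
  qed
  then obtain p where p: "p \<in> P" "\<forall>q\<in>B. b (D p) (D q) = b w (D q)" using sB(1) by blast
  have Dw: "D p - w \<in> RS S" by (intro subspace_diff[OF subspace_RS] dof_vector_in_RS w)
  have "\<forall>q\<in>B. b (D p - w) (D q) = 0" using p(2) form_diff[OF dof_vector_in_RS w dof_vector_in_RS] by simp
  then show ?thesis using orthogonal_on_basis[OF Dw] p(1) by blast
qed

lemma PiS_eqI:
  assumes \<phi>: "\<phi> \<in> V" and p: "p \<in> P" and o: "\<forall>q\<in>P. b (D p - D \<phi>) (D q) = 0"
  shows "PiS k E S \<delta> b \<phi> = p"
  unfolding PiS_def
proof (rule the_equality, intro conjI ballI p)
  have PV': "x \<in> V" if "x \<in> P" for x using that PV by blast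
  show "b (D (p - \<phi>)) (D q) = 0" if "q \<in> P" for q
    using o that dof_vector_diff[OF PV'[OF p] \<phi>] by simp
  fix p' assume p': "p' \<in> P \<and> (\<forall>q\<in>P. b (D (p' - \<phi>)) (D q) = 0)"
  have d: "p' - p \<in> P" using p p' by (intro subspace_diff subspace_Pk) auto
  have o': "b (D p' - D \<phi>) (D (p' - p)) = 0"
    using p' d dof_vector_diff[OF PV'[OF conjunct1[OF p']] \<phi>] by simp
  have o'': "b (D p - D \<phi>) (D (p' - p)) = 0" using o d by blast
  have m: "D p' - D \<phi> \<in> RS S" "D p - D \<phi> \<in> RS S" by (intro subspace_diff[OF subspace_RS] dof_vector_in_RS)+
  have "D (p' - p) = (D p' - D \<phi>) - (D p - D \<phi>)" using dof_vector_diff[OF PV' PV'] p p' by simp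
  then have "b (D (p' - p)) (D (p' - p)) = 0"
    using form_diff[OF m dof_vector_in_RS[of S \<delta> "p' - p"]] o' o'' by simp
  then have "D (p' - p) = 0" by (rule form_pos[OF dof_vector_in_RS])
  then show "p' = p" using dof_vector_definite_on_P[OF d] by simp
qed

lemma PiS_cong: "\<phi> \<in> V \<Longrightarrow> \<psi> \<in> V \<Longrightarrow> D \<phi> = D \<psi> \<Longrightarrow> PiS k E S \<delta> b \<phi> = PiS k E S \<delta> b \<psi>"
  using projection_exists[OF dof_vector_in_RS[of S \<delta> \<psi>]] PiS_eqI by metis

lemma PiS_in_P: "\<phi> \<in> V \<Longrightarrow> PiS k E S \<delta> b \<phi> \<in> P"
  using projection_exists[OF dof_vector_in_RS[of S \<delta> \<phi>]] PiS_eqI by metis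

lemma PiS_id:
  assumes p: "p \<in> P" shows "PiS k E S \<delta> b p = p"
proof (rule PiS_eqI[OF _ p])
  have "b (0 *\<^sub>R 0) w = 0 * b 0 w" if "w \<in> RS S" for w
    using form_linear[OF that] subspace_0[OF subspace_RS] unfolding linear_functional_on_def by blast
  then show "\<forall>q\<in>P. b (D p - D p) (D q) = 0" using dof_vector_in_RS by simp
qed (use p PV in blast)

text \<open>The coefficients are the projections of the unit vectors.\<close>

lemma PiS_formula:
  "\<exists>l. (\<forall>r\<in>{1..S}. l r \<in> P) \<and> (\<forall>\<phi>\<in>V. PiS k E S \<delta> b \<phi> = (\<Sum>r = 1..S. \<delta> r \<phi> *\<^sub>R l r))"
proof -
  have "\<forall>r. \<exists>p. r \<in> {1..S} \<longrightarrow> p \<in> P \<and> (\<forall>q\<in>P. b (D p - unit_vector r) (D q) = 0)"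
    using projection_exists[OF unit_vector_in_RS] by blast
  from choice[OF this] obtain l where l: "\<forall>r. r \<in> {1..S} \<longrightarrow> l r \<in> P \<and> (\<forall>q\<in>P. b (D (l r) - unit_vector r) (D q) = 0)"
    by (elim exE) (rule that)
  have "PiS k E S \<delta> b \<phi> = (\<Sum>r = 1..S. \<delta> r \<phi> *\<^sub>R l r)" if \<phi>: "\<phi> \<in> V" for \<phi>
  proof (rule PiS_eqI[OF \<phi>])
    show "(\<Sum>r = 1..S. \<delta> r \<phi> *\<^sub>R l r) \<in> P"
      using l by (intro subspace_sum[OF subspace_Pk] subspace_scale[OF subspace_Pk]) auto
    have lV: "l r \<in> V" if "r \<in> {1..S}" for r using l that PV by blast
    have Dsum: "D (\<Sum>r = 1..S. \<delta> r \<phi> *\<^sub>R l r) = (\<Sum>r = 1..S. \<delta> r \<phi> *\<^sub>R D (l r))"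
    proof
      fix i show "D (\<Sum>r = 1..S. \<delta> r \<phi> *\<^sub>R l r) i = (\<Sum>r = 1..S. \<delta> r \<phi> *\<^sub>R D (l r)) i"
      proof (cases "i \<in> {1..S}")
        case True
        have "\<delta> i (\<Sum>r = 1..S. \<delta> r \<phi> *\<^sub>R l r) = (\<Sum>r = 1..S. \<delta> r \<phi> * \<delta> i (l r))"
          by (rule linear_functional_on_sum[OF dof_functional_linear[OF True] V lV])
        then show ?thesis using True by (simp add: sum_fun_apply dof_vector_def scaleR_fun_def)
      qed (auto simp: sum_fun_apply dof_vector_def scaleR_fun_def)
    qed
    have "D \<phi> = (\<Sum>r = 1..S. D \<phi> r *\<^sub>R unit_vector r)" by (rule RS_expansion[OF dof_vector_in_RS])
    also have "\<dots> = (\<Sum>r = 1..S. \<delta> r \<phi> *\<^sub>R unit_vector r)" by (intro sum.cong) (auto simp: dof_vector_def)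
    finally have diff: "D (\<Sum>r = 1..S. \<delta> r \<phi> *\<^sub>R l r) - D \<phi> = (\<Sum>r = 1..S. \<delta> r \<phi> *\<^sub>R (D (l r) - unit_vector r))"
      unfolding Dsum by (simp add: scaleR_diff_right sum_subtractf)
    show "\<forall>q\<in>P. b (D (\<Sum>r = 1..S. \<delta> r \<phi> *\<^sub>R l r) - D \<phi>) (D q) = 0"
    proof
      fix q assume q: "q \<in> P"
      have "b (\<Sum>r = 1..S. \<delta> r \<phi> *\<^sub>R (D (l r) - unit_vector r)) (D q) = (\<Sum>r = 1..S. \<delta> r \<phi> * b (D (l r) - unit_vector r) (D q))"
        by (rule linear_functional_on_sum[OF form_linear[OF dof_vector_in_RS] subspace_RS])
           (intro subspace_diff[OF subspace_RS] dof_vector_in_RS unit_vector_in_RS)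
      also have "\<dots> = 0" using l q by (intro sum.neutral) auto
      finally show "b (D (\<Sum>r = 1..S. \<delta> r \<phi> *\<^sub>R l r) - D \<phi>) (D q) = 0" unfolding diff .
    qed
  qed
  then show ?thesis using l by blast
qed

end

end

section \<open>The serendipity space\<close>

theorem mainTheorem5:
  fixes k S :: nat and \<rho>\<^sub>0 :: real
    and E :: "plane set" and vs :: "plane list"
    and Be :: "nat \<Rightarrow> (plane \<Rightarrow> real) set" and Bi :: "(plane \<Rightarrow> real) set"
    and \<sigma> :: "nat \<Rightarrow> dof" and \<delta> :: "nat \<Rightarrow> (plane \<Rightarrow> real) \<Rightarrow> real"
    and b :: "(nat \<Rightarrow> real) \<Rightarrow> (nat \<Rightarrow> real) \<Rightarrow> real"
  assumes "1 \<le> k"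
    and "polygon E vs" and "shape_regular \<rho>\<^sub>0 E vs"
    and "(k + 1) * (k + 2) div 2 \<le> S" and "S \<le> num_dofs k vs"
    and "dof_ordering k E vs Be Bi \<sigma> \<delta>"
    and "boundary_dofs vs Be \<subseteq> \<sigma> ` {1..S}"
    and "property_S k E S \<delta>"
    and "spd_form S b"
  shows "(subspace (VS k E vs S \<delta> b) \<and> dim (VS k E vs S \<delta> b) = S) \<and>
         unisolvent S \<delta> (VS k E vs S \<delta> b) \<and>
         Pk k (closure E) \<subseteq> VS k E vs S \<delta> b \<and>
         Pi0_computable k E vs Bi \<sigma> S \<delta> b"
proof -
  let ?N = "num_dofs k vs" and ?V = "Vkk k E vs" and ?P = "Pk k (closure E)" and ?W = "VS k E vs S \<delta> b"
  let ?D = "dof_vector S \<delta>" and ?\<Pi> = "PiS k E S \<delta> b"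
  have Be: "\<forall>i<length vs. is_basis (Be i) (Pk_edge (int k - 2) (vs ! i) (edge_end vs i))"
    and Bi: "is_basis Bi ?P" and bij: "bij_betw \<sigma> {1..?N} (all_dofs vs Be Bi)"
    and \<delta>: "\<And>r. r \<in> {1..?N} \<Longrightarrow> \<delta> r = dof_value E vs (\<sigma> r)"
    using assms(6) unfolding dof_ordering_def by blast+
  have fin: "finite (all_dofs vs Be Bi)" using bij bij_betw_finite by blast
  note setting = assms(1-3) Be Bi fin
  have fB: "finite Bi" by (rule finite_bases(1)[OF setting])
  have V: "subspace ?V" by (rule subspace_Vkk[OF setting])
  have PV: "?P \<subseteq> ?V" by (rule Pk_subset_Vkk[OF setting])
  have linN: "linear_functional_on ?V (\<delta> r)" if "r \<in> {1..?N}" for r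
    unfolding \<delta>[OF that] by (rule dof_linear[OF setting]) (rule bspec[OF bij_betwE[OF bij] that])
  have lin: "\<forall>r\<in>{1..S}. linear_functional_on ?V (\<delta> r)" using linN assms(5) by simp
  note proj = V lin PV Bi fB assms(8,9)
  have \<Pi>P: "?\<Pi> \<phi> \<in> ?P" if "\<phi> \<in> ?V" for \<phi> by (rule PiS_in_P[OF proj that])
  obtain l where l: "\<forall>r\<in>{1..S}. l r \<in> ?P" "\<forall>\<phi>\<in>?V. ?\<Pi> \<phi> = (\<Sum>r = 1..S. \<delta> r \<phi> *\<^sub>R l r)"
    using PiS_formula[OF proj] by (elim exE conjE) (rule that)
  have \<delta>add: "\<delta> r (u + c *\<^sub>R v) = \<delta> r u + c * \<delta> r v" if "r \<in> {1..?N}" "u \<in> ?V" "v \<in> ?V" for r u v c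
    using linN[OF that(1)] that subspace_scale[OF V that(3)] unfolding linear_functional_on_def by simp
  have \<Pi>add: "?\<Pi> (u + c *\<^sub>R v) = ?\<Pi> u + c *\<^sub>R ?\<Pi> v" if u: "u \<in> ?V" and v: "v \<in> ?V" for u v c
  proof -
    have "u + c *\<^sub>R v \<in> ?V" using u v by (intro subspace_add subspace_scale V)
    then have "?\<Pi> (u + c *\<^sub>R v) = (\<Sum>r = 1..S. \<delta> r (u + c *\<^sub>R v) *\<^sub>R l r)" using l(2) by blast
    also have "\<dots> = (\<Sum>r = 1..S. \<delta> r u *\<^sub>R l r + c *\<^sub>R (\<delta> r v *\<^sub>R l r))"
      using \<delta>add[OF _ u v] assms(5) by (intro sum.cong) (auto simp: scaleR_add_left)
    also have "\<dots> = ?\<Pi> u + c *\<^sub>R ?\<Pi> v" using l(2) u v by (simp add: sum.distrib scaleR_sum_right)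
    finally show ?thesis .
  qed
  have WV: "?W \<subseteq> ?V" by (auto simp: VS_def)
  have PW: "?P \<subseteq> ?W" using PV PiS_id[OF proj] by (auto simp: VS_def)
  have W: "subspace ?W"
  proof -
    have step: "u + c *\<^sub>R v \<in> ?W" if u: "u \<in> ?W" and v: "v \<in> ?W" for u v c
    proof -
      have uv: "u \<in> ?V" "v \<in> ?V" using u v WV by blast+
      have "u + c *\<^sub>R v \<in> ?V" using uv by (intro subspace_add subspace_scale V)
      moreover have "\<delta> r (u + c *\<^sub>R v) = \<delta> r (?\<Pi> (u + c *\<^sub>R v))" if r: "r \<in> {S + 1..?N}" for r
      proof -
        have rN: "r \<in> {1..?N}" using r by simp
        have "?\<Pi> u \<in> ?V" "?\<Pi> v \<in> ?V" using \<Pi>P uv PV by blast+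
        then show ?thesis using u v r \<delta>add[OF rN uv] \<delta>add[OF rN, of "?\<Pi> u" "?\<Pi> v"] \<Pi>add[OF uv] by (simp add: VS_def)
      qed
      ultimately show ?thesis by (simp add: VS_def)
    qed
    have 0: "0 \<in> ?W" using PW subspace_0[OF subspace_Pk] by blast
    show ?thesis unfolding subspace_def using step[of _ _ 1] step[OF 0] 0 by auto
  qed
  (* Equal values of the first S degrees of freedom give equal polynomials, hence equal values of
     the remaining ones, and the full set is injective. *)
  have inj: "u = v" if u: "u \<in> ?W" and v: "v \<in> ?W" and D: "?D u = ?D v" for u v
  proof -
    have uv: "u \<in> ?V" "v \<in> ?V" using u v WV by blast+
    have \<Pi>: "?\<Pi> u = ?\<Pi> v" by (rule PiS_cong[OF proj uv D])
    have same: "\<delta> r u = \<delta> r v" if r: "r \<in> {1..?N}" for r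
    proof (cases "r \<in> {1..S}")
      case True then show ?thesis using fun_cong[OF D, of r] by (simp add: dof_vector_def)
    next
      case False
      then have "r \<in> {S + 1..?N}" using r by auto
      then show ?thesis using u v \<Pi> by (simp add: VS_def)
    qed
    have uv': "u + (-1) *\<^sub>R v \<in> ?V" using uv by (intro subspace_add subspace_scale V)
    have "\<forall>d\<in>all_dofs vs Be Bi. dof_value E vs d (u + (-1) *\<^sub>R v) = 0"
    proof
      fix d assume "d \<in> all_dofs vs Be Bi"
      then obtain r where r: "r \<in> {1..?N}" "d = \<sigma> r" using bij_betw_imp_surj_on[OF bij] by blast
      then show "dof_value E vs d (u + (-1) *\<^sub>R v) = 0" using \<delta>add[OF r(1) uv, of "-1"] same[OF r(1)] \<delta>[OF r(1)] by simp
    qed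
    then have "u + (-1) *\<^sub>R v = 0" by (rule dofs_injective[OF setting uv'])
    then show "u = v" by simp
  qed
  have real: "\<exists>\<phi>\<in>?V. \<forall>r\<in>{1..?N}. \<delta> r \<phi> = c r" for c :: "nat \<Rightarrow> real"
  proof -
    obtain \<phi> where \<phi>: "\<phi> \<in> ?V" "\<forall>d\<in>all_dofs vs Be Bi. dof_value E vs d \<phi> = c (the_inv_into {1..?N} \<sigma> d)"
      using dofs_surjective[OF setting, of "\<lambda>d. c (the_inv_into {1..?N} \<sigma> d)"] by blast
    have "\<delta> r \<phi> = c r" if r: "r \<in> {1..?N}" for r
    proof -
      have "\<sigma> r \<in> all_dofs vs Be Bi" "the_inv_into {1..?N} \<sigma> (\<sigma> r) = r"
        using bij_betwE[OF bij] the_inv_into_f_f[OF bij_betw_imp_inj_on[OF bij] r] r by blast+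
      then show ?thesis using \<phi>(2) \<delta>[OF r] by simp
    qed
    then show ?thesis using \<phi>(1) by blast
  qed
  (* The polynomial depends only on the first S values, so it can be computed from an arbitrary
     function phi1 with these values before the others are prescribed. *)
  have surj: "\<exists>\<phi>\<in>?W. ?D \<phi> = u" if u: "u \<in> RS S" for u
  proof -
    obtain \<phi>1 where \<phi>1: "\<phi>1 \<in> ?V" "\<forall>r\<in>{1..?N}. \<delta> r \<phi>1 = u r" using real[of u] by blast
    obtain \<phi> where \<phi>: "\<phi> \<in> ?V" "\<forall>r\<in>{1..?N}. \<delta> r \<phi> = (if r \<in> {1..S} then u r else \<delta> r (?\<Pi> \<phi>1))"
      using real[of "\<lambda>r. if r \<in> {1..S} then u r else \<delta> r (?\<Pi> \<phi>1)"] by blast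
    have D: "?D \<phi> = u" "?D \<phi>1 = u"
      using u \<phi>(2) \<phi>1(2) assms(5) by (auto simp: dof_vector_def RS_def fun_eq_iff)
    have "?\<Pi> \<phi> = ?\<Pi> \<phi>1" by (rule PiS_cong[OF proj \<phi>(1) \<phi>1(1)]) (simp add: D)
    then have "\<phi> \<in> ?W" using \<phi> by (simp add: VS_def)
    then show ?thesis using D(1) by blast
  qed
  have linW: "\<forall>r\<in>{1..S}. linear_functional_on ?W (\<delta> r)"
    using lin WV unfolding linear_functional_on_def by blast
  have bijW: "bij_betw ?D ?W (RS S)"
    unfolding bij_betw_def
  proof
    show "inj_on ?D ?W" using inj by (intro inj_onI) blast
    show "?D ` ?W = RS S" using surj dof_vector_in_RS by blast
  qed
  have uni: "unisolvent S \<delta> ?W" unfolding unisolvent_def using linW bijW by blast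
  have dimW: "dim ?W = S" by (rule dim_of_unisolvent[OF W linW bijW])

  have alt: "InternalMoment q \<in> \<sigma> ` {1..S} \<or> (\<forall>\<phi>\<in>?W. moment E \<phi> q = moment E (?\<Pi> \<phi>) q)" if q: "q \<in> Bi" for q
  proof -
    have "InternalMoment q \<in> all_dofs vs Be Bi" using q by (simp add: all_dofs_def)
    then obtain s where s: "s \<in> {1..?N}" "InternalMoment q = \<sigma> s" using bij_betw_imp_surj_on[OF bij] by blast
    then have \<delta>s: "\<delta> s \<phi> = moment E \<phi> q" for \<phi> using \<delta>[OF s(1)] by (metis dof_value.simps(3))
    show ?thesis
    proof (cases "s \<in> {1..S}")
      case True then show ?thesis using s(2) by blast
    next
      case False
      then have "s \<in> {S + 1..?N}" using s(1) by auto
      then show ?thesis by (simp add: VS_def flip: \<delta>s)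
    qed
  qed
  have BP: "q \<in> ?P" if "q \<in> Bi" for q using that Bi span_base unfolding is_basis_def by blast
  have lV: "l r \<in> ?V" if "r \<in> {1..S}" for r using l(1) that PV by blast
  (* The moments against the basis as linear forms in the first S degrees of freedom. *)
  have "\<forall>q. \<exists>a :: nat \<Rightarrow> real. q \<in> Bi \<longrightarrow> (\<forall>\<phi>\<in>?W. moment E \<phi> q = (\<Sum>r = 1..S. a r * \<delta> r \<phi>))"
  proof
    fix q
    show "\<exists>a :: nat \<Rightarrow> real. q \<in> Bi \<longrightarrow> (\<forall>\<phi>\<in>?W. moment E \<phi> q = (\<Sum>r = 1..S. a r * \<delta> r \<phi>))"
    proof (cases "q \<in> Bi")
      case q: True
      from alt[OF q] show ?thesis
      proof
        assume "InternalMoment q \<in> \<sigma> ` {1..S}"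
        then obtain s where s: "s \<in> {1..S}" "InternalMoment q = \<sigma> s" by blast
        have "\<delta> s \<phi> = moment E \<phi> q" for \<phi> using \<delta>[of s] s assms(5) by (metis dof_value.simps(3) atLeastAtMost_iff order_trans)
        moreover have "(\<Sum>r = 1..S. (if r = s then 1 else 0) * \<delta> r \<phi>) = \<delta> s \<phi>" for \<phi>
          using s(1) by (simp add: if_distrib[of "\<lambda>x. x * _"] sum.delta cong: if_cong)
        ultimately show ?thesis by (intro exI[of _ "\<lambda>r. if r = s then 1 else 0"]) simp
      next
        assume m: "\<forall>\<phi>\<in>?W. moment E \<phi> q = moment E (?\<Pi> \<phi>) q"
        have "moment E \<phi> q = (\<Sum>r = 1..S. moment E (l r) q * \<delta> r \<phi>)" if "\<phi> \<in> ?W" for \<phi>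
        proof -
          have "\<phi> \<in> ?V" using that WV by blast
          then have "moment E (?\<Pi> \<phi>) q = moment E (\<Sum>r = 1..S. \<delta> r \<phi> *\<^sub>R l r) q" using l(2) by simp
          also have "\<dots> = (\<Sum>r = 1..S. \<delta> r \<phi> * moment E (l r) q)"
            by (rule linear_functional_on_sum[OF moment_linear_left[OF setting BP[OF q]] V lV])
          finally show ?thesis using m that by (simp add: mult.commute)
        qed
        then show ?thesis by (intro exI[of _ "\<lambda>r. moment E (l r) q"]) simp
      qed
    qed simp
  qed
  from choice[OF this] obtain A :: "(plane \<Rightarrow> real) \<Rightarrow> nat \<Rightarrow> real"
    where A: "\<forall>q. q \<in> Bi \<longrightarrow> (\<forall>\<phi>\<in>?W. moment E \<phi> q = (\<Sum>r = 1..S. A q r * \<delta> r \<phi>))"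
    by (elim exE) (rule that)
  have C1: "\<exists>c :: nat \<Rightarrow> real. \<forall>\<phi>\<in>?W. moment E \<phi> q = (\<Sum>r = 1..S. c r * \<delta> r \<phi>)" if q: "q \<in> ?P" for q
  proof -
    have "span Bi = ?P" using Bi by (simp add: is_basis_def)
    then obtain x where x: "q = (\<Sum>p\<in>Bi. x p *\<^sub>R p)" using q span_finite[OF fB] by auto
    have "moment E \<phi> q = (\<Sum>r = 1..S. (\<Sum>p\<in>Bi. x p * A p r) * \<delta> r \<phi>)" if \<phi>: "\<phi> \<in> ?W" for \<phi>
    proof -
      have c: "continuous_on (closure E) \<phi>" by (rule Vkk_continuous[OF setting]) (use \<phi> WV in blast)
      have "moment E \<phi> q = (\<Sum>p\<in>Bi. x p * moment E \<phi> p)"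
        unfolding x by (rule linear_functional_on_sum[OF moment_linear_right[OF setting c] subspace_Pk BP])
      also have "\<dots> = (\<Sum>p\<in>Bi. \<Sum>r = 1..S. x p * A p r * \<delta> r \<phi>)"
        using A \<phi> by (intro sum.cong) (simp_all add: sum_distrib_left mult.assoc)
      also have "\<dots> = (\<Sum>r = 1..S. \<Sum>p\<in>Bi. x p * A p r * \<delta> r \<phi>)" by (rule sum.swap)
      finally show ?thesis by (simp add: sum_distrib_right)
    qed
    then show ?thesis by (intro exI[of _ "\<lambda>r. \<Sum>p\<in>Bi. x p * A p r"]) simp
  qed
  (* The coefficients of the projection are the polynomials whose moments are those linear forms. *)
  have C2: "\<exists>l. (\<forall>r\<in>{1..S}. l r \<in> ?P) \<and> (\<forall>\<phi>\<in>?W. Pi0 k E \<phi> = (\<Sum>r = 1..S. \<delta> r \<phi> *\<^sub>R l r))"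
  proof -
    have "\<forall>r. \<exists>p. p \<in> ?P \<and> (\<forall>q\<in>Bi. moment E p q = A q r)"
    proof
      fix r show "\<exists>p. p \<in> ?P \<and> (\<forall>q\<in>Bi. moment E p q = A q r)"
        using polynomial_with_moments[OF setting, of "\<lambda>q. A q r"] by blast
    qed
    from choice[OF this] obtain m where m: "\<forall>r. m r \<in> ?P \<and> (\<forall>q\<in>Bi. moment E (m r) q = A q r)"
      by (elim exE) (rule that)
    have "Pi0 k E \<phi> = (\<Sum>r = 1..S. \<delta> r \<phi> *\<^sub>R m r)" if \<phi>: "\<phi> \<in> ?W" for \<phi>
    proof (rule Pi0_eqI[OF setting])
      show "continuous_on (closure E) \<phi>" by (rule Vkk_continuous[OF setting]) (use \<phi> WV in blast)
      show "(\<Sum>r = 1..S. \<delta> r \<phi> *\<^sub>R m r) \<in> ?P"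
        using m by (intro subspace_sum[OF subspace_Pk] subspace_scale[OF subspace_Pk]) auto
      show "\<forall>q\<in>Bi. moment E (\<Sum>r = 1..S. \<delta> r \<phi> *\<^sub>R m r) q = moment E \<phi> q"
      proof
        fix q assume q: "q \<in> Bi"
        have "moment E (\<Sum>r = 1..S. \<delta> r \<phi> *\<^sub>R m r) q = (\<Sum>r = 1..S. \<delta> r \<phi> * moment E (m r) q)"
          by (rule linear_functional_on_sum[OF moment_linear_left[OF setting BP[OF q]] V]) (use m PV in blast)
        also have "\<dots> = moment E \<phi> q" using A m q \<phi> by (simp add: mult.commute)
        finally show "moment E (\<Sum>r = 1..S. \<delta> r \<phi> *\<^sub>R m r) q = moment E \<phi> q" .
      qed
    qed
    then show ?thesis using m by blast
  qed
  have C3: "\<exists>l. (\<forall>r\<in>{1..S}. l r \<in> ?P) \<and> (\<forall>\<phi>\<in>?W. ?\<Pi> \<phi> = (\<Sum>r = 1..S. \<delta> r \<phi> *\<^sub>R l r))"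
    using l WV by blast
  have "Pi0_computable k E vs Bi \<sigma> S \<delta> b"
    unfolding Pi0_computable_def
  proof (intro conjI ballI)
    show "\<exists>c. \<forall>\<phi>\<in>?W. moment E \<phi> q = (\<Sum>r = 1..S. c r * \<delta> r \<phi>)" if "q \<in> ?P" for q by (rule C1[OF that])
    show "InternalMoment q \<in> \<sigma> ` {1..S} \<or> (\<forall>\<phi>\<in>?W. moment E \<phi> q = moment E (?\<Pi> \<phi>) q)" if "q \<in> Bi" for q
      by (rule alt[OF that])
  qed (rule C2, rule C3)
  then show ?thesis using W dimW uni PW by blast
qed

end
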